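(* (Radford's Formula) Let $H$ be a finite dimensional quasi-Hopf algebra over a field $\mathbf k$ with modulus $\mu$. Let $\lambda$ be a left cointegral on $H$ and $r\in H$ a right integral with $\lambda(r)=1$, and let $u:=(\lambda\otimes\mathrm{id})(\bar\Delta(r))\in H$ be the comodulus of $H$. For $a\in H$ put $S_\mu(a):=S(a)\leftharpoonup\mu$, and put $v:=(\mathrm{id}\otimes\lambda\circ S)(\bar\Delta(r))$. Then $u$ is invertible with $$u^{-1}=S^2(v)=S_\mu^{-2}(v)$$ and $$u^{-1}\,a\,u=S^2(S_\mu^2(a))\qquad\text{for all }a\in H .$$
   Context: Quasi-Hopf algebras. $\mathbf k$ is a field, algebras are unital. A quasi-bialgebra $(H,\Delta,\epsilon,\phi)$ is a unital $\mathbf k$-algebra $H$ with unital algebra morphisms $\Delta:H\to H\otimes H$, $\epsilon:H\to\mathbf k$ and an invertible $\phi\in H\otimes H\otimes H$ such that $(\mathrm{id}\otimes\Delta)(\Delta(a))\,\phi=\phi\,(\Delta\otimes\mathrm{id})(\Delta(a))$ for all $a\in H$; $(\mathrm{id}\otimes\mathrm{id}\otimes\Delta)(\phi)(\Delta\otimes\mathrm{id}\otimes\mathrm{id})(\phi)=(\mathbf 1\otimes\phi)(\mathrm{id}\otimes\Delta\otimes\mathrm{id})(\phi)(\phi\otimes\mathbf 1)$; $(\epsilon\otimes\mathrm{id})\circ\Delta=\mathrm{id}=(\mathrm{id}\otimes\epsilon)\circ\Delta$; $(\mathrm{id}\otimes\epsilon\otimes\mathrm{id})(\phi)=\mathbf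 1\otimes\mathbf 1$. Write $\Delta(a)=a_{(1)}\otimes a_{(2)}$, $\Delta^{op}(a)=a_{(2)}\otimes a_{(1)}$, $\phi=X^j\otimes Y^j\otimes Z^j$, $\phi^{-1}=\bar X^j\otimes\bar Y^j\otimes\bar Z^j$ (summation suppressed); for $x=x^1\otimes x^2$ put $x^{21}=x^2\otimes x^1$. $H$ is a quasi-Hopf algebra if there are an algebra anti-morphism $S:H\to H$ and $\alpha,\beta\in H$ with $S(a_{(1)})\alpha a_{(2)}=\epsilon(a)\alpha$, $a_{(1)}\beta S(a_{(2)})=\epsilon(a)\beta$ for all $a$, and $X^j\beta S(Y^j)\alpha Z^j=\mathbf 1=S(\bar X^j)\alpha\bar Y^j\beta S(\bar Z^j)$. Standing conventions: $S$ is invertible and $\epsilon(\alpha)=\epsilon(\beta)=1$. Notation. $a\leftharpoonup\mu:=\mu(a_{(1)})a_{(2)}$, so $S_\mu(a)=\mu(S(a)_{(1)})\,S(a)_{(2)}$; $S_\mu$ is a bijection of $H$, $S_\mu^2=S_\mu\circ S_\mu$ and $S_\mu^{-2}$ is its inverse. Special elements. $q_R=q_R^1\otimes q_R^2:=X^i\otimes S^{-1}(\alpha Z^i)Y^i$, $p_R:=\bar X^i\otimes\bar Y^i\beta S(\bar Z^i)$. With $T^i\otimes U^i\otimes V^i\otimes W^i:=(\mathbf 1\otimes\phi^{-1})(\mathrm{id}\otimes\mathrm{id}\otimes\Delta)(\phi)$ let $\gamma:=S(U^i)\alpha V^i\otimes S(T^i)\alpha W^i$. Drinfeld's element $f:=(S\otimes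 S)(\Delta^{op}(\bar X^i))\,\gamma\,\Delta(\bar Y^i\beta S(\bar Z^i))$ is invertible. Put $h:=(S^{-1}\otimes S^{-1})(f^{21})$, $U:=f^{-1}(S\otimes S)(q_R^{21})$, $V:=(S^{-1}\otimes S^{-1})(p_R^{21})h$ and $\bar\Delta(a):=V\Delta(a)U$. Left cointegrals. Let $\hat H=\mathrm{Hom}_{\mathbf k}(H,\mathbf k)$, $\{b_i\}$ a basis of $H$ with dual basis $\{b^i\}\subset\hat H$. Define $E(\psi)(a)=\sum_i(b^i\otimes\psi)\big(\bar\Delta(S^{-1}(q_R^1)\,a\,S^2(q_R^2b_i)S(\beta))\big)$ for $\psi\in\hat H$. A left cointegral is $\lambda\in\hat H$ with $E(\lambda)=\lambda$. The space $\mathcal L$ of left cointegrals and the space $R=\{r\in H\mid ra=\epsilon(a)r\ \forall a\}$ of right integrals are one dimensional, and $\mathcal L\otimes R\ni\lambda\otimes r\mapsto\lambda(r)$ is nondegenerate. Modulus. The modulus of $H$ is the algebra morphism $\mu:H\to\mathbf k$ with $la=\mu(a)l$ for all left integrals $l$ (i.e. $l\in H$ with $al=\epsilon(a)l$ for all $a$), the space of which is one dimensional. *)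

theory Defs
  imports Complex_Main "HOL-Library.Function_Algebras"
begin

section \<open>Algebras over a field and tensor powers\<close>

locale unital_algebra = vector_space scale
  for scale :: "'k::field \<Rightarrow> 'h::ring_1 \<Rightarrow> 'h" +
  assumes mult_scale_left: "scale c a * b = scale c (a * b)"
    and mult_scale_right: "a * scale c b = scale c (a * b)"

text \<open>
  \<open>H \<otimes> H\<close> is realised as the image of the canonical embedding into the bilinear forms on the
  dual space: the simple tensor \<open>a \<otimes> b\<close> is \<open>(f, g) \<mapsto> f(a) g(b)\<close>, and \<open>H \<otimes> H\<close> consists of the
  finite sums of simple tensors (this embedding is injective over any field, in any dimension).
  Addition of tensors is the pointwise addition of functions.  The value at non-linear \<open>f\<close>, \<open>g\<close> is
  irrelevant and set to 0, so that bilinearity of \<open>\<otimes>\<close> holds as an equality of functions.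
  Threefold and fourfold tensors are treated in the same way.  The pointwise product of functions
  is never used: the algebra structures are \<open>mult2\<close>, \<open>mult3\<close>, \<open>mult4\<close> below.
\<close>

type_synonym ('k, 'h) tensor2 = "('h \<Rightarrow> 'k) \<Rightarrow> ('h \<Rightarrow> 'k) \<Rightarrow> 'k"
type_synonym ('k, 'h) tensor3 = "('h \<Rightarrow> 'k) \<Rightarrow> ('h \<Rightarrow> 'k) \<Rightarrow> ('h \<Rightarrow> 'k) \<Rightarrow> 'k"
type_synonym ('k, 'h) tensor4 =
  "('h \<Rightarrow> 'k) \<Rightarrow> ('h \<Rightarrow> 'k) \<Rightarrow> ('h \<Rightarrow> 'k) \<Rightarrow> ('h \<Rightarrow> 'k) \<Rightarrow> 'k"

context unital_algebra
begin

definition dual :: "('h \<Rightarrow> 'k) set" where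
  "dual = {f. Vector_Spaces.linear scale (*) f}"

definition algebra_character :: "('h \<Rightarrow> 'k) \<Rightarrow> bool" where
  "algebra_character f \<longleftrightarrow> f \<in> dual \<and> f 1 = 1 \<and> (\<forall>a b. f (a * b) = f a * f b)"

definition ten2 :: "'h \<Rightarrow> 'h \<Rightarrow> ('k, 'h) tensor2" (infix "\<otimes>" 72) where
  "a \<otimes> b = (\<lambda>f g. if f \<in> dual \<and> g \<in> dual then f a * g b else 0)"

definition ten3 :: "'h \<Rightarrow> 'h \<Rightarrow> 'h \<Rightarrow> ('k, 'h) tensor3" where
  "ten3 a b c = (\<lambda>f g h. if {f, g, h} \<subseteq> dual then f a * g b * h c else 0)"

definition ten4 :: "'h \<Rightarrow> 'h \<Rightarrow> 'h \<Rightarrow> 'h \<Rightarrow> ('k, 'h) tensor4" where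
  "ten4 a b c d = (\<lambda>f g h k. if {f, g, h, k} \<subseteq> dual then f a * g b * h c * k d else 0)"

definition tensors2 :: "('k, 'h) tensor2 set" where
  "tensors2 = {t. \<exists>xs. t = (\<Sum>(a, b)\<leftarrow>xs. a \<otimes> b)}"

definition tensors3 :: "('k, 'h) tensor3 set" where
  "tensors3 = {t. \<exists>xs. t = (\<Sum>(a, b, c)\<leftarrow>xs. ten3 a b c)}"

definition tensors4 :: "('k, 'h) tensor4 set" where
  "tensors4 = {t. \<exists>xs. t = (\<Sum>(a, b, c, d)\<leftarrow>xs. ten4 a b c d)}"

text \<open>
  \<open>lift2 F\<close> is the linear map on \<open>H \<otimes> H\<close> induced by a bilinear map \<open>F\<close>, i.e.
  \<open>lift2 F (\<Sum>i. a\<^sub>i \<otimes> b\<^sub>i) = (\<Sum>i. F a\<^sub>i b\<^sub>i)\<close>; see \<open>lift2_eq\<close> below for well-definedness.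
  It renders the Sweedler convention: an expression \<open>F(t\<^sup>1, t\<^sup>2)\<close> in the components of
  \<open>t = t\<^sup>1 \<otimes> t\<^sup>2\<close> (summation suppressed) is \<open>lift2 F t\<close>.
\<close>

definition lift2 :: "('h \<Rightarrow> 'h \<Rightarrow> 'w::comm_monoid_add) \<Rightarrow> ('k, 'h) tensor2 \<Rightarrow> 'w" where
  "lift2 F t = (THE v. \<exists>xs. t = (\<Sum>(a, b)\<leftarrow>xs. a \<otimes> b) \<and> v = (\<Sum>(a, b)\<leftarrow>xs. F a b))"

definition lift3 :: "('h \<Rightarrow> 'h \<Rightarrow> 'h \<Rightarrow> 'w::comm_monoid_add) \<Rightarrow> ('k, 'h) tensor3 \<Rightarrow> 'w" where
  "lift3 F t =
    (THE v. \<exists>xs. t = (\<Sum>(a, b, c)\<leftarrow>xs. ten3 a b c) \<and> v = (\<Sum>(a, b, c)\<leftarrow>xs. F a b c))"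

definition lift4 :: "('h \<Rightarrow> 'h \<Rightarrow> 'h \<Rightarrow> 'h \<Rightarrow> 'w::comm_monoid_add) \<Rightarrow> ('k, 'h) tensor4 \<Rightarrow> 'w" where
  "lift4 F t =
    (THE v. \<exists>xs. t = (\<Sum>(a, b, c, d)\<leftarrow>xs. ten4 a b c d) \<and> v = (\<Sum>(a, b, c, d)\<leftarrow>xs. F a b c d))"

context
  fixes scaleW :: "'k \<Rightarrow> 'w::ab_group_add \<Rightarrow> 'w"
  assumes W: "vector_space scaleW"
begin

interpretation W: vector_space scaleW by (rule W)

private abbreviation (input) lin :: "('h \<Rightarrow> 'w) \<Rightarrow> bool" where
  "lin \<equiv> Vector_Spaces.linear scale scaleW"

private abbreviation (input) B where "B \<equiv> extend_basis {}"
private abbreviation (input) rep where "rep i a \<equiv> representation B a i"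

private lemma basis: "independent B" "span B = UNIV"
  using independent_extend_basis[of "{}"] span_extend_basis[of "{}"]
  by (simp_all add: independent_empty)

private lemma rep_dual: "rep i \<in> dual"
proof -
  have "vector_space ((*) :: 'k \<Rightarrow> 'k \<Rightarrow> 'k)"
    by unfold_locales (auto simp: algebra_simps)
  then have "Vector_Spaces.linear scale (*) (rep i)"
    by (simp add: Vector_Spaces.linear_iff vector_space_axioms basis
      representation_add representation_scale)
  then show ?thesis by (simp add: dual_def)
qed

private definition supp :: "'h \<Rightarrow> 'h set" where "supp a = {i. rep i a \<noteq> 0}"

private lemma finite_supp: "finite (supp a)"
  unfolding supp_def by (rule finite_representation)

private lemma expand: assumes "finite I" "supp a \<subseteq> I" shows "a = (\<Sum>i\<in>I. scale (rep i a) i)"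
proof -
  have "(\<Sum>i\<in>I. scale (rep i a) i) = (\<Sum>i\<in>supp a. scale (rep i a) i)"
    by (rule sum.mono_neutral_right) (use assms in \<open>auto simp: supp_def\<close>)
  also have "\<dots> = a"
    unfolding supp_def by (rule sum_nonzero_representation_eq) (simp_all add: basis)
  finally show ?thesis by simp
qed

private lemma expand_lin:
  assumes "lin F" "finite I" "supp a \<subseteq> I"
  shows "F a = (\<Sum>i\<in>I. scaleW (rep i a) (F i))"
proof -
  interpret F: Vector_Spaces.linear scale scaleW F by fact
  have "F a = F (\<Sum>i\<in>I. scale (rep i a) i)" using expand[OF assms(2,3)] by simp
  also have "\<dots> = (\<Sum>i\<in>I. scaleW (rep i a) (F i))" by (simp add: F.sum F.scale)
  finally show ?thesis .
qed

private lemma expand2: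
  assumes "\<And>b. lin (\<lambda>a. F a b)" "\<And>a. lin (\<lambda>b. F a b)"
    and "finite I" "supp a \<subseteq> I" "supp b \<subseteq> I"
  shows "F a b = (\<Sum>i\<in>I. \<Sum>j\<in>I. scaleW (rep i a * rep j b) (F i j))"
  by (subst expand_lin[OF assms(1,3,4)], subst expand_lin[OF assms(2,3,5)])
    (simp add: W.scale_sum_right)

private lemma expand3:
  assumes "\<And>b c. lin (\<lambda>a. F a b c)" "\<And>a c. lin (\<lambda>b. F a b c)" "\<And>a b. lin (\<lambda>c. F a b c)"
    and "finite I" "supp a \<subseteq> I" "supp b \<subseteq> I" "supp c \<subseteq> I"
  shows "F a b c = (\<Sum>i\<in>I. \<Sum>j\<in>I. \<Sum>k\<in>I. scaleW (rep i a * rep j b * rep k c) (F i j k))"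
  by (subst expand_lin[OF assms(1,4,5)], subst expand2[OF assms(2,3,4,6,7)])
    (simp add: W.scale_sum_right mult.assoc)

private lemma expand4:
  assumes "\<And>b c d. lin (\<lambda>a. F a b c d)" "\<And>a c d. lin (\<lambda>b. F a b c d)"
    "\<And>a b d. lin (\<lambda>c. F a b c d)" "\<And>a b c. lin (\<lambda>d. F a b c d)"
    and "finite I" "supp a \<subseteq> I" "supp b \<subseteq> I" "supp c \<subseteq> I" "supp d \<subseteq> I"
  shows "F a b c d =
    (\<Sum>i\<in>I. \<Sum>j\<in>I. \<Sum>k\<in>I. \<Sum>l\<in>I. scaleW (rep i a * rep j b * rep k c * rep l d) (F i j k l))"
  by (subst expand_lin[OF assms(1,5,6)], subst expand3[OF assms(2,3,4,5,7,8,9)])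
    (simp add: W.scale_sum_right mult.assoc)

private lemma sum2:
  assumes "\<And>b. lin (\<lambda>a. F a b)" "\<And>a. lin (\<lambda>b. F a b)" "finite I"
    and "\<forall>(a, b)\<in>set xs. supp a \<union> supp b \<subseteq> I"
  shows "(\<Sum>(a, b)\<leftarrow>xs. F a b) =
    (\<Sum>i\<in>I. \<Sum>j\<in>I. scaleW ((\<Sum>(a, b)\<leftarrow>xs. a \<otimes> b) (rep i) (rep j)) (F i j))"
  using assms(4)
proof (induction xs)
  case (Cons x xs)
  obtain a b where x: "x = (a, b)" by (cases x)
  have "F a b = (\<Sum>i\<in>I. \<Sum>j\<in>I. scaleW (rep i a * rep j b) (F i j))"
    by (rule expand2) (use assms Cons.prems x in auto)
  with Cons x show ?case
    by (simp add: ten2_def rep_dual W.scale_left_distrib sum.distrib)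
qed simp

private lemma sum3:
  assumes "\<And>b c. lin (\<lambda>a. F a b c)" "\<And>a c. lin (\<lambda>b. F a b c)" "\<And>a b. lin (\<lambda>c. F a b c)"
    and "finite I" "\<forall>(a, b, c)\<in>set xs. supp a \<union> supp b \<union> supp c \<subseteq> I"
  shows "(\<Sum>(a, b, c)\<leftarrow>xs. F a b c) = (\<Sum>i\<in>I. \<Sum>j\<in>I. \<Sum>k\<in>I.
    scaleW ((\<Sum>(a, b, c)\<leftarrow>xs. ten3 a b c) (rep i) (rep j) (rep k)) (F i j k))"
  using assms(5)
proof (induction xs)
  case (Cons x xs)
  obtain a b c where x: "x = (a, b, c)" by (cases x)
  have "F a b c = (\<Sum>i\<in>I. \<Sum>j\<in>I. \<Sum>k\<in>I. scaleW (rep i a * rep j b * rep k c) (F i j k))"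
    by (rule expand3) (use assms Cons.prems x in auto)
  with Cons x show ?case
    by (simp add: ten3_def rep_dual W.scale_left_distrib sum.distrib)
qed simp

private lemma sum4:
  assumes "\<And>b c d. lin (\<lambda>a. F a b c d)" "\<And>a c d. lin (\<lambda>b. F a b c d)"
    "\<And>a b d. lin (\<lambda>c. F a b c d)" "\<And>a b c. lin (\<lambda>d. F a b c d)"
    and "finite I" "\<forall>(a, b, c, d)\<in>set xs. supp a \<union> supp b \<union> supp c \<union> supp d \<subseteq> I"
  shows "(\<Sum>(a, b, c, d)\<leftarrow>xs. F a b c d) = (\<Sum>i\<in>I. \<Sum>j\<in>I. \<Sum>k\<in>I. \<Sum>l\<in>I.
    scaleW ((\<Sum>(a, b, c, d)\<leftarrow>xs. ten4 a b c d) (rep i) (rep j) (rep k) (rep l)) (F i j k l))"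
  using assms(6)
proof (induction xs)
  case (Cons x xs)
  obtain a b c d where x: "x = (a, b, c, d)" by (cases x)
  have "F a b c d =
    (\<Sum>i\<in>I. \<Sum>j\<in>I. \<Sum>k\<in>I. \<Sum>l\<in>I. scaleW (rep i a * rep j b * rep k c * rep l d) (F i j k l))"
    by (rule expand4) (use assms Cons.prems x in auto)
  with Cons x show ?case
    by (simp add: ten4_def rep_dual W.scale_left_distrib sum.distrib)
qed simp

lemma lift2_eq:
  assumes "\<And>b. lin (\<lambda>a. F a b)" "\<And>a. lin (\<lambda>b. F a b)"
  shows "lift2 F (\<Sum>(a, b)\<leftarrow>xs. a \<otimes> b) = (\<Sum>(a, b)\<leftarrow>xs. F a b)"
proof -
  have "(\<Sum>(a, b)\<leftarrow>xs. F a b) = (\<Sum>(a, b)\<leftarrow>ys. F a b)"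
    if eq: "(\<Sum>(a, b)\<leftarrow>xs. a \<otimes> b) = (\<Sum>(a, b)\<leftarrow>ys. a \<otimes> b)" for ys
  proof -
    let ?I = "\<Union>(a, b)\<in>set xs \<union> set ys. supp a \<union> supp b"
    have fin: "finite ?I" by (auto simp: finite_supp)
    have "\<forall>(a, b)\<in>set xs. supp a \<union> supp b \<subseteq> ?I" "\<forall>(a, b)\<in>set ys. supp a \<union> supp b \<subseteq> ?I"
      by blast+
    then show ?thesis
      by (simp only: sum2[where F = F, OF assms fin] eq)
  qed
  note indep = this
  show ?thesis unfolding lift2_def
    by (rule the_equality)
      (rule exI[of _ xs], rule conjI, rule refl, rule refl, elim exE conjE, drule indep, simp only:)
qed

lemma lift3_eq:
  assumes "\<And>b c. lin (\<lambda>a. F a b c)" "\<And>a c. lin (\<lambda>b. F a b c)" "\<And>a b. lin (\<lambda>c. F a b c)"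
  shows "lift3 F (\<Sum>(a, b, c)\<leftarrow>xs. ten3 a b c) = (\<Sum>(a, b, c)\<leftarrow>xs. F a b c)"
proof -
  have "(\<Sum>(a, b, c)\<leftarrow>xs. F a b c) = (\<Sum>(a, b, c)\<leftarrow>ys. F a b c)"
    if eq: "(\<Sum>(a, b, c)\<leftarrow>xs. ten3 a b c) = (\<Sum>(a, b, c)\<leftarrow>ys. ten3 a b c)" for ys
  proof -
    let ?I = "\<Union>(a, b, c)\<in>set xs \<union> set ys. supp a \<union> supp b \<union> supp c"
    have fin: "finite ?I" by (auto simp: finite_supp)
    have "\<forall>(a, b, c)\<in>set xs. supp a \<union> supp b \<union> supp c \<subseteq> ?I" "\<forall>(a, b, c)\<in>set ys. supp a \<union> supp b \<union> supp c \<subseteq> ?I"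
      by blast+
    then show ?thesis
      by (simp only: sum3[where F = F, OF assms fin] eq)
  qed
  note indep = this
  show ?thesis unfolding lift3_def
    by (rule the_equality)
      (rule exI[of _ xs], rule conjI, rule refl, rule refl, elim exE conjE, drule indep, simp only:)
qed

lemma lift4_eq:
  assumes "\<And>b c d. lin (\<lambda>a. F a b c d)" "\<And>a c d. lin (\<lambda>b. F a b c d)"
    "\<And>a b d. lin (\<lambda>c. F a b c d)" "\<And>a b c. lin (\<lambda>d. F a b c d)"
  shows "lift4 F (\<Sum>(a, b, c, d)\<leftarrow>xs. ten4 a b c d) = (\<Sum>(a, b, c, d)\<leftarrow>xs. F a b c d)"
proof -
  have "(\<Sum>(a, b, c, d)\<leftarrow>xs. F a b c d) = (\<Sum>(a, b, c, d)\<leftarrow>ys. F a b c d)"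
    if eq: "(\<Sum>(a, b, c, d)\<leftarrow>xs. ten4 a b c d) = (\<Sum>(a, b, c, d)\<leftarrow>ys. ten4 a b c d)" for ys
  proof -
    let ?I = "\<Union>(a, b, c, d)\<in>set xs \<union> set ys. supp a \<union> supp b \<union> supp c \<union> supp d"
    have fin: "finite ?I" by (auto simp: finite_supp)
    have "\<forall>(a, b, c, d)\<in>set xs. supp a \<union> supp b \<union> supp c \<union> supp d \<subseteq> ?I" "\<forall>(a, b, c, d)\<in>set ys. supp a \<union> supp b \<union> supp c \<union> supp d \<subseteq> ?I"
      by blast+
    then show ?thesis
      by (simp only: sum4[where F = F, OF assms fin] eq)
  qed
  note indep = this
  show ?thesis unfolding lift4_def
    by (rule the_equality)
      (rule exI[of _ xs], rule conjI, rule refl, rule refl, elim exE conjE, drule indep, simp only:)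
qed

end

definition mult2 :: "('k, 'h) tensor2 \<Rightarrow> ('k, 'h) tensor2 \<Rightarrow> ('k, 'h) tensor2"
    (infixl "\<bullet>" 70) where
  "s \<bullet> t = lift2 (\<lambda>a b. lift2 (\<lambda>a' b'. (a * a') \<otimes> (b * b')) t) s"

definition mult3 :: "('k, 'h) tensor3 \<Rightarrow> ('k, 'h) tensor3 \<Rightarrow> ('k, 'h) tensor3"
    (infixl "\<bullet>\<^sub>3" 70) where
  "s \<bullet>\<^sub>3 t = lift3 (\<lambda>a b c. lift3 (\<lambda>a' b' c'. ten3 (a * a') (b * b') (c * c')) t) s"

definition mult4 :: "('k, 'h) tensor4 \<Rightarrow> ('k, 'h) tensor4 \<Rightarrow> ('k, 'h) tensor4"
    (infixl "\<bullet>\<^sub>4" 70) where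
  "s \<bullet>\<^sub>4 t = lift4 (\<lambda>a b c d. lift4 (\<lambda>a' b' c' d'.
     ten4 (a * a') (b * b') (c * c') (d * d')) t) s"

definition is_inverse2 :: "('k, 'h) tensor2 \<Rightarrow> ('k, 'h) tensor2 \<Rightarrow> bool" where
  "is_inverse2 s t \<longleftrightarrow> t \<in> tensors2 \<and> s \<bullet> t = 1 \<otimes> 1 \<and> t \<bullet> s = 1 \<otimes> 1"

definition is_inverse3 :: "('k, 'h) tensor3 \<Rightarrow> ('k, 'h) tensor3 \<Rightarrow> bool" where
  "is_inverse3 s t \<longleftrightarrow> t \<in> tensors3 \<and> s \<bullet>\<^sub>3 t = ten3 1 1 1 \<and> t \<bullet>\<^sub>3 s = ten3 1 1 1"

definition inverse2 :: "('k, 'h) tensor2 \<Rightarrow> ('k, 'h) tensor2" where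
  "inverse2 s = (THE t. is_inverse2 s t)"

definition inverse3 :: "('k, 'h) tensor3 \<Rightarrow> ('k, 'h) tensor3" where
  "inverse3 s = (THE t. is_inverse3 s t)"

definition flip :: "('k, 'h) tensor2 \<Rightarrow> ('k, 'h) tensor2" where
  "flip t = lift2 (\<lambda>a b. b \<otimes> a) t"

definition map2 :: "('h \<Rightarrow> 'h) \<Rightarrow> ('h \<Rightarrow> 'h) \<Rightarrow> ('k, 'h) tensor2 \<Rightarrow> ('k, 'h) tensor2" where
  "map2 F G t = lift2 (\<lambda>a b. F a \<otimes> G b) t"

definition one_ten3 :: "('k, 'h) tensor3 \<Rightarrow> ('k, 'h) tensor4" where
  "one_ten3 t = lift3 (\<lambda>a b c. ten4 1 a b c) t"

definition ten3_one :: "('k, 'h) tensor3 \<Rightarrow> ('k, 'h) tensor4" where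
  "ten3_one t = lift3 (\<lambda>a b c. ten4 a b c 1) t"

end


section \<open>Quasi-Hopf algebras\<close>

text \<open>Sum, product and unit of \<open>H\<close> are those of the type \<open>'h\<close>.\<close>

record ('k, 'h) quasi_hopf_data =
  smult :: "'k \<Rightarrow> 'h \<Rightarrow> 'h"
  comult :: "'h \<Rightarrow> ('k, 'h) tensor2"
  counit :: "'h \<Rightarrow> 'k"
  reassoc :: "('k, 'h) tensor3"
  antipode :: "'h \<Rightarrow> 'h"
  alpha :: "'h"
  beta :: "'h"

locale quasi_hopf_signature = unital_algebra "smult H"
  for H :: "('k::field, 'h::ring_1) quasi_hopf_data"
begin

notation ten2 (infix "\<otimes>" 72)
  and mult2 (infixl "\<bullet>" 70)
  and mult3 (infixl "\<bullet>\<^sub>3" 70)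
  and mult4 (infixl "\<bullet>\<^sub>4" 70)

abbreviation \<Delta> where "\<Delta> \<equiv> comult H"
abbreviation \<epsilon> where "\<epsilon> \<equiv> counit H"
abbreviation \<phi> where "\<phi> \<equiv> reassoc H"
abbreviation S where "S \<equiv> antipode H"
abbreviation \<alpha> where "\<alpha> \<equiv> alpha H"
abbreviation \<beta> where "\<beta> \<equiv> beta H"

definition id_comult :: "('k, 'h) tensor2 \<Rightarrow> ('k, 'h) tensor3" where
  "id_comult t = lift2 (\<lambda>a b. lift2 (\<lambda>b1 b2. ten3 a b1 b2) (\<Delta> b)) t"

definition comult_id :: "('k, 'h) tensor2 \<Rightarrow> ('k, 'h) tensor3" where
  "comult_id t = lift2 (\<lambda>a b. lift2 (\<lambda>a1 a2. ten3 a1 a2 b) (\<Delta> a)) t"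

definition comult_id_id :: "('k, 'h) tensor3 \<Rightarrow> ('k, 'h) tensor4" where
  "comult_id_id t = lift3 (\<lambda>a b c. lift2 (\<lambda>a1 a2. ten4 a1 a2 b c) (\<Delta> a)) t"

definition id_comult_id :: "('k, 'h) tensor3 \<Rightarrow> ('k, 'h) tensor4" where
  "id_comult_id t = lift3 (\<lambda>a b c. lift2 (\<lambda>b1 b2. ten4 a b1 b2 c) (\<Delta> b)) t"

definition id_id_comult :: "('k, 'h) tensor3 \<Rightarrow> ('k, 'h) tensor4" where
  "id_id_comult t = lift3 (\<lambda>a b c. lift2 (\<lambda>c1 c2. ten4 a b c1 c2) (\<Delta> c)) t"

end

locale quasi_bialgebra = quasi_hopf_signature H
  for H :: "('k::field, 'h::ring_1) quasi_hopf_data" +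
  assumes comult_closed: "\<Delta> a \<in> tensors2"
    and comult_add: "\<Delta> (a + b) = \<Delta> a + \<Delta> b"
    and comult_smult: "\<Delta> (smult H c a) = (\<lambda>f g. c * \<Delta> a f g)"
    and comult_mult: "\<Delta> (a * b) = \<Delta> a \<bullet> \<Delta> b"
    and comult_one: "\<Delta> 1 = 1 \<otimes> 1"
    and counit_character: "algebra_character \<epsilon>"
    and reassoc_closed: "\<phi> \<in> tensors3"
    and reassoc_invertible: "\<exists>t. is_inverse3 \<phi> t"
    and quasi_coassoc: "id_comult (\<Delta> a) \<bullet>\<^sub>3 \<phi> = \<phi> \<bullet>\<^sub>3 comult_id (\<Delta> a)"
    and pentagon:
      "id_id_comult \<phi> \<bullet>\<^sub>4 comult_id_id \<phi> = one_ten3 \<phi> \<bullet>\<^sub>4 id_comult_id \<phi> \<bullet>\<^sub>4 ten3_one \<phi>"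
    and counit_left: "lift2 (\<lambda>a1 a2. smult H (\<epsilon> a1) a2) (\<Delta> a) = a"
    and counit_right: "lift2 (\<lambda>a1 a2. smult H (\<epsilon> a2) a1) (\<Delta> a) = a"
    and counit_reassoc: "lift3 (\<lambda>x y z. smult H (\<epsilon> y) x \<otimes> z) \<phi> = 1 \<otimes> 1"

text \<open>
  As a standing convention the antipode is bijective and \<open>\<alpha>\<close>, \<open>\<beta>\<close> are normalised.
\<close>

locale quasi_hopf_algebra = quasi_bialgebra H
  for H :: "('k::field, 'h::ring_1) quasi_hopf_data" +
  assumes antipode_linear: "Vector_Spaces.linear (smult H) (smult H) S"
    and antipode_mult: "S (a * b) = S b * S a"
    and antipode_one: "S 1 = 1"
    and antipode_alpha: "lift2 (\<lambda>a1 a2. S a1 * \<alpha> * a2) (\<Delta> a) = smult H (\<epsilon> a) \<alpha>"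
    and antipode_beta: "lift2 (\<lambda>a1 a2. a1 * \<beta> * S a2) (\<Delta> a) = smult H (\<epsilon> a) \<beta>"
    and antipode_reassoc: "lift3 (\<lambda>x y z. x * \<beta> * S y * \<alpha> * z) \<phi> = 1"
    and antipode_reassoc_inverse:
      "lift3 (\<lambda>x y z. S x * \<alpha> * y * \<beta> * S z) (inverse3 \<phi>) = 1"
    and antipode_bij: "bij S"
    and counit_alpha: "\<epsilon> \<alpha> = 1"
    and counit_beta: "\<epsilon> \<beta> = 1"
begin

abbreviation S_inv :: "'h \<Rightarrow> 'h" where "S_inv \<equiv> inv S"

definition q_R :: "('k, 'h) tensor2" where
  "q_R = lift3 (\<lambda>x y z. x \<otimes> (S_inv (\<alpha> * z) * y)) \<phi>"

definition p_R :: "('k, 'h) tensor2" where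
  "p_R = lift3 (\<lambda>x y z. x \<otimes> (y * \<beta> * S z)) (inverse3 \<phi>)"

definition gamma :: "('k, 'h) tensor2" where
  "gamma = lift4 (\<lambda>t u v w. (S u * \<alpha> * v) \<otimes> (S t * \<alpha> * w))
    (one_ten3 (inverse3 \<phi>) \<bullet>\<^sub>4 id_id_comult \<phi>)"

definition drinfeld_f :: "('k, 'h) tensor2" where
  "drinfeld_f = lift3 (\<lambda>x y z. map2 S S (flip (\<Delta> x)) \<bullet> gamma \<bullet> \<Delta> (y * \<beta> * S z)) (inverse3 \<phi>)"

definition drinfeld_h :: "('k, 'h) tensor2" where
  "drinfeld_h = map2 S_inv S_inv (flip drinfeld_f)"

definition tensor_U :: "('k, 'h) tensor2" where
  "tensor_U = inverse2 drinfeld_f \<bullet> map2 S S (flip q_R)"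

definition tensor_V :: "('k, 'h) tensor2" where
  "tensor_V = map2 S_inv S_inv (flip p_R) \<bullet> drinfeld_h"

definition comult_bar :: "'h \<Rightarrow> ('k, 'h) tensor2" where
  "comult_bar a = tensor_V \<bullet> \<Delta> a \<bullet> tensor_U"

definition left_integral :: "'h \<Rightarrow> bool" where
  "left_integral l \<longleftrightarrow> (\<forall>a. a * l = smult H (\<epsilon> a) l)"

definition right_integral :: "'h \<Rightarrow> bool" where
  "right_integral r \<longleftrightarrow> (\<forall>a. r * a = smult H (\<epsilon> a) r)"

definition modulus :: "('h \<Rightarrow> 'k) \<Rightarrow> bool" where
  "modulus \<mu> \<longleftrightarrow> algebra_character \<mu> \<and>
    (\<forall>l. left_integral l \<longrightarrow> (\<forall>a. l * a = smult H (\<mu> a) l))"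

text \<open>
  \<open>B\<close> is a (finite) basis of \<open>H\<close>; for \<open>b \<in> B\<close> the dual basis element is
  \<open>\<lambda>x. representation B x b\<close>.
\<close>

definition cointegral_map :: "'h set \<Rightarrow> ('h \<Rightarrow> 'k) \<Rightarrow> 'h \<Rightarrow> 'k" where
  "cointegral_map B \<psi> a = (\<Sum>b\<in>B.
     lift2 (\<lambda>q1 q2. lift2 (\<lambda>x y. representation B x b * \<psi> y)
       (comult_bar (S_inv q1 * a * S (S (q2 * b)) * S \<beta>))) q_R)"

definition left_cointegral :: "'h set \<Rightarrow> ('h \<Rightarrow> 'k) \<Rightarrow> bool" where
  "left_cointegral B lam \<longleftrightarrow> lam \<in> dual \<and> cointegral_map B lam = lam"

definition comodulus :: "('h \<Rightarrow> 'k) \<Rightarrow> 'h \<Rightarrow> 'h" where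
  "comodulus lam r = lift2 (\<lambda>x y. smult H (lam x) y) (comult_bar r)"

definition v_element :: "('h \<Rightarrow> 'k) \<Rightarrow> 'h \<Rightarrow> 'h" where
  "v_element lam r = lift2 (\<lambda>x y. smult H (lam (S y)) x) (comult_bar r)"

definition hit_right :: "'h \<Rightarrow> ('h \<Rightarrow> 'k) \<Rightarrow> 'h" (infixl "\<leftharpoonup>" 75) where
  "a \<leftharpoonup> \<mu> = lift2 (\<lambda>a1 a2. smult H (\<mu> a1) a2) (\<Delta> a)"

definition S_mod :: "('h \<Rightarrow> 'k) \<Rightarrow> 'h \<Rightarrow> 'h" where
  "S_mod \<mu> a = S a \<leftharpoonup> \<mu>"

end

end

theory Submission
  imports Defs
begin

text \<open>
  Write \<open>r\<^sub>1 \<otimes> r\<^sub>2\<close> for \<open>V \<Delta>(r) U\<close>.  For a right integral \<open>r\<close> one has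
  \<open>\<Delta>(r) U = \<Delta>(r) p\<^sub>R\<close>, which gives two Casimir identities: \<open>r\<^sub>1 a \<otimes> r\<^sub>2 = r\<^sub>1 \<otimes> r\<^sub>2 S(a)\<close>, and
  \<open>r\<^sub>1 \<otimes> S\<^sup>-\<^sup>1(a) r\<^sub>2 = (a \<leftharpoonup> \<mu>) r\<^sub>1 \<otimes> r\<^sub>2\<close>.  The equation \<open>E(\<lambda>) = \<lambda>\<close> then yields \<open>r\<^sub>1 \<lambda>(r\<^sub>2) = 1\<close>,
  so that \<open>\<lambda>\<close> is a Frobenius functional with Casimir element \<open>r\<^sub>1 \<otimes> r\<^sub>2\<close>, and
  \<open>\<lambda>(S\<^sup>-\<^sup>1(a) y) = \<lambda>(y S(a \<leftharpoonup> \<mu>))\<close> determines its Nakayama automorphism.  By nondegeneracy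
  \<open>\<lambda> \<circ> S\<^sup>-\<^sup>1 = \<lambda>(u \<cdot>)\<close> and \<open>\<lambda> \<circ> S = \<lambda>(\<cdot> S(v))\<close>; comparing these with the Nakayama automorphism
  gives the theorem.
\<close>

section \<open>Evaluating tensors on multilinear forms\<close>

text \<open>The locale gives \<open>inverse2 drinfeld_f\<close> only as a description, so
  \<open>tensor_U\<close> says nothing until f is proved invertible. A right inverse is written down
  explicitly and verified from the antipode axioms and the pentagon; finite dimension makes it
  two-sided. In the equation E(\<lambda>) = \<lambda> one would expect the reassociator twisted by
  f; it is avoided by evaluating a single contraction, \<open>phi_form\<close>, at f p_R, where its
  value is 1 \<otimes> 1. The integral keeps the rest short: a factor \<Delta>(a) to the right of
  \<Delta>(r) shrinks to \<epsilon>(a), so that the Casimir identities come from the covariance of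
  p_R. The shape of the final formula has this origin. The Nakayama relation reads \<lambda>(a y) =
  \<lambda>(y S(S_\<mu>(a))). In \<lambda>(a u y) the element a is carried past u y, the rule
  \<lambda>(u x) = \<lambda>(S^-1(x)) reverses the order, a is carried past once more, and the rule
  is applied backwards. The two passages give S_\<mu> twice and S twice; the first reversal cancels
  one S, the second adds one.\<close>

text \<open>Iterated, this makes tensors a vector space, which \<open>lift2_eq\<close> and its
  analogues require of their target.\<close>

lemma vector_space_fun:
  assumes "vector_space s"
  shows "vector_space (\<lambda>c w x. s c (w x))"
proof -
  interpret vector_space s by fact
  show ?thesis
    by unfold_locales (auto simp: fun_eq_iff scale_right_distrib scale_left_distrib)
qed

lemma vector_space_field: "vector_space ((*) :: 'k::field \<Rightarrow> 'k \<Rightarrow> 'k)"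
  by unfold_locales (auto simp: algebra_simps)

text \<open>Additivity and homogeneity of every map in sight. With \<open>lin_defs\<close> they let
  \<open>simp\<close> prove that a nested Sweedler expression is linear in each variable, the side
  condition of almost every rewriting rule below.\<close>

named_theorems multilinear

locale finite_algebra = unital_algebra scale + finite_dimensional_vector_space scale B
  for scale :: "'k::field \<Rightarrow> 'h::ring_1 \<Rightarrow> 'h" and B :: "'h set"
begin

section \<open>Functionals, coordinates and multilinear forms\<close>

lemma dual_iff: "f \<in> dual \<longleftrightarrow> (\<forall>x y. f (x + y) = f x + f y) \<and> (\<forall>c x. f (scale c x) = c * f x)"
  using vector_space_field
  by (auto simp: dual_def Vector_Spaces.linear_iff vector_space_axioms)

lemma dualD:
  assumes "f \<in> dual"
  shows "f (x + y) = f x + f y" "f (scale c x) = c * f x"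
  using assms by (auto simp: dual_iff)

lemma dual_0: "f \<in> dual \<Longrightarrow> f 0 = 0"
  using dualD(2)[of f 0 0] by simp

lemma dual_sum: "f \<in> dual \<Longrightarrow> f (\<Sum>i\<in>I. g i) = (\<Sum>i\<in>I. f (g i))"
  by (induction I rule: infinite_finite_induct) (auto simp: dual_0 dualD)

abbreviation coord :: "'h \<Rightarrow> 'h \<Rightarrow> 'k" where "coord b a \<equiv> representation B a b"

lemma coord_dual: "coord b \<in> dual"
  by (simp add: dual_iff representation_add representation_scale independent_Basis span_Basis)

lemma coord_expand: "(\<Sum>b\<in>B. scale (coord b a) b) = a"
  by (rule sum_representation_eq) (auto simp: independent_Basis span_Basis finite_Basis)

lemma dual_expand: "f \<in> dual \<Longrightarrow> (\<Sum>b\<in>B. coord b a * f b) = f a"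
  using dual_sum[of f "\<lambda>b. scale (coord b a) b" B] by (simp add: coord_expand dualD)

text \<open>Coordinate functionals already separate points; identities in H become scalar identities
  in this way.\<close>

lemma dual_eqI: "(\<And>f. f \<in> dual \<Longrightarrow> f x = f y) \<Longrightarrow> x = y"
proof -
  assume *: "\<And>f. f \<in> dual \<Longrightarrow> f x = f y"
  have "(\<Sum>b\<in>B. scale (coord b x) b) = (\<Sum>b\<in>B. scale (coord b y) b)"
    using *[OF coord_dual] by simp
  then show ?thesis by (simp add: coord_expand)
qed

definition bilin :: "('h \<Rightarrow> 'h \<Rightarrow> 'k) \<Rightarrow> bool" where
  "bilin F \<longleftrightarrow> (\<forall>b. (\<lambda>a. F a b) \<in> dual) \<and> (\<forall>a. (\<lambda>b. F a b) \<in> dual)"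

definition trilin :: "('h \<Rightarrow> 'h \<Rightarrow> 'h \<Rightarrow> 'k) \<Rightarrow> bool" where
  "trilin F \<longleftrightarrow> (\<forall>c. bilin (\<lambda>a b. F a b c)) \<and> (\<forall>a b. (\<lambda>c. F a b c) \<in> dual)"

definition quadrilin :: "('h \<Rightarrow> 'h \<Rightarrow> 'h \<Rightarrow> 'h \<Rightarrow> 'k) \<Rightarrow> bool" where
  "quadrilin F \<longleftrightarrow> (\<forall>d. trilin (\<lambda>a b c. F a b c d)) \<and> (\<forall>a b c. (\<lambda>d. F a b c d) \<in> dual)"

lemmas lin_defs = bilin_def trilin_def quadrilin_def dual_iff

text \<open>The laws in all but the last variable are equations between functions, so that they also
  rewrite eta-contracted arguments such as \<open>ev2 t (F (x + y))\<close>.\<close>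

lemma bilinD:
  assumes "bilin F"
  shows "F (x + y) = (\<lambda>b. F x b + F y b)" "F (scale c x) = (\<lambda>b. c * F x b)"
    "F a (x + y) = F a x + F a y" "F a (scale c x) = c * F a x"
  using assms by (auto simp: lin_defs)

lemma trilinD:
  assumes "trilin F"
  shows "F (x + y) = (\<lambda>b d. F x b d + F y b d)" "F (scale c x) = (\<lambda>b d. c * F x b d)"
    "F a (x + y) = (\<lambda>d. F a x d + F a y d)" "F a (scale c x) = (\<lambda>d. c * F a x d)"
    "F a b (x + y) = F a b x + F a b y" "F a b (scale c x) = c * F a b x"
  using assms by (simp_all add: lin_defs fun_eq_iff)

lemma quadrilinD:
  assumes "quadrilin F"
  shows "F (x + y) = (\<lambda>b d e. F x b d e + F y b d e)"
    "F (scale c x) = (\<lambda>b d e. c * F x b d e)"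
    "F a (x + y) = (\<lambda>d e. F a x d e + F a y d e)" "F a (scale c x) = (\<lambda>d e. c * F a x d e)"
    "F a b (x + y) = (\<lambda>e. F a b x e + F a b y e)" "F a b (scale c x) = (\<lambda>e. c * F a b x e)"
    "F a b d (x + y) = F a b d x + F a b d y" "F a b d (scale c x) = c * F a b d x"
  using assms by (simp_all add: lin_defs fun_eq_iff)

text \<open>
  All tensor identities are tested on \<open>k\<close>-valued multilinear forms.  In terms of a basis and its
  dual basis, the evaluation of a tensor on a form is linear in both arguments without any side
  condition, so that evaluations of independent tensors commute.
\<close>

definition ev2 :: "('k, 'h) tensor2 \<Rightarrow> ('h \<Rightarrow> 'h \<Rightarrow> 'k) \<Rightarrow> 'k" where
  "ev2 t F = (\<Sum>a\<in>B. \<Sum>b\<in>B. t (coord a) (coord b) * F a b)"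

definition ev3 :: "('k, 'h) tensor3 \<Rightarrow> ('h \<Rightarrow> 'h \<Rightarrow> 'h \<Rightarrow> 'k) \<Rightarrow> 'k" where
  "ev3 t F = (\<Sum>a\<in>B. \<Sum>b\<in>B. \<Sum>c\<in>B. t (coord a) (coord b) (coord c) * F a b c)"

definition ev4 :: "('k, 'h) tensor4 \<Rightarrow> ('h \<Rightarrow> 'h \<Rightarrow> 'h \<Rightarrow> 'h \<Rightarrow> 'k) \<Rightarrow> 'k" where
  "ev4 t F = (\<Sum>a\<in>B. \<Sum>b\<in>B. \<Sum>c\<in>B. \<Sum>d\<in>B.
    t (coord a) (coord b) (coord c) (coord d) * F a b c d)"

lemma ev2_form [multilinear]:
  "ev2 t (\<lambda>a b. F a b + G a b) = ev2 t F + ev2 t G"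
  "ev2 t (\<lambda>a b. c * F a b) = c * ev2 t F"
  by (simp_all add: ev2_def sum.distrib distrib_left sum_distrib_left mult.left_commute)

lemma ev3_form [multilinear]:
  "ev3 t (\<lambda>a b c. F a b c + G a b c) = ev3 t F + ev3 t G"
  "ev3 t (\<lambda>a b c. k * F a b c) = k * ev3 t F"
  by (simp_all add: ev3_def sum.distrib distrib_left sum_distrib_left mult.left_commute)

lemma ev4_form [multilinear]:
  "ev4 t (\<lambda>a b c d. F a b c d + G a b c d) = ev4 t F + ev4 t G"
  "ev4 t (\<lambda>a b c d. k * F a b c d) = k * ev4 t F"
  by (simp_all add: ev4_def sum.distrib distrib_left sum_distrib_left mult.left_commute)

lemma ev2_form_0: "ev2 t (\<lambda>a b. 0) = 0"
  by (simp add: ev2_def)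

lemma ev2_form_right: "ev2 t (\<lambda>a b. F a b * c) = ev2 t F * c"
  using ev2_form(2)[of t c F] by (simp add: mult.commute)

lemma ev3_form_right: "ev3 t (\<lambda>a b d. F a b d * c) = ev3 t F * c"
  using ev3_form(2)[of t c F] by (simp add: mult.commute)

lemma ev2_tensor:
  "ev2 (s + t) F = ev2 s F + ev2 t F"
  "ev2 0 F = 0"
  "ev2 (\<lambda>f g. c * t f g) F = c * ev2 t F"
  by (simp_all add: ev2_def sum.distrib distrib_right sum_distrib_left mult.assoc)

lemma ev3_tensor:
  "ev3 (s + t) F = ev3 s F + ev3 t F"
  "ev3 0 F = 0"
  "ev3 (\<lambda>f g h. c * t f g h) F = c * ev3 t F"
  by (simp_all add: ev3_def sum.distrib distrib_right sum_distrib_left mult.assoc)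

lemma ev4_tensor:
  "ev4 (s + t) F = ev4 s F + ev4 t F"
  "ev4 0 F = 0"
  "ev4 (\<lambda>f g h k. c * t f g h k) F = c * ev4 t F"
  by (simp_all add: ev4_def sum.distrib distrib_right sum_distrib_left mult.assoc)

lemma ev2_alt: "ev2 t F = (\<Sum>x\<in>B \<times> B. t (coord (fst x)) (coord (snd x)) * F (fst x) (snd x))"
  by (simp add: ev2_def sum.cartesian_product split_def)

lemma ev22_swap:
  "ev2 s (\<lambda>a b. ev2 t (F a b)) = ev2 t (\<lambda>c d. ev2 s (\<lambda>a b. F a b c d))"
  unfolding ev2_alt sum_distrib_left
  by (subst sum.swap) (simp add: mult.left_commute)

lemma ev2_form_sum: "ev2 t (\<lambda>a b. \<Sum>i\<in>I. F i a b) = (\<Sum>i\<in>I. ev2 t (F i))"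
  unfolding ev2_alt sum_distrib_left by (rule sum.swap)

lemma ev3_alt: "ev3 t F = (\<Sum>x\<in>B \<times> B \<times> B. t (coord (fst x)) (coord (fst (snd x))) (coord (snd (snd x))) *
    F (fst x) (fst (snd x)) (snd (snd x)))"
  by (simp add: ev3_def sum.cartesian_product split_def)

lemma ev23_swap:
  "ev2 s (\<lambda>a b. ev3 t (F a b)) = ev3 t (\<lambda>c d e. ev2 s (\<lambda>a b. F a b c d e))"
  unfolding ev2_alt ev3_alt sum_distrib_left
  by (subst sum.swap) (simp add: mult.left_commute)

lemma ev33_swap:
  "ev3 s (\<lambda>a b c. ev3 t (F a b c)) = ev3 t (\<lambda>d e f. ev3 s (\<lambda>a b c. F a b c d e f))"
  unfolding ev3_alt sum_distrib_left
  by (subst sum.swap) (simp add: mult.left_commute)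

lemma ev2_ten:
  assumes "bilin F"
  shows "ev2 (a \<otimes> b) F = F a b"
proof -
  have "ev2 (a \<otimes> b) F = (\<Sum>i\<in>B. coord i a * (\<Sum>j\<in>B. coord j b * F i j))"
    by (simp add: ev2_def ten2_def coord_dual sum_distrib_left mult.assoc)
  also have "\<dots> = F a b"
    using assms by (simp add: dual_expand bilin_def)
  finally show ?thesis .
qed

lemma ev3_ten:
  assumes "trilin F"
  shows "ev3 (ten3 a b c) F = F a b c"
proof -
  have "ev3 (ten3 a b c) F = (\<Sum>i\<in>B. coord i a * (\<Sum>j\<in>B. coord j b * (\<Sum>k\<in>B. coord k c * F i j k)))"
    by (simp add: ev3_def ten3_def coord_dual sum_distrib_left mult.assoc)
  also have "\<dots> = F a b c"
    using assms by (simp add: dual_expand trilin_def bilin_def)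
  finally show ?thesis .
qed

lemma ev4_ten:
  assumes "quadrilin F"
  shows "ev4 (ten4 a b c d) F = F a b c d"
proof -
  have "ev4 (ten4 a b c d) F = (\<Sum>i\<in>B. coord i a * (\<Sum>j\<in>B. coord j b * (\<Sum>k\<in>B. coord k c *
      (\<Sum>l\<in>B. coord l d * F i j k l))))"
    by (simp add: ev4_def ten4_def coord_dual sum_distrib_left mult.assoc)
  also have "\<dots> = F a b c d"
    using assms by (simp add: dual_expand quadrilin_def trilin_def bilin_def)
  finally show ?thesis .
qed

lemma ev2_list:
  assumes "bilin F"
  shows "ev2 (\<Sum>(a, b)\<leftarrow>xs. a \<otimes> b) F = (\<Sum>(a, b)\<leftarrow>xs. F a b)"
  by (induction xs) (simp_all add: ev2_tensor ev2_ten assms split_def del: plus_fun_apply zero_fun_apply)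

lemma ev3_list:
  assumes "trilin F"
  shows "ev3 (\<Sum>(a, b, c)\<leftarrow>xs. ten3 a b c) F = (\<Sum>(a, b, c)\<leftarrow>xs. F a b c)"
  by (induction xs) (simp_all add: ev3_tensor ev3_ten assms split_def del: plus_fun_apply zero_fun_apply)

lemma ev4_list:
  assumes "quadrilin F"
  shows "ev4 (\<Sum>(a, b, c, d)\<leftarrow>xs. ten4 a b c d) F = (\<Sum>(a, b, c, d)\<leftarrow>xs. F a b c d)"
  by (induction xs) (simp_all add: ev4_tensor ev4_ten assms split_def del: plus_fun_apply zero_fun_apply)

section \<open>From lifts of multilinear maps to evaluations on forms\<close>

text \<open>Both sides are computed on a list of simple tensors, and an additive \<open>h\<close>
  passes through the list sum. In applications \<open>h\<close> is a functional on H or, for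
  tensor-valued lifts, the evaluation on a fixed form.\<close>

lemma lift2_ev:
  assumes W: "vector_space scaleW" and t: "t \<in> tensors2"
    and F: "\<And>b. Vector_Spaces.linear scale scaleW (\<lambda>a. F a b)"
      "\<And>a. Vector_Spaces.linear scale scaleW (\<lambda>b. F a b)"
    and h: "\<And>x y. h (x + y) = h x + h y" "h 0 = 0" "bilin (\<lambda>a b. h (F a b))"
  shows "h (lift2 F t) = ev2 t (\<lambda>a b. h (F a b))"
proof -
  obtain xs where t: "t = (\<Sum>(a, b)\<leftarrow>xs. a \<otimes> b)" using t by (auto simp: tensors2_def)
  have "h (\<Sum>(a, b)\<leftarrow>xs. F a b) = (\<Sum>(a, b)\<leftarrow>xs. h (F a b))"
    by (induction xs) (auto simp: h)
  then show ?thesis using h(3) by (simp add: t lift2_eq[OF W F] ev2_list)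
qed

lemma lift3_ev:
  assumes W: "vector_space scaleW" and t: "t \<in> tensors3"
    and F: "\<And>b c. Vector_Spaces.linear scale scaleW (\<lambda>a. F a b c)"
      "\<And>a c. Vector_Spaces.linear scale scaleW (\<lambda>b. F a b c)"
      "\<And>a b. Vector_Spaces.linear scale scaleW (\<lambda>c. F a b c)"
    and h: "\<And>x y. h (x + y) = h x + h y" "h 0 = 0" "trilin (\<lambda>a b c. h (F a b c))"
  shows "h (lift3 F t) = ev3 t (\<lambda>a b c. h (F a b c))"
proof -
  obtain xs where t: "t = (\<Sum>(a, b, c)\<leftarrow>xs. ten3 a b c)" using t by (auto simp: tensors3_def)
  have "h (\<Sum>(a, b, c)\<leftarrow>xs. F a b c) = (\<Sum>(a, b, c)\<leftarrow>xs. h (F a b c))"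
    by (induction xs) (auto simp: h)
  then show ?thesis using h(3) by (simp add: t lift3_eq[OF W F] ev3_list)
qed

lemma lift4_ev:
  assumes W: "vector_space scaleW" and t: "t \<in> tensors4"
    and F: "\<And>b c d. Vector_Spaces.linear scale scaleW (\<lambda>a. F a b c d)"
      "\<And>a c d. Vector_Spaces.linear scale scaleW (\<lambda>b. F a b c d)"
      "\<And>a b d. Vector_Spaces.linear scale scaleW (\<lambda>c. F a b c d)"
      "\<And>a b c. Vector_Spaces.linear scale scaleW (\<lambda>d. F a b c d)"
    and h: "\<And>x y. h (x + y) = h x + h y" "h 0 = 0" "quadrilin (\<lambda>a b c d. h (F a b c d))"
  shows "h (lift4 F t) = ev4 t (\<lambda>a b c d. h (F a b c d))"
proof -
  obtain xs where t: "t = (\<Sum>(a, b, c, d)\<leftarrow>xs. ten4 a b c d)" using t by (auto simp: tensors4_def)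
  have "h (\<Sum>(a, b, c, d)\<leftarrow>xs. F a b c d) = (\<Sum>(a, b, c, d)\<leftarrow>xs. h (F a b c d))"
    by (induction xs) (auto simp: h)
  then show ?thesis using h(3) by (simp add: t lift4_eq[OF W F] ev4_list)
qed

lemma linear_scale: "Vector_Spaces.linear scale sW F \<longleftrightarrow> vector_space sW \<and>
    (\<forall>x y. F (x + y) = F x + F y) \<and> (\<forall>c x. F (scale c x) = sW c (F x))"
  by (auto simp: Vector_Spaces.linear_iff vector_space_axioms)

abbreviation "scale2 \<equiv> \<lambda>c (w :: ('k, 'h) tensor2) f g. c * w f g"
abbreviation "scale3 \<equiv> \<lambda>c (w :: ('k, 'h) tensor3) f g h. c * w f g h"
abbreviation "scale4 \<equiv> \<lambda>c (w :: ('k, 'h) tensor4) f g h k. c * w f g h k"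

lemma vs2: "vector_space scale2"
  by (intro vector_space_fun vector_space_field)

lemma vs3: "vector_space scale3"
  by (intro vector_space_fun vector_space_field)

lemma vs4: "vector_space scale4"
  by (intro vector_space_fun vector_space_field)

lemma ten2_linear [multilinear]:
  "(x + y) \<otimes> b = x \<otimes> b + y \<otimes> b" "a \<otimes> (x + y) = a \<otimes> x + a \<otimes> y"
  "scale c a \<otimes> b = scale2 c (a \<otimes> b)" "a \<otimes> scale c b = scale2 c (a \<otimes> b)"
  by (auto simp: ten2_def fun_eq_iff dualD algebra_simps)

lemma ten3_linear [multilinear]:
  "ten3 (x + y) b d = ten3 x b d + ten3 y b d" "ten3 (scale c x) b d = scale3 c (ten3 x b d)"
  "ten3 a (x + y) d = ten3 a x d + ten3 a y d" "ten3 a (scale c x) d = scale3 c (ten3 a x d)"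
  "ten3 a b (x + y) = ten3 a b x + ten3 a b y" "ten3 a b (scale c x) = scale3 c (ten3 a b x)"
  by (auto simp: ten3_def fun_eq_iff dualD algebra_simps)

lemma ten4_linear [multilinear]:
  "ten4 (x + y) b d e = ten4 x b d e + ten4 y b d e" "ten4 (scale c x) b d e = scale4 c (ten4 x b d e)"
  "ten4 a (x + y) d e = ten4 a x d e + ten4 a y d e" "ten4 a (scale c x) d e = scale4 c (ten4 a x d e)"
  "ten4 a b (x + y) e = ten4 a b x e + ten4 a b y e" "ten4 a b (scale c x) e = scale4 c (ten4 a b x e)"
  "ten4 a b d (x + y) = ten4 a b d x + ten4 a b d y" "ten4 a b d (scale c x) = scale4 c (ten4 a b d x)"
  by (auto simp: ten4_def fun_eq_iff dualD algebra_simps)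

lemmas [multilinear] = mult_scale_left mult_scale_right distrib_left distrib_right
  representation_add[OF independent_Basis] representation_scale[OF independent_Basis] span_Basis

lemma tensors2_closed:
  "0 \<in> tensors2" "a \<otimes> b \<in> tensors2" "s \<in> tensors2 \<Longrightarrow> t \<in> tensors2 \<Longrightarrow> s + t \<in> tensors2"
proof -
  show "0 \<in> tensors2" by (auto simp: tensors2_def intro!: exI[of _ "[]"])
  show "a \<otimes> b \<in> tensors2" by (auto simp: tensors2_def intro!: exI[of _ "[(a, b)]"])
  assume "s \<in> tensors2" "t \<in> tensors2"
  then obtain xs ys where "s = (\<Sum>(a, b)\<leftarrow>xs. a \<otimes> b)" "t = (\<Sum>(a, b)\<leftarrow>ys. a \<otimes> b)"
    by (auto simp: tensors2_def)
  then show "s + t \<in> tensors2" by (auto simp: tensors2_def intro!: exI[of _ "xs @ ys"])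
qed

lemma tensors3_closed:
  "0 \<in> tensors3" "ten3 a b c \<in> tensors3" "s \<in> tensors3 \<Longrightarrow> t \<in> tensors3 \<Longrightarrow> s + t \<in> tensors3"
proof -
  show "0 \<in> tensors3" by (auto simp: tensors3_def intro!: exI[of _ "[]"])
  show "ten3 a b c \<in> tensors3" by (auto simp: tensors3_def intro!: exI[of _ "[(a, b, c)]"])
  assume "s \<in> tensors3" "t \<in> tensors3"
  then obtain xs ys where "s = (\<Sum>(a, b, c)\<leftarrow>xs. ten3 a b c)" "t = (\<Sum>(a, b, c)\<leftarrow>ys. ten3 a b c)"
    by (auto simp: tensors3_def)
  then show "s + t \<in> tensors3" by (auto simp: tensors3_def intro!: exI[of _ "xs @ ys"])
qed

lemma tensors4_closed:
  "0 \<in> tensors4" "ten4 a b c d \<in> tensors4" "s \<in> tensors4 \<Longrightarrow> t \<in> tensors4 \<Longrightarrow> s + t \<in> tensors4"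
proof -
  show "0 \<in> tensors4" by (auto simp: tensors4_def intro!: exI[of _ "[]"])
  show "ten4 a b c d \<in> tensors4" by (auto simp: tensors4_def intro!: exI[of _ "[(a, b, c, d)]"])
  assume "s \<in> tensors4" "t \<in> tensors4"
  then obtain xs ys where "s = (\<Sum>(a, b, c, d)\<leftarrow>xs. ten4 a b c d)" "t = (\<Sum>(a, b, c, d)\<leftarrow>ys. ten4 a b c d)"
    by (auto simp: tensors4_def)
  then show "s + t \<in> tensors4" by (auto simp: tensors4_def intro!: exI[of _ "xs @ ys"])
qed

lemma tensors2_list: "(\<And>a b. F a b \<in> tensors2) \<Longrightarrow> (\<Sum>(a, b)\<leftarrow>xs. F a b) \<in> tensors2"
  by (induction xs) (simp_all add: tensors2_closed split_def del: plus_fun_apply zero_fun_apply)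

lemma lift2_closed:
  assumes t: "t \<in> tensors2"
    and F: "\<And>b. Vector_Spaces.linear scale sW (\<lambda>a. F a b)"
      "\<And>a. Vector_Spaces.linear scale sW (\<lambda>b. F a b)"
    and W: "vector_space sW" and A: "0 \<in> A" "\<And>x y. x \<in> A \<Longrightarrow> y \<in> A \<Longrightarrow> x + y \<in> A" "\<And>a b. F a b \<in> A"
  shows "lift2 F t \<in> A"
proof -
  obtain xs where t: "t = (\<Sum>(a, b)\<leftarrow>xs. a \<otimes> b)" using t by (auto simp: tensors2_def)
  show ?thesis unfolding t lift2_eq[OF W F] by (induction xs) (simp_all add: A split_def)
qed

lemma lift3_closed:
  assumes t: "t \<in> tensors3"
    and F: "\<And>b c. Vector_Spaces.linear scale sW (\<lambda>a. F a b c)"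
      "\<And>a c. Vector_Spaces.linear scale sW (\<lambda>b. F a b c)"
      "\<And>a b. Vector_Spaces.linear scale sW (\<lambda>c. F a b c)"
    and W: "vector_space sW" and A: "0 \<in> A" "\<And>x y. x \<in> A \<Longrightarrow> y \<in> A \<Longrightarrow> x + y \<in> A" "\<And>a b c. F a b c \<in> A"
  shows "lift3 F t \<in> A"
proof -
  obtain xs where t: "t = (\<Sum>(a, b, c)\<leftarrow>xs. ten3 a b c)" using t by (auto simp: tensors3_def)
  show ?thesis unfolding t lift3_eq[OF W F] by (induction xs) (simp_all add: A split_def)
qed

lemma lift4_closed:
  assumes t: "t \<in> tensors4"
    and F: "\<And>b c d. Vector_Spaces.linear scale sW (\<lambda>a. F a b c d)"
      "\<And>a c d. Vector_Spaces.linear scale sW (\<lambda>b. F a b c d)"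
      "\<And>a b d. Vector_Spaces.linear scale sW (\<lambda>c. F a b c d)"
      "\<And>a b c. Vector_Spaces.linear scale sW (\<lambda>d. F a b c d)"
    and W: "vector_space sW" and A: "0 \<in> A" "\<And>x y. x \<in> A \<Longrightarrow> y \<in> A \<Longrightarrow> x + y \<in> A" "\<And>a b c d. F a b c d \<in> A"
  shows "lift4 F t \<in> A"
proof -
  obtain xs where t: "t = (\<Sum>(a, b, c, d)\<leftarrow>xs. ten4 a b c d)" using t by (auto simp: tensors4_def)
  show ?thesis unfolding t lift4_eq[OF W F] by (induction xs) (simp_all add: A split_def)
qed

lemma linear_sum_list:
  assumes "vector_space sW" "\<And>y. y \<in> set ys \<Longrightarrow> Vector_Spaces.linear scale sW (\<lambda>a. F y a)"
  shows "Vector_Spaces.linear scale sW (\<lambda>a. \<Sum>y\<leftarrow>ys. F y a)"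
proof -
  interpret W: vector_space sW by fact
  show ?thesis using assms(2)
    by (induction ys) (auto simp: linear_scale assms(1) W.scale_right_distrib algebra_simps)
qed

section \<open>Products of tensors\<close>

text \<open>The outer lift is well defined only if the inner one is bilinear in \<open>a\<close> and
  \<open>b\<close>. A fixed list representing \<open>t\<close> turns the inner lift into a list sum,
  where bilinearity is visible.\<close>

lemma mult2_props:
  assumes s: "s \<in> tensors2" and t: "t \<in> tensors2"
  shows mult2_closed: "s \<bullet> t \<in> tensors2"
    and ev2_mult: "bilin F \<Longrightarrow> ev2 (s \<bullet> t) F = ev2 s (\<lambda>a b. ev2 t (\<lambda>c d. F (a * c) (b * d)))"
proof -
  let ?I = "\<lambda>a b. lift2 (\<lambda>a' b'. (a * a') \<otimes> (b * b')) t"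
  have lin: "Vector_Spaces.linear scale scale2 (\<lambda>a'. (a * a') \<otimes> (b * b'))"
    "Vector_Spaces.linear scale scale2 (\<lambda>b'. (a * a') \<otimes> (b * b'))" for a b a' b'
    by (simp_all add: linear_scale vs2 multilinear)
  obtain ys where ys: "t = (\<Sum>(a, b)\<leftarrow>ys. a \<otimes> b)" using t by (auto simp: tensors2_def)
  have I: "?I a b = (\<Sum>y\<leftarrow>ys. (a * fst y) \<otimes> (b * snd y))" for a b
    unfolding ys by (subst lift2_eq[OF vs2 lin]) (simp add: split_def)
  have linI: "Vector_Spaces.linear scale scale2 (\<lambda>a. ?I a b)"
    "Vector_Spaces.linear scale scale2 (\<lambda>b. ?I a b)" for a b
    unfolding I by (intro linear_sum_list vs2; simp add: linear_scale vs2 multilinear)+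
  have cl: "?I a b \<in> tensors2" for a b
    by (intro lift2_closed[OF t lin vs2] tensors2_closed)
  show "s \<bullet> t \<in> tensors2"
    unfolding mult2_def by (intro lift2_closed[OF s linI vs2] cl tensors2_closed)
  assume F: "bilin F"
  have inner: "ev2 (?I a b) F = ev2 t (\<lambda>c d. F (a * c) (b * d))" for a b
    by (subst lift2_ev[OF vs2 t lin, of "\<lambda>w. ev2 w F"])
      (simp_all add: ev2_tensor ev2_ten F lin_defs multilinear bilinD[OF F])
  show "ev2 (s \<bullet> t) F = ev2 s (\<lambda>a b. ev2 t (\<lambda>c d. F (a * c) (b * d)))"
    unfolding mult2_def
    by (subst lift2_ev[OF vs2 s linI, of "\<lambda>w. ev2 w F"])
      (simp_all add: inner ev2_tensor lin_defs multilinear bilinD[OF F])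
qed

lemma mult3_props:
  assumes s: "s \<in> tensors3" and t: "t \<in> tensors3"
  shows mult3_closed: "s \<bullet>\<^sub>3 t \<in> tensors3"
    and ev3_mult: "trilin F \<Longrightarrow> ev3 (s \<bullet>\<^sub>3 t) F =
      ev3 s (\<lambda>a b c. ev3 t (\<lambda>a' b' c'. F (a * a') (b * b') (c * c')))"
proof -
  let ?I = "\<lambda>a b c. lift3 (\<lambda>a' b' c'. ten3 (a * a') (b * b') (c * c')) t"
  have lin: "Vector_Spaces.linear scale scale3 (\<lambda>a'. ten3 (a * a') (b * b') (c * c'))"
    "Vector_Spaces.linear scale scale3 (\<lambda>b'. ten3 (a * a') (b * b') (c * c'))"
    "Vector_Spaces.linear scale scale3 (\<lambda>c'. ten3 (a * a') (b * b') (c * c'))" for a b c a' b' c'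
    by (simp_all add: linear_scale vs3 multilinear)
  obtain ys where ys: "t = (\<Sum>(a, b, c)\<leftarrow>ys. ten3 a b c)" using t by (auto simp: tensors3_def)
  have I: "?I a b c = (\<Sum>y\<leftarrow>ys. ten3 (a * fst y) (b * fst (snd y)) (c * snd (snd y)))" for a b c
    unfolding ys by (subst lift3_eq[OF vs3 lin]) (simp add: split_def)
  have linI: "Vector_Spaces.linear scale scale3 (\<lambda>a. ?I a b c)"
    "Vector_Spaces.linear scale scale3 (\<lambda>b. ?I a b c)"
    "Vector_Spaces.linear scale scale3 (\<lambda>c. ?I a b c)" for a b c
    unfolding I by (intro linear_sum_list vs3; simp add: linear_scale vs3 multilinear)+
  have cl: "?I a b c \<in> tensors3" for a b c
    by (intro lift3_closed[OF t lin vs3] tensors3_closed)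
  show "s \<bullet>\<^sub>3 t \<in> tensors3"
    unfolding mult3_def by (intro lift3_closed[OF s linI vs3] cl tensors3_closed)
  assume F: "trilin F"
  have inner: "ev3 (?I a b c) F = ev3 t (\<lambda>a' b' c'. F (a * a') (b * b') (c * c'))" for a b c
    by (subst lift3_ev[OF vs3 t lin, of "\<lambda>w. ev3 w F"])
      (simp_all add: ev3_tensor ev3_ten F lin_defs multilinear trilinD[OF F])
  show "ev3 (s \<bullet>\<^sub>3 t) F = ev3 s (\<lambda>a b c. ev3 t (\<lambda>a' b' c'. F (a * a') (b * b') (c * c')))"
    unfolding mult3_def
    by (subst lift3_ev[OF vs3 s linI, of "\<lambda>w. ev3 w F"])
      (simp_all add: inner ev3_tensor lin_defs multilinear trilinD[OF F])
qed

lemma mult4_props: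
  assumes s: "s \<in> tensors4" and t: "t \<in> tensors4"
  shows mult4_closed: "s \<bullet>\<^sub>4 t \<in> tensors4"
    and ev4_mult: "quadrilin F \<Longrightarrow> ev4 (s \<bullet>\<^sub>4 t) F =
      ev4 s (\<lambda>a b c d. ev4 t (\<lambda>a' b' c' d'. F (a * a') (b * b') (c * c') (d * d')))"
proof -
  let ?I = "\<lambda>a b c d. lift4 (\<lambda>a' b' c' d'. ten4 (a * a') (b * b') (c * c') (d * d')) t"
  have lin: "Vector_Spaces.linear scale scale4 (\<lambda>a'. ten4 (a * a') (b * b') (c * c') (d * d'))"
    "Vector_Spaces.linear scale scale4 (\<lambda>b'. ten4 (a * a') (b * b') (c * c') (d * d'))"
    "Vector_Spaces.linear scale scale4 (\<lambda>c'. ten4 (a * a') (b * b') (c * c') (d * d'))"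
    "Vector_Spaces.linear scale scale4 (\<lambda>d'. ten4 (a * a') (b * b') (c * c') (d * d'))"
    for a b c d a' b' c' d'
    by (simp_all add: linear_scale vs4 multilinear)
  obtain ys where ys: "t = (\<Sum>(a, b, c, d)\<leftarrow>ys. ten4 a b c d)" using t by (auto simp: tensors4_def)
  have I: "?I a b c d = (\<Sum>y\<leftarrow>ys. ten4 (a * fst y) (b * fst (snd y)) (c * fst (snd (snd y)))
      (d * snd (snd (snd y))))" for a b c d
    unfolding ys by (subst lift4_eq[OF vs4 lin]) (simp add: split_def)
  have linI: "Vector_Spaces.linear scale scale4 (\<lambda>a. ?I a b c d)"
    "Vector_Spaces.linear scale scale4 (\<lambda>b. ?I a b c d)"
    "Vector_Spaces.linear scale scale4 (\<lambda>c. ?I a b c d)"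
    "Vector_Spaces.linear scale scale4 (\<lambda>d. ?I a b c d)" for a b c d
    unfolding I by (intro linear_sum_list vs4; simp add: linear_scale vs4 multilinear)+
  have cl: "?I a b c d \<in> tensors4" for a b c d
    by (intro lift4_closed[OF t lin vs4] tensors4_closed)
  show "s \<bullet>\<^sub>4 t \<in> tensors4"
    unfolding mult4_def by (intro lift4_closed[OF s linI vs4] cl tensors4_closed)
  assume F: "quadrilin F"
  have inner: "ev4 (?I a b c d) F = ev4 t (\<lambda>a' b' c' d'. F (a * a') (b * b') (c * c') (d * d'))" for a b c d
    by (subst lift4_ev[OF vs4 t lin, of "\<lambda>w. ev4 w F"])
      (simp_all add: ev4_tensor ev4_ten F lin_defs multilinear quadrilinD[OF F])
  show "ev4 (s \<bullet>\<^sub>4 t) F =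
      ev4 s (\<lambda>a b c d. ev4 t (\<lambda>a' b' c' d'. F (a * a') (b * b') (c * c') (d * d')))"
    unfolding mult4_def
    by (subst lift4_ev[OF vs4 s linI, of "\<lambda>w. ev4 w F"])
      (simp_all add: inner ev4_tensor lin_defs multilinear quadrilinD[OF F])
qed

section \<open>Extensionality and inverses of tensors\<close>

text \<open>On functionals a tensor is its own evaluation on a product form; elsewhere the default
  value 0 in \<open>ten2\<close> decides. Both cases are needed to prove tensors equal as
  functions.\<close>

lemma tensors2_apply: "t \<in> tensors2 \<Longrightarrow> t f g = (if f \<in> dual \<and> g \<in> dual then ev2 t (\<lambda>a b. f a * g b) else 0)"
proof -
  assume "t \<in> tensors2"
  then obtain xs where t: "t = (\<Sum>(a, b)\<leftarrow>xs. a \<otimes> b)" by (auto simp: tensors2_def)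
  have "t f g = (\<Sum>(a, b)\<leftarrow>xs. if f \<in> dual \<and> g \<in> dual then f a * g b else 0)"
    unfolding t by (induction xs) (auto simp: ten2_def)
  moreover have "bilin (\<lambda>a b. f a * g b)" if "f \<in> dual" "g \<in> dual"
    using that by (simp add: lin_defs algebra_simps)
  moreover have "(\<Sum>(a, b)\<leftarrow>xs. 0 :: 'k) = 0" by (induction xs) auto
  ultimately show ?thesis unfolding t by (auto simp: ev2_list)
qed

lemma tensors3_apply: "t \<in> tensors3 \<Longrightarrow> t f g h =
  (if {f, g, h} \<subseteq> dual then ev3 t (\<lambda>a b c. f a * g b * h c) else 0)"
proof -
  assume "t \<in> tensors3"
  then obtain xs where t: "t = (\<Sum>(a, b, c)\<leftarrow>xs. ten3 a b c)" by (auto simp: tensors3_def)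
  have "t f g h = (\<Sum>(a, b, c)\<leftarrow>xs. if {f, g, h} \<subseteq> dual then f a * g b * h c else 0)"
    unfolding t by (induction xs) (auto simp: ten3_def)
  moreover have "trilin (\<lambda>a b c. f a * g b * h c)" if "{f, g, h} \<subseteq> dual"
    using that by (simp add: lin_defs algebra_simps)
  moreover have "(\<Sum>(a, b, c)\<leftarrow>xs. 0 :: 'k) = 0" by (induction xs) auto
  ultimately show ?thesis unfolding t by (auto simp: ev3_list)
qed

lemma tensors2_eqI:
  assumes "s \<in> tensors2" "t \<in> tensors2" "\<And>F. bilin F \<Longrightarrow> ev2 s F = ev2 t F"
  shows "s = t"
proof (intro ext)
  fix f g
  show "s f g = t f g"
    using assms(3)[of "\<lambda>a b. f a * g b"]
    by (auto simp: tensors2_apply assms(1,2) lin_defs algebra_simps)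
qed

lemma tensors3_eqI:
  assumes "s \<in> tensors3" "t \<in> tensors3" "\<And>F. trilin F \<Longrightarrow> ev3 s F = ev3 t F"
  shows "s = t"
proof (intro ext)
  fix f g h
  show "s f g h = t f g h"
    using assms(3)[of "\<lambda>a b c. f a * g b * h c"]
    by (auto simp: tensors3_apply assms(1,2) lin_defs algebra_simps)
qed

text \<open>The usual t = t (s t') = (t s) t' = t', carried out on forms.\<close>

lemma mult2_unique_inverse:
  assumes s: "s \<in> tensors2" and t: "t \<in> tensors2" "t' \<in> tensors2"
    and "t \<bullet> s = 1 \<otimes> 1" "s \<bullet> t' = 1 \<otimes> 1"
  shows "t = t'"
proof (rule tensors2_eqI[OF t])
  fix F assume F: "bilin F"
  have *: "bilin (\<lambda>c d. F (a * c) (b * d))" "bilin (\<lambda>a b. F (a * c) (b * d))" for a b c d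
    by (simp_all add: lin_defs multilinear bilinD[OF F])
  have "ev2 t F = ev2 t (\<lambda>a b. ev2 (s \<bullet> t') (\<lambda>c d. F (a * c) (b * d)))"
    using * by (simp add: assms ev2_ten)
  also have "\<dots> = ev2 (t \<bullet> s) (\<lambda>a b. ev2 t' (\<lambda>c d. F (a * c) (b * d)))"
    by (subst ev2_mult[OF s t(2) *(1)], subst ev2_mult[OF t(1) s])
      (simp_all add: mult.assoc lin_defs multilinear bilinD[OF F])
  also have "\<dots> = ev2 t' F"
    by (simp add: assms ev2_ten lin_defs multilinear bilinD[OF F])
  finally show "ev2 t F = ev2 t' F" .
qed

text \<open>Uniqueness turns the description \<open>inverse2\<close> into an actual inverse as soon
  as some inverse is known.\<close>

lemma is_inverse2_inverse2:
  assumes "s \<in> tensors2" "is_inverse2 s t"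
  shows "is_inverse2 s (inverse2 s)"
  unfolding inverse2_def
proof (rule theI[where P = "is_inverse2 s", OF assms(2)])
  show "t' = t" if "is_inverse2 s t'" for t'
    using mult2_unique_inverse[OF assms(1), of t' t] that assms(2) by (simp add: is_inverse2_def)
qed

lemma mult3_unique_inverse:
  assumes s: "s \<in> tensors3" and t: "t \<in> tensors3" "t' \<in> tensors3"
    and "t \<bullet>\<^sub>3 s = ten3 1 1 1" "s \<bullet>\<^sub>3 t' = ten3 1 1 1"
  shows "t = t'"
proof (rule tensors3_eqI[OF t])
  fix F assume F: "trilin F"
  have *: "trilin (\<lambda>c d e. F (a * c) (b * d) (a' * e))" for a b a'
    by (simp_all add: lin_defs multilinear trilinD[OF F])
  have "ev3 t F = ev3 t (\<lambda>a b a'. ev3 (s \<bullet>\<^sub>3 t') (\<lambda>c d e. F (a * c) (b * d) (a' * e)))"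
    using * by (simp add: assms ev3_ten)
  also have "\<dots> = ev3 (t \<bullet>\<^sub>3 s) (\<lambda>a b a'. ev3 t' (\<lambda>c d e. F (a * c) (b * d) (a' * e)))"
    by (subst ev3_mult[OF s t(2) *(1)], subst ev3_mult[OF t(1) s])
      (simp_all add: mult.assoc lin_defs multilinear trilinD[OF F])
  also have "\<dots> = ev3 t' F"
    by (simp add: assms ev3_ten lin_defs multilinear trilinD[OF F])
  finally show "ev3 t F = ev3 t' F" .
qed

lemma is_inverse3_inverse3:
  assumes "s \<in> tensors3" "is_inverse3 s t"
  shows "is_inverse3 s (inverse3 s)"
  unfolding inverse3_def
proof (rule theI[where P = "is_inverse3 s", OF assms(2)])
  show "t' = t" if "is_inverse3 s t'" for t'
    using mult3_unique_inverse[OF assms(1), of t' t] that assms(2) by (simp add: is_inverse3_def)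
qed

lemma tensors2_scale:
  assumes "x \<in> tensors2"
  shows "scale2 c x \<in> tensors2"
proof -
  obtain xs where x: "x = (\<Sum>(a, b)\<leftarrow>xs. a \<otimes> b)" using assms by (auto simp: tensors2_def)
  have "scale2 c x = (\<Sum>(a, b)\<leftarrow>xs. scale c a \<otimes> b)"
    unfolding x by (induction xs) (auto simp: fun_eq_iff ten2_linear distrib_left)
  then show ?thesis by (simp add: tensors2_list tensors2_closed)
qed

text \<open>Supplies the finite spanning set for the dimension count in
  \<open>mult2_left_inverse\<close>; the coefficients are the values of \<open>t\<close> at
  coordinate functionals.\<close>

lemma tensors2_span:
  assumes "t \<in> tensors2"
  shows "t \<in> module.span scale2 ((\<lambda>(a, b). a \<otimes> b) ` (B \<times> B))"
proof -
  interpret V2: vector_space scale2 by (rule vs2)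
  let ?T = "(\<lambda>(a, b). a \<otimes> b) ` (B \<times> B)"
  let ?s = "\<Sum>a\<in>B. \<Sum>b\<in>B. scale2 (t (coord a) (coord b)) (a \<otimes> b)"
  have cl: "scale2 c (a \<otimes> b) \<in> tensors2" for c a b
    using tensors2_closed(2)[of "scale c a" b] by (simp add: ten2_linear)
  have sum_cl: "(\<Sum>i\<in>I. f i) \<in> tensors2" if "\<And>i. f i \<in> tensors2" for I :: "'h set" and f
    using that by (induction I rule: infinite_finite_induct)
      (auto simp: tensors2_closed simp del: plus_fun_apply zero_fun_apply)
  have ev_sum: "ev2 (\<Sum>i\<in>I. f i) F = (\<Sum>i\<in>I. ev2 (f i) F)" for I :: "'h set" and f F
    by (induction I rule: infinite_finite_induct)
      (auto simp: ev2_tensor simp del: plus_fun_apply zero_fun_apply)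
  have "t = ?s"
    by (rule tensors2_eqI[OF assms])
      (auto intro!: sum_cl cl simp: ev_sum ev2_tensor ev2_ten, simp add: ev2_def)
  also have "\<dots> \<in> V2.span ?T"
    by (intro V2.span_sum V2.span_scale V2.span_base) auto
  finally show ?thesis .
qed

text \<open>Left multiplication by \<open>t\<close> is injective, hence surjective by finite dimension.\<close>

lemma mult2_left_inverse:
  assumes s: "s \<in> tensors2" and t: "t \<in> tensors2" and st: "s \<bullet> t = 1 \<otimes> 1"
  shows "t \<bullet> s = 1 \<otimes> 1"
proof -
  interpret V2: vector_space scale2 by (rule vs2)
  have one: "x \<bullet> (1 \<otimes> 1) = x" "(1 \<otimes> 1) \<bullet> x = x" if x: "x \<in> tensors2" for x
  proof -
    have ev: "ev2 (x \<bullet> (1 \<otimes> 1)) F = ev2 x F" "ev2 ((1 \<otimes> 1) \<bullet> x) F = ev2 x F" if F: "bilin F" for F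
    proof -
      have *: "bilin (\<lambda>c d. F (a * c) (b * d))" "bilin (\<lambda>a b. ev2 x (\<lambda>c d. F (a * c) (b * d)))" for a b
        by (simp_all add: lin_defs multilinear bilinD[OF F])
      show "ev2 (x \<bullet> (1 \<otimes> 1)) F = ev2 x F" "ev2 ((1 \<otimes> 1) \<bullet> x) F = ev2 x F"
        using x * by (simp_all add: ev2_mult tensors2_closed ev2_ten F)
    qed
    show "x \<bullet> (1 \<otimes> 1) = x" "(1 \<otimes> 1) \<bullet> x = x"
      by (rule tensors2_eqI; simp add: mult2_closed x tensors2_closed ev)+
  qed
  have assoc: "(x \<bullet> y) \<bullet> z = x \<bullet> (y \<bullet> z)"
    if x: "x \<in> tensors2" and y: "y \<in> tensors2" and z: "z \<in> tensors2" for x y z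
  proof (rule tensors2_eqI)
    fix F assume F: "bilin F"
    have *: "bilin (\<lambda>a b. ev2 z (\<lambda>c d. F (a * c) (b * d)))"
      "bilin (\<lambda>a b. F (a' * a) (b' * b))" for a' b'
      by (simp_all add: lin_defs multilinear bilinD[OF F])
    show "ev2 ((x \<bullet> y) \<bullet> z) F = ev2 (x \<bullet> (y \<bullet> z)) F"
      using * by (simp add: ev2_mult x y z F mult2_closed mult.assoc)
  qed (simp_all add: mult2_closed x y z)
  have L_add: "t \<bullet> (x + y) = t \<bullet> x + t \<bullet> y" if "x \<in> tensors2" "y \<in> tensors2" for x y
    by (rule tensors2_eqI)
      (simp_all add: mult2_closed tensors2_closed that t ev2_mult ev2_tensor multilinear)
  have L_scale: "t \<bullet> scale2 c x = scale2 c (t \<bullet> x)" if "x \<in> tensors2" for c x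
    by (rule tensors2_eqI)
      (simp_all add: mult2_closed tensors2_scale that t ev2_mult ev2_tensor multilinear)
  have inj: "x = 0" if "x \<in> tensors2" "t \<bullet> x = 0" for x
  proof -
    have "x = (s \<bullet> t) \<bullet> x" by (simp add: st one that)
    also have "\<dots> = s \<bullet> (t \<bullet> x)" by (simp add: assoc s t that)
    also have "\<dots> = 0"
      by (rule tensors2_eqI)
        (simp_all add: mult2_closed that t s tensors2_closed ev2_mult ev2_tensor ev2_form_0)
    finally show ?thesis .
  qed
  let ?T = "(\<lambda>(a, b). a \<otimes> b) ` (B \<times> B)"
  \<comment> \<open>A maximal independent subset of the products of basis elements is a finite basis
    of the tensors; independence of the whole set need not be known.\<close>
  obtain C where C: "C \<subseteq> ?T" "V2.independent C" "?T \<subseteq> V2.span C"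
    using V2.maximal_independent_subset[of ?T] by blast
  have fC: "finite C" using C(1) by (rule finite_subset) (simp add: finite_Basis)
  have TC: "tensors2 \<subseteq> V2.span C"
    using tensors2_span V2.span_mono[OF C(3)] by (auto simp: V2.span_span)
  have C2: "C \<subseteq> tensors2" using C(1) by (auto simp: tensors2_closed)
  have sub: "V2.subspace tensors2"
    by (auto simp: V2.subspace_def tensors2_closed tensors2_scale)
  have comb: "(\<Sum>c\<in>D. scale2 (w c) (f c)) \<in> tensors2" if "\<And>c. c \<in> D \<Longrightarrow> f c \<in> tensors2" for D w f
    using that by (intro V2.subspace_sum sub V2.subspace_scale)
  have L_comb: "t \<bullet> (\<Sum>c\<in>D. scale2 (w c) c) = (\<Sum>c\<in>D. scale2 (w c) (t \<bullet> c))"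
    if "finite D" "D \<subseteq> tensors2" for D w
    using that
  proof (induction D rule: finite_induct)
    case empty
    show ?case using L_scale[OF tensors2_closed(1), of 0] by (simp add: zero_fun_def)
  next
    case (insert x D)
    then show ?case
      by (simp add: L_add tensors2_scale comb subset_iff L_scale del: plus_fun_apply)
  qed
  have injC: "inj_on (\<lambda>c. t \<bullet> c) C"
  proof (rule inj_onI)
    fix c d assume cd: "c \<in> C" "d \<in> C" "t \<bullet> c = t \<bullet> d"
    then have m: "c \<in> tensors2" "d \<in> tensors2" using C2 by auto
    have "c = (s \<bullet> t) \<bullet> c" by (simp add: st one m)
    also have "\<dots> = (s \<bullet> t) \<bullet> d" by (simp add: assoc s t m cd)
    also have "\<dots> = d" by (simp add: st one m)
    finally show "c = d" .
  qed
  have ind: "V2.independent ((\<lambda>c. t \<bullet> c) ` C)"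
    unfolding V2.dependent_finite[OF finite_imageI[OF fC]]
  proof (rule notI, elim exE conjE bexE)
    fix w v
    assume v: "v \<in> (\<lambda>c. t \<bullet> c) ` C" "w v \<noteq> 0"
      and "(\<Sum>v\<in>(\<lambda>c. t \<bullet> c) ` C. scale2 (w v) v) = 0"
    then have w: "(\<Sum>c\<in>C. scale2 (w (t \<bullet> c)) (t \<bullet> c)) = 0"
      by (simp only: sum.reindex[OF injC] o_def)
    have "(\<Sum>c\<in>C. scale2 (w (t \<bullet> c)) c) = 0"
    proof (rule inj)
      show "(\<Sum>c\<in>C. scale2 (w (t \<bullet> c)) c) \<in> tensors2" using C2 by (intro comb) auto
      show "t \<bullet> (\<Sum>c\<in>C. scale2 (w (t \<bullet> c)) c) = 0"
        using w by (simp only: L_comb[OF fC C2, of "\<lambda>c. w (t \<bullet> c)"])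
    qed
    moreover obtain c where "c \<in> C" "w (t \<bullet> c) \<noteq> 0" using v by blast
    ultimately have "\<exists>u. (\<exists>v\<in>C. u v \<noteq> 0) \<and> (\<Sum>v\<in>C. scale2 (u v) v) = 0"
      by (intro exI[of _ "\<lambda>c. w (t \<bullet> c)"] conjI bexI[of _ c])
    then show False using C(2) unfolding V2.dependent_finite[OF fC] by (rule notE[rotated])
  qed
  \<comment> \<open>Otherwise \<open>1 \<otimes> 1\<close> together with the images of
    \<open>C\<close> would be \<open>card C + 1\<close> independent vectors in the span of
    \<open>C\<close>.\<close>
  have "1 \<otimes> 1 \<in> V2.span ((\<lambda>c. t \<bullet> c) ` C)"
  proof (rule ccontr)
    assume n: "1 \<otimes> 1 \<notin> V2.span ((\<lambda>c. t \<bullet> c) ` C)"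
    then have "V2.independent (insert (1 \<otimes> 1) ((\<lambda>c. t \<bullet> c) ` C))"
      using ind by (rule V2.independent_insertI)
    moreover have "insert (1 \<otimes> 1) ((\<lambda>c. t \<bullet> c) ` C) \<subseteq> V2.span C"
      using TC C2 by (auto simp: tensors2_closed t intro!: mult2_closed)
    ultimately have "card (insert (1 \<otimes> 1) ((\<lambda>c. t \<bullet> c) ` C)) \<le> card C"
      by (rule V2.independent_span_bound[OF fC, THEN conjunct2])
    moreover have "1 \<otimes> 1 \<notin> (\<lambda>c. t \<bullet> c) ` C" using n by (rule contrapos_nn) (rule V2.span_base)
    ultimately show False by (simp add: fC card_image[OF injC])
  qed
  then have "1 \<otimes> 1 \<in> range (\<lambda>w. \<Sum>c\<in>(\<lambda>c. t \<bullet> c) ` C. scale2 (w c) c)"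
    unfolding V2.span_finite[OF finite_imageI[OF fC]] .
  then obtain w where w: "1 \<otimes> 1 = (\<Sum>c\<in>(\<lambda>c. t \<bullet> c) ` C. scale2 (w c) c)"
    by (rule rangeE)
  define x where "x = (\<Sum>c\<in>C. scale2 (w (t \<bullet> c)) c)"
  have "t \<bullet> x = 1 \<otimes> 1"
    unfolding w x_def L_comb[OF fC C2, of "\<lambda>c. w (t \<bullet> c)"] sum.reindex[OF injC] o_def ..
  moreover have "x \<in> tensors2"
    unfolding x_def using C2 by (intro comb) auto
  ultimately have x: "t \<bullet> x = 1 \<otimes> 1" "x \<in> tensors2" .
  \<comment> \<open>The right inverse \<open>x\<close> of \<open>t\<close> coincides with its left
    inverse \<open>s\<close>.\<close>
  have "x = (s \<bullet> t) \<bullet> x" by (simp add: st one x)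
  also have "\<dots> = s" by (simp add: assoc s t x one)
  finally show ?thesis using x by simp
qed

section \<open>Leg permutations, leg maps and inserted units\<close>

text \<open>A lift with values in functions is computed pointwise. This exposes how an inner lift
  depends on its parameters, so that its linearity in them can be checked.\<close>

lemma lift2_fun3:
  assumes "t \<in> tensors2" and F: "\<And>b. Vector_Spaces.linear scale scale3 (\<lambda>a. F a b)"
      "\<And>a. Vector_Spaces.linear scale scale3 (\<lambda>b. F a b)"
  shows "lift2 F t = (\<lambda>f g h. ev2 t (\<lambda>a b. F a b f g h))"
  by (intro ext lift2_ev[OF vs3 assms, of "\<lambda>w. w f g h" for f g h])
    (use F in \<open>simp_all add: linear_scale lin_defs\<close>)

lemma lift2_fun4:
  assumes "t \<in> tensors2" and F: "\<And>b. Vector_Spaces.linear scale scale4 (\<lambda>a. F a b)"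
      "\<And>a. Vector_Spaces.linear scale scale4 (\<lambda>b. F a b)"
  shows "lift2 F t = (\<lambda>f g h k. ev2 t (\<lambda>a b. F a b f g h k))"
  by (intro ext lift2_ev[OF vs4 assms, of "\<lambda>w. w f g h k" for f g h k])
    (use F in \<open>simp_all add: linear_scale lin_defs\<close>)

lemma flip_props:
  assumes t: "t \<in> tensors2"
  shows flip_closed: "flip t \<in> tensors2"
    and ev2_flip: "bilin F \<Longrightarrow> ev2 (flip t) F = ev2 t (\<lambda>a b. F b a)"
proof -
  have lin: "Vector_Spaces.linear scale scale2 (\<lambda>a. b \<otimes> a)"
    "Vector_Spaces.linear scale scale2 (\<lambda>b. b \<otimes> a)" for a b
    by (simp_all add: linear_scale vs2 multilinear)
  show "flip t \<in> tensors2" unfolding flip_def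
    by (intro lift2_closed[OF t lin vs2] tensors2_closed)
  assume F: "bilin F"
  show "ev2 (flip t) F = ev2 t (\<lambda>a b. F b a)" unfolding flip_def
    by (subst lift2_ev[OF vs2 t lin, of "\<lambda>w. ev2 w F"])
      (simp_all add: ev2_tensor ev2_ten F lin_defs multilinear bilinD[OF F])
qed

lemma map2_props:
  assumes t: "t \<in> tensors2"
    and G: "\<And>x y. G (x + y) = G x + G y" "\<And>c x. G (scale c x) = scale c (G x)"
    and K: "\<And>x y. K (x + y) = K x + K y" "\<And>c x. K (scale c x) = scale c (K x)"
  shows map2_closed: "map2 G K t \<in> tensors2"
    and ev2_map2: "bilin F \<Longrightarrow> ev2 (map2 G K t) F = ev2 t (\<lambda>a b. F (G a) (K b))"
proof -
  have lin: "Vector_Spaces.linear scale scale2 (\<lambda>a. G a \<otimes> K b)"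
    "Vector_Spaces.linear scale scale2 (\<lambda>b. G a \<otimes> K b)" for a b
    by (simp_all add: linear_scale vs2 multilinear G K)
  show "map2 G K t \<in> tensors2" unfolding map2_def
    by (intro lift2_closed[OF t lin vs2] tensors2_closed)
  assume F: "bilin F"
  show "ev2 (map2 G K t) F = ev2 t (\<lambda>a b. F (G a) (K b))" unfolding map2_def
    by (subst lift2_ev[OF vs2 t lin, of "\<lambda>w. ev2 w F"])
      (simp_all add: ev2_tensor ev2_ten F lin_defs multilinear bilinD[OF F] G K)
qed

lemma one_ten3_props:
  assumes t: "t \<in> tensors3"
  shows one_ten3_closed: "one_ten3 t \<in> tensors4"
    and ev4_one_ten3: "quadrilin F \<Longrightarrow> ev4 (one_ten3 t) F = ev3 t (\<lambda>a b c. F 1 a b c)"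
proof -
  have lin: "Vector_Spaces.linear scale scale4 (\<lambda>a. ten4 1 a b c)"
    "Vector_Spaces.linear scale scale4 (\<lambda>b. ten4 1 a b c)"
    "Vector_Spaces.linear scale scale4 (\<lambda>c. ten4 1 a b c)" for a b c
    by (simp_all add: linear_scale vs4 multilinear)
  show "one_ten3 t \<in> tensors4" unfolding one_ten3_def
    by (intro lift3_closed[OF t lin vs4] tensors4_closed)
  assume F: "quadrilin F"
  show "ev4 (one_ten3 t) F = ev3 t (\<lambda>a b c. F 1 a b c)" unfolding one_ten3_def
    by (subst lift3_ev[OF vs4 t lin, of "\<lambda>w. ev4 w F"])
      (simp_all add: ev4_tensor ev4_ten F lin_defs multilinear quadrilinD[OF F])
qed

lemma ten3_one_props:
  assumes t: "t \<in> tensors3"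
  shows ten3_one_closed: "ten3_one t \<in> tensors4"
    and ev4_ten3_one: "quadrilin F \<Longrightarrow> ev4 (ten3_one t) F = ev3 t (\<lambda>a b c. F a b c 1)"
proof -
  have lin: "Vector_Spaces.linear scale scale4 (\<lambda>a. ten4 a b c 1)"
    "Vector_Spaces.linear scale scale4 (\<lambda>b. ten4 a b c 1)"
    "Vector_Spaces.linear scale scale4 (\<lambda>c. ten4 a b c 1)" for a b c
    by (simp_all add: linear_scale vs4 multilinear)
  show "ten3_one t \<in> tensors4" unfolding ten3_one_def
    by (intro lift3_closed[OF t lin vs4] tensors4_closed)
  assume F: "quadrilin F"
  show "ev4 (ten3_one t) F = ev3 t (\<lambda>a b c. F a b c 1)" unfolding ten3_one_def
    by (subst lift3_ev[OF vs4 t lin, of "\<lambda>w. ev4 w F"])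
      (simp_all add: ev4_tensor ev4_ten F lin_defs multilinear quadrilinD[OF F])
qed

section \<open>Reordering nested evaluations\<close>

lemma ev2_cong: "(\<And>a b. F a b = G a b) \<Longrightarrow> ev2 t F = ev2 t G"
  by (simp add: ev2_def)

lemma ev3_cong: "(\<And>a b c. F a b c = G a b c) \<Longrightarrow> ev3 t F = ev3 t G"
  by (simp add: ev3_def)

text \<open>Homogeneity read backwards: scalars enter the evaluations, where they can be exchanged
  or merged with other scalars.\<close>

lemmas pull_in = ev2_form(2)[symmetric] ev3_form(2)[symmetric] ev2_form_right[symmetric] ev3_form_right[symmetric]

text \<open>
  The following rules, used backwards together with the congruence rules, show that two nested
  evaluations which differ in the order of the tensors only agree: the outermost tensor of the
  right-hand side is pulled to the front of the left-hand side.
\<close>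

lemma ev22_front:
  assumes "\<And>a b. L a b = ev2 t (M a b)" "\<And>c d. ev2 s (\<lambda>a b. M a b c d) = R c d"
  shows "ev2 s L = ev2 t R"
proof -
  have "ev2 s L = ev2 s (\<lambda>a b. ev2 t (M a b))" by (intro ev2_cong assms)
  also have "\<dots> = ev2 t (\<lambda>c d. ev2 s (\<lambda>a b. M a b c d))" by (rule ev22_swap)
  also have "\<dots> = ev2 t R" by (intro ev2_cong assms)
  finally show ?thesis .
qed

lemma ev23_front:
  assumes "\<And>a b. L a b = ev3 t (M a b)" "\<And>c d e. ev2 s (\<lambda>a b. M a b c d e) = R c d e"
  shows "ev2 s L = ev3 t R"
proof -
  have "ev2 s L = ev2 s (\<lambda>a b. ev3 t (M a b))" by (intro ev2_cong assms)
  also have "\<dots> = ev3 t (\<lambda>c d e. ev2 s (\<lambda>a b. M a b c d e))" by (rule ev23_swap)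
  also have "\<dots> = ev3 t R" by (intro ev3_cong assms)
  finally show ?thesis .
qed

lemma ev32_front:
  assumes "\<And>a b c. L a b c = ev2 t (M a b c)" "\<And>d e. ev3 s (\<lambda>a b c. M a b c d e) = R d e"
  shows "ev3 s L = ev2 t R"
proof -
  have "ev3 s L = ev3 s (\<lambda>a b c. ev2 t (M a b c))" by (intro ev3_cong assms)
  also have "\<dots> = ev2 t (\<lambda>d e. ev3 s (\<lambda>a b c. M a b c d e))" by (rule ev23_swap[symmetric])
  also have "\<dots> = ev2 t R" by (intro ev2_cong assms)
  finally show ?thesis .
qed

lemma ev33_front:
  assumes "\<And>a b c. L a b c = ev3 t (M a b c)" "\<And>d e f. ev3 s (\<lambda>a b c. M a b c d e f) = R d e f"
  shows "ev3 s L = ev3 t R"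
proof -
  have "ev3 s L = ev3 s (\<lambda>a b c. ev3 t (M a b c))" by (intro ev3_cong assms)
  also have "\<dots> = ev3 t (\<lambda>d e f. ev3 s (\<lambda>a b c. M a b c d e f))" by (rule ev33_swap)
  also have "\<dots> = ev3 t R" by (intro ev3_cong assms)
  finally show ?thesis .
qed

text \<open>Congruence precedes exchange, so evaluations of the same tensor are paired in the order
  displayed. Where two copies of \<phi> must trade places, the swap is made explicitly.\<close>

lemmas ev_reorder = refl ev2_cong ev3_cong ev22_front ev23_front ev32_front ev33_front

section \<open>Expressions in a form that come from a tensor\<close>

text \<open>Allows a tensor to be specified by a nested evaluation, without lifts, and to be
  produced as an element afterwards. The inverse of f is constructed in this way.\<close>

definition tensorial :: "(('h \<Rightarrow> 'h \<Rightarrow> 'k) \<Rightarrow> 'k) \<Rightarrow> bool" where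
  "tensorial T \<longleftrightarrow> (\<exists>t\<in>tensors2. \<forall>F. bilin F \<longrightarrow> ev2 t F = T F)"

lemma tensorial_ten: "tensorial (\<lambda>F. F a b)"
  unfolding tensorial_def by (intro bexI[of _ "a \<otimes> b"]) (simp_all add: ev2_ten tensors2_closed)

lemma tensorial_sum:
  assumes "finite I" "\<And>i. tensorial (T i)"
  shows "tensorial (\<lambda>F. \<Sum>i\<in>I. c i * T i F)"
  using assms(1)
proof (induction I rule: finite_induct)
  case empty
  show ?case unfolding tensorial_def
    by (intro bexI[of _ 0]) (simp_all add: ev2_tensor tensors2_closed del: zero_fun_apply)
next
  case (insert i I)
  obtain s where s: "s \<in> tensors2" "\<And>F. bilin F \<Longrightarrow> ev2 s F = (\<Sum>i\<in>I. c i * T i F)"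
    using insert.IH by (auto simp: tensorial_def)
  obtain t where t: "t \<in> tensors2" "\<And>F. bilin F \<Longrightarrow> ev2 t F = T i F"
    using assms(2)[of i] by (auto simp: tensorial_def)
  show ?case unfolding tensorial_def
    using insert.hyps
    by (intro bexI[of _ "scale2 (c i) t + s"])
      (simp_all add: ev2_tensor tensors2_closed tensors2_scale s t del: plus_fun_apply)
qed

lemma tensorial_ev2: "(\<And>a b. tensorial (T a b)) \<Longrightarrow> tensorial (\<lambda>F. ev2 s (\<lambda>a b. T a b F))"
  unfolding ev2_alt by (rule tensorial_sum) (simp_all add: finite_Basis)

lemma tensorial_ev3: "(\<And>a b c. tensorial (T a b c)) \<Longrightarrow> tensorial (\<lambda>F. ev3 s (\<lambda>a b c. T a b c F))"
  unfolding ev3_alt by (rule tensorial_sum) (simp_all add: finite_Basis)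

end

section \<open>Structure identities\<close>

locale finite_quasi_hopf = quasi_hopf_algebra H + finite_algebra "smult H" B
  for H :: "('k::field, 'h::ring_1) quasi_hopf_data" and B :: "'h set"
begin

abbreviation \<phi>_inv where "\<phi>_inv \<equiv> inverse3 \<phi>"
abbreviation cop where "cop a \<equiv> ev2 (\<Delta> a)"
abbreviation asc where "asc \<equiv> ev3 \<phi>"
abbreviation asci where "asci \<equiv> ev3 \<phi>_inv"

section \<open>The axioms as laws of evaluation\<close>

lemma S_linear [multilinear]: "S (x + y) = S x + S y" "S (smult H c x) = smult H c (S x)"
  using antipode_linear by (simp_all add: Vector_Spaces.linear_iff)

lemma S_S_inv [simp]: "S (S_inv x) = x"
  by (rule surj_f_inv_f[OF bij_is_surj[OF antipode_bij]])

lemma S_inv_S [simp]: "S_inv (S x) = x"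
  by (rule inv_f_f[OF bij_is_inj[OF antipode_bij]])

lemma S_inj: "S x = S y \<longleftrightarrow> x = y"
  by (metis S_inv_S)

lemma S_inv_linear [multilinear]:
  "S_inv (x + y) = S_inv x + S_inv y" "S_inv (smult H c x) = smult H c (S_inv x)"
  by (simp_all add: S_inj[symmetric] S_linear)

lemma S_inv_mult: "S_inv (a * b) = S_inv b * S_inv a"
  by (simp add: S_inj[symmetric] antipode_mult)

lemma S_inv_one: "S_inv 1 = 1"
  using antipode_one S_inv_S by metis

lemmas mult_simps = mult.assoc antipode_mult S_inv_mult antipode_one S_inv_one

lemma \<epsilon>_props: "\<epsilon> \<in> dual" "\<epsilon> 1 = 1" "\<epsilon> (a * b) = \<epsilon> a * \<epsilon> b"
  using counit_character by (auto simp: algebra_character_def)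

lemmas \<epsilon>_linear [multilinear] = dualD[OF \<epsilon>_props(1)]

lemma cop_linear [multilinear]: "cop (a + b) F = cop a F + cop b F" "cop (smult H c a) F = c * cop a F"
  by (simp_all add: comult_add comult_smult ev2_tensor)

lemma cop_mult: "bilin F \<Longrightarrow> cop (a * b) F = cop a (\<lambda>a1 a2. cop b (\<lambda>b1 b2. F (a1 * b1) (a2 * b2)))"
  by (simp add: comult_mult ev2_mult comult_closed)

lemma cop_one: "bilin F \<Longrightarrow> cop 1 F = F 1 1"
  by (simp add: comult_one ev2_ten)

lemmas inverse_\<phi> = is_inverse3_inverse3[OF reassoc_closed someI_ex[OF reassoc_invertible]]

lemma \<phi>_inv_closed: "\<phi>_inv \<in> tensors3"
  using inverse_\<phi> by (simp add: is_inverse3_def)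

lemma asc_asci: "trilin F \<Longrightarrow> asc (\<lambda>X Y Z. asci (\<lambda>x y z. F (X * x) (Y * y) (Z * z))) = F 1 1 1"
  using ev3_mult[OF reassoc_closed \<phi>_inv_closed, of F] inverse_\<phi>
  by (simp add: is_inverse3_def ev3_ten)

lemma asci_asc: "trilin F \<Longrightarrow> asci (\<lambda>x y z. asc (\<lambda>X Y Z. F (x * X) (y * Y) (z * Z))) = F 1 1 1"
  using ev3_mult[OF \<phi>_inv_closed reassoc_closed, of F] inverse_\<phi>
  by (simp add: is_inverse3_def ev3_ten)

text \<open>Through this lemma and its threefold analogue, the counit and antipode axioms, stated
  with lifts, become laws for \<open>cop\<close>, \<open>asc\<close> and
  \<open>asci\<close>.\<close>

lemma lift2_scalar:
  assumes "t \<in> tensors2" "f \<in> dual" "\<And>b. Vector_Spaces.linear (smult H) (smult H) (\<lambda>a. F a b)"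
    "\<And>a. Vector_Spaces.linear (smult H) (smult H) (\<lambda>b. F a b)"
  shows "f (lift2 F t) = ev2 t (\<lambda>a b. f (F a b))"
proof (rule lift2_ev[OF vector_space_axioms assms(1,3,4)])
  show "bilin (\<lambda>a b. f (F a b))"
    using assms(3-) by (simp add: lin_defs linear_scale dualD[OF assms(2)])
qed (simp_all add: dualD[OF assms(2)] dual_0[OF assms(2)])

lemma lift3_scalar:
  assumes "t \<in> tensors3" "f \<in> dual" "\<And>b c. Vector_Spaces.linear (smult H) (smult H) (\<lambda>a. F a b c)"
    "\<And>a c. Vector_Spaces.linear (smult H) (smult H) (\<lambda>b. F a b c)"
    "\<And>a b. Vector_Spaces.linear (smult H) (smult H) (\<lambda>c. F a b c)"
  shows "f (lift3 F t) = ev3 t (\<lambda>a b c. f (F a b c))"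
proof (rule lift3_ev[OF vector_space_axioms assms(1,3,4,5)])
  show "trilin (\<lambda>a b c. f (F a b c))"
    using assms(3-) by (simp add: lin_defs linear_scale dualD[OF assms(2)])
qed (simp_all add: dualD[OF assms(2)] dual_0[OF assms(2)])

lemma cop_counit_left: "f \<in> dual \<Longrightarrow> cop a (\<lambda>a1 a2. \<epsilon> a1 * f a2) = f a"
  using lift2_scalar[OF comult_closed, of f "\<lambda>a1 a2. smult H (\<epsilon> a1) a2" a]
  by (simp add: counit_left linear_scale vector_space_axioms multilinear scale_left_distrib
      scale_right_distrib mult.commute dualD(2))

lemma cop_counit_right: "f \<in> dual \<Longrightarrow> cop a (\<lambda>a1 a2. \<epsilon> a2 * f a1) = f a"
  using lift2_scalar[OF comult_closed, of f "\<lambda>a1 a2. smult H (\<epsilon> a2) a1" a]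
  by (simp add: counit_right linear_scale vector_space_axioms multilinear scale_left_distrib
      scale_right_distrib mult.commute dualD(2))

lemma cop_alpha: "f \<in> dual \<Longrightarrow> cop a (\<lambda>a1 a2. f (S a1 * \<alpha> * a2)) = \<epsilon> a * f \<alpha>"
  using lift2_scalar[OF comult_closed, of f "\<lambda>a1 a2. S a1 * \<alpha> * a2" a]
  by (simp add: antipode_alpha linear_scale vector_space_axioms multilinear dualD(2))

lemma cop_beta: "f \<in> dual \<Longrightarrow> cop a (\<lambda>a1 a2. f (a1 * \<beta> * S a2)) = \<epsilon> a * f \<beta>"
  using lift2_scalar[OF comult_closed, of f "\<lambda>a1 a2. a1 * \<beta> * S a2" a]
  by (simp add: antipode_beta linear_scale vector_space_axioms multilinear dualD(2))

lemma asc_antipode: "f \<in> dual \<Longrightarrow> asc (\<lambda>X Y Z. f (X * \<beta> * S Y * \<alpha> * Z)) = f 1"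
  using lift3_scalar[OF reassoc_closed, of f "\<lambda>X Y Z. X * \<beta> * S Y * \<alpha> * Z"]
  by (simp add: antipode_reassoc linear_scale vector_space_axioms multilinear)

lemma asci_antipode: "f \<in> dual \<Longrightarrow> asci (\<lambda>x y z. f (S x * \<alpha> * y * \<beta> * S z)) = f 1"
  using lift3_scalar[OF \<phi>_inv_closed, of f "\<lambda>X Y Z. S X * \<alpha> * Y * \<beta> * S Z"]
  by (simp add: antipode_reassoc_inverse linear_scale vector_space_axioms multilinear)

section \<open>Coproducts applied to a single leg\<close>

lemma id_comult_props:
  assumes t: "t \<in> tensors2"
  shows id_comult_closed: "id_comult t \<in> tensors3"
    and ev3_id_comult: "trilin F \<Longrightarrow>
      ev3 (id_comult t) F = ev2 t (\<lambda>a b. cop b (\<lambda>b1 b2. F a b1 b2))"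
proof -
  let ?I = "\<lambda>a b. lift2 (\<lambda>b1 b2. ten3 a b1 b2) (\<Delta> b)"
  have lin: "Vector_Spaces.linear (smult H) scale3 (\<lambda>b1. ten3 a b1 b2)" "Vector_Spaces.linear (smult H) scale3 (\<lambda>b2. ten3 a b1 b2)" for a b1 b2
    by (simp_all add: linear_scale vs3 multilinear)
  have I: "?I a b = (\<lambda>f g h. cop b (\<lambda>b1 b2. ten3 a b1 b2 f g h))" for a b
    by (rule lift2_fun3[OF comult_closed lin])
  have linI: "Vector_Spaces.linear (smult H) scale3 (\<lambda>a. ?I a b)" "Vector_Spaces.linear (smult H) scale3 (\<lambda>b. ?I a b)" for a b
    unfolding I by (simp_all add: linear_scale vs3 multilinear fun_eq_iff)
  show "id_comult t \<in> tensors3" unfolding id_comult_def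
    by (intro lift2_closed[OF t linI vs3] lift2_closed[OF comult_closed lin vs3] tensors3_closed)
  assume F: "trilin F"
  have inner: "ev3 (?I a b) F = cop b (\<lambda>b1 b2. F a b1 b2)" for a b
    by (subst lift2_ev[OF vs3 comult_closed lin, of "\<lambda>w. ev3 w F"])
      (simp_all add: ev3_tensor ev3_ten F lin_defs multilinear trilinD[OF F])
  show "ev3 (id_comult t) F = ev2 t (\<lambda>a b. cop b (\<lambda>b1 b2. F a b1 b2))" unfolding id_comult_def
    by (subst lift2_ev[OF vs3 t linI, of "\<lambda>w. ev3 w F"])
      (simp_all add: inner ev3_tensor lin_defs multilinear trilinD[OF F])
qed

lemma comult_id_props:
  assumes t: "t \<in> tensors2"
  shows comult_id_closed: "comult_id t \<in> tensors3"
    and ev3_comult_id: "trilin F \<Longrightarrow>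
      ev3 (comult_id t) F = ev2 t (\<lambda>a b. cop a (\<lambda>a1 a2. F a1 a2 b))"
proof -
  let ?I = "\<lambda>a b. lift2 (\<lambda>a1 a2. ten3 a1 a2 b) (\<Delta> a)"
  have lin: "Vector_Spaces.linear (smult H) scale3 (\<lambda>a1. ten3 a1 a2 b)" "Vector_Spaces.linear (smult H) scale3 (\<lambda>a2. ten3 a1 a2 b)" for b a1 a2
    by (simp_all add: linear_scale vs3 multilinear)
  have I: "?I a b = (\<lambda>f g h. cop a (\<lambda>a1 a2. ten3 a1 a2 b f g h))" for a b
    by (rule lift2_fun3[OF comult_closed lin])
  have linI: "Vector_Spaces.linear (smult H) scale3 (\<lambda>a. ?I a b)" "Vector_Spaces.linear (smult H) scale3 (\<lambda>b. ?I a b)" for a b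
    unfolding I by (simp_all add: linear_scale vs3 multilinear fun_eq_iff)
  show "comult_id t \<in> tensors3" unfolding comult_id_def
    by (intro lift2_closed[OF t linI vs3] lift2_closed[OF comult_closed lin vs3] tensors3_closed)
  assume F: "trilin F"
  have inner: "ev3 (?I a b) F = cop a (\<lambda>a1 a2. F a1 a2 b)" for a b
    by (subst lift2_ev[OF vs3 comult_closed lin, of "\<lambda>w. ev3 w F"])
      (simp_all add: ev3_tensor ev3_ten F lin_defs multilinear trilinD[OF F])
  show "ev3 (comult_id t) F = ev2 t (\<lambda>a b. cop a (\<lambda>a1 a2. F a1 a2 b))" unfolding comult_id_def
    by (subst lift2_ev[OF vs3 t linI, of "\<lambda>w. ev3 w F"])
      (simp_all add: inner ev3_tensor lin_defs multilinear trilinD[OF F])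
qed

lemma comult_id_id_props:
  assumes t: "t \<in> tensors3"
  shows comult_id_id_closed: "comult_id_id t \<in> tensors4"
    and ev4_comult_id_id: "quadrilin F \<Longrightarrow>
      ev4 (comult_id_id t) F = ev3 t (\<lambda>a b c. cop a (\<lambda>a1 a2. F a1 a2 b c))"
proof -
  let ?I = "\<lambda>a b c. lift2 (\<lambda>a1 a2. ten4 a1 a2 b c) (\<Delta> a)"
  have lin: "Vector_Spaces.linear (smult H) scale4 (\<lambda>a1. ten4 a1 a2 b c)" "Vector_Spaces.linear (smult H) scale4 (\<lambda>a2. ten4 a1 a2 b c)" for b c a1 a2
    by (simp_all add: linear_scale vs4 multilinear)
  have I: "?I a b c = (\<lambda>f g h k. cop a (\<lambda>a1 a2. ten4 a1 a2 b c f g h k))" for a b c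
    by (rule lift2_fun4[OF comult_closed lin])
  have linI: "Vector_Spaces.linear (smult H) scale4 (\<lambda>a. ?I a b c)" "Vector_Spaces.linear (smult H) scale4 (\<lambda>b. ?I a b c)"
    "Vector_Spaces.linear (smult H) scale4 (\<lambda>c. ?I a b c)" for a b c
    unfolding I by (simp_all add: linear_scale vs4 multilinear fun_eq_iff)
  show "comult_id_id t \<in> tensors4" unfolding comult_id_id_def
    by (intro lift3_closed[OF t linI vs4] lift2_closed[OF comult_closed lin vs4] tensors4_closed)
  assume F: "quadrilin F"
  have inner: "ev4 (?I a b c) F = cop a (\<lambda>a1 a2. F a1 a2 b c)" for a b c
    by (subst lift2_ev[OF vs4 comult_closed lin, of "\<lambda>w. ev4 w F"])
      (simp_all add: ev4_tensor ev4_ten F lin_defs multilinear quadrilinD[OF F])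
  show "ev4 (comult_id_id t) F = ev3 t (\<lambda>a b c. cop a (\<lambda>a1 a2. F a1 a2 b c))" unfolding comult_id_id_def
    by (subst lift3_ev[OF vs4 t linI, of "\<lambda>w. ev4 w F"])
      (simp_all add: inner ev4_tensor lin_defs multilinear quadrilinD[OF F])
qed

lemma id_comult_id_props:
  assumes t: "t \<in> tensors3"
  shows id_comult_id_closed: "id_comult_id t \<in> tensors4"
    and ev4_id_comult_id: "quadrilin F \<Longrightarrow>
      ev4 (id_comult_id t) F = ev3 t (\<lambda>a b c. cop b (\<lambda>b1 b2. F a b1 b2 c))"
proof -
  let ?I = "\<lambda>a b c. lift2 (\<lambda>b1 b2. ten4 a b1 b2 c) (\<Delta> b)"
  have lin: "Vector_Spaces.linear (smult H) scale4 (\<lambda>b1. ten4 a b1 b2 c)" "Vector_Spaces.linear (smult H) scale4 (\<lambda>b2. ten4 a b1 b2 c)" for a c b1 b2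
    by (simp_all add: linear_scale vs4 multilinear)
  have I: "?I a b c = (\<lambda>f g h k. cop b (\<lambda>b1 b2. ten4 a b1 b2 c f g h k))" for a b c
    by (rule lift2_fun4[OF comult_closed lin])
  have linI: "Vector_Spaces.linear (smult H) scale4 (\<lambda>a. ?I a b c)" "Vector_Spaces.linear (smult H) scale4 (\<lambda>b. ?I a b c)"
    "Vector_Spaces.linear (smult H) scale4 (\<lambda>c. ?I a b c)" for a b c
    unfolding I by (simp_all add: linear_scale vs4 multilinear fun_eq_iff)
  show "id_comult_id t \<in> tensors4" unfolding id_comult_id_def
    by (intro lift3_closed[OF t linI vs4] lift2_closed[OF comult_closed lin vs4] tensors4_closed)
  assume F: "quadrilin F"
  have inner: "ev4 (?I a b c) F = cop b (\<lambda>b1 b2. F a b1 b2 c)" for a b c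
    by (subst lift2_ev[OF vs4 comult_closed lin, of "\<lambda>w. ev4 w F"])
      (simp_all add: ev4_tensor ev4_ten F lin_defs multilinear quadrilinD[OF F])
  show "ev4 (id_comult_id t) F = ev3 t (\<lambda>a b c. cop b (\<lambda>b1 b2. F a b1 b2 c))" unfolding id_comult_id_def
    by (subst lift3_ev[OF vs4 t linI, of "\<lambda>w. ev4 w F"])
      (simp_all add: inner ev4_tensor lin_defs multilinear quadrilinD[OF F])
qed

lemma id_id_comult_props:
  assumes t: "t \<in> tensors3"
  shows id_id_comult_closed: "id_id_comult t \<in> tensors4"
    and ev4_id_id_comult: "quadrilin F \<Longrightarrow>
      ev4 (id_id_comult t) F = ev3 t (\<lambda>a b c. cop c (\<lambda>c1 c2. F a b c1 c2))"
proof -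
  let ?I = "\<lambda>a b c. lift2 (\<lambda>c1 c2. ten4 a b c1 c2) (\<Delta> c)"
  have lin: "Vector_Spaces.linear (smult H) scale4 (\<lambda>c1. ten4 a b c1 c2)" "Vector_Spaces.linear (smult H) scale4 (\<lambda>c2. ten4 a b c1 c2)" for a b c1 c2
    by (simp_all add: linear_scale vs4 multilinear)
  have I: "?I a b c = (\<lambda>f g h k. cop c (\<lambda>c1 c2. ten4 a b c1 c2 f g h k))" for a b c
    by (rule lift2_fun4[OF comult_closed lin])
  have linI: "Vector_Spaces.linear (smult H) scale4 (\<lambda>a. ?I a b c)" "Vector_Spaces.linear (smult H) scale4 (\<lambda>b. ?I a b c)"
    "Vector_Spaces.linear (smult H) scale4 (\<lambda>c. ?I a b c)" for a b c
    unfolding I by (simp_all add: linear_scale vs4 multilinear fun_eq_iff)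
  show "id_id_comult t \<in> tensors4" unfolding id_id_comult_def
    by (intro lift3_closed[OF t linI vs4] lift2_closed[OF comult_closed lin vs4] tensors4_closed)
  assume F: "quadrilin F"
  have inner: "ev4 (?I a b c) F = cop c (\<lambda>c1 c2. F a b c1 c2)" for a b c
    by (subst lift2_ev[OF vs4 comult_closed lin, of "\<lambda>w. ev4 w F"])
      (simp_all add: ev4_tensor ev4_ten F lin_defs multilinear quadrilinD[OF F])
  show "ev4 (id_id_comult t) F = ev3 t (\<lambda>a b c. cop c (\<lambda>c1 c2. F a b c1 c2))" unfolding id_id_comult_def
    by (subst lift3_ev[OF vs4 t linI, of "\<lambda>w. ev4 w F"])
      (simp_all add: inner ev4_tensor lin_defs multilinear quadrilinD[OF F])
qed

section \<open>Coassociativity and variants of the pentagon\<close>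

lemma coassoc:
  assumes F: "trilin F"
  shows "cop a (\<lambda>a1 a2. cop a2 (\<lambda>a21 a22. asc (\<lambda>X Y Z. F (a1 * X) (a21 * Y) (a22 * Z)))) =
    asc (\<lambda>X Y Z. cop a (\<lambda>a1 a2. cop a1 (\<lambda>a11 a12. F (X * a11) (Y * a12) (Z * a2))))"
proof -
  have *: "trilin (\<lambda>a b c. asc (\<lambda>X Y Z. F (a * X) (b * Y) (c * Z)))"
    "trilin (\<lambda>a b c. F (X * a) (Y * b) (Z * c))" for X Y Z
    by (simp_all add: lin_defs multilinear trilinD[OF F])
  have "ev3 (id_comult (\<Delta> a) \<bullet>\<^sub>3 \<phi>) F = ev3 (\<phi> \<bullet>\<^sub>3 comult_id (\<Delta> a)) F"
    by (simp add: quasi_coassoc)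
  then show ?thesis
    using * by (simp add: ev3_mult F ev3_id_comult ev3_comult_id comult_closed id_comult_closed
        comult_id_closed reassoc_closed)
qed

lemma pentagon_ev:
  assumes F: "quadrilin F"
  shows "asc (\<lambda>X Y Z. cop Z (\<lambda>Z1 Z2. asc (\<lambda>X' Y' Z'. cop X' (\<lambda>X1 X2.
      F (X * X1) (Y * X2) (Z1 * Y') (Z2 * Z'))))) =
    asc (\<lambda>X Y Z. asc (\<lambda>X' Y' Z'. cop Y' (\<lambda>Y1 Y2. asc (\<lambda>X'' Y'' Z''.
      F (X' * X'') (X * (Y1 * Y'')) (Y * (Y2 * Z'')) (Z * Z')))))"
proof -
  have 1: "quadrilin (\<lambda>a b c d. asc (\<lambda>X' Y' Z'. cop X' (\<lambda>X1 X2. F (a * X1) (b * X2) (c * Y') (d * Z'))))"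
    "quadrilin (\<lambda>a' b' c' d'. F (a * a') (b * b') (c * c') (d * d'))" for a b c d
    by (simp_all add: lin_defs multilinear quadrilinD[OF F])
  have 2: "quadrilin (\<lambda>a b c d. asc (\<lambda>X Y Z. F (a * X) (b * Y) (c * Z) d))"
    "quadrilin (\<lambda>a b c d. asc (\<lambda>X Y Z. F (a' * a * X) (b' * b * Y) (c' * c * Z) (d' * d)))"
    "quadrilin (\<lambda>a b c d. asc (\<lambda>X Y Z. cop Y (\<lambda>Y1 Y2. asc (\<lambda>X' Y' Z'. F (a * X * X') (b * Y1 * Y') (c * Y2 * Z') (d * Z)))))" for a' b' c' d'
    by (simp_all add: lin_defs multilinear quadrilinD[OF F])
  have "ev4 (id_id_comult \<phi> \<bullet>\<^sub>4 comult_id_id \<phi>) F =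
    ev4 (one_ten3 \<phi> \<bullet>\<^sub>4 id_comult_id \<phi> \<bullet>\<^sub>4 ten3_one \<phi>) F"
    by (simp add: pentagon)
  then show ?thesis
    using 1 2 by (simp add: ev4_mult F mult4_closed ev4_id_id_comult ev4_comult_id_id ev4_one_ten3
        ev4_id_comult_id ev4_ten3_one id_id_comult_closed comult_id_id_closed one_ten3_closed
        id_comult_id_closed ten3_one_closed reassoc_closed mult.assoc)
qed

text \<open>\<Delta> applied to the first leg of \<phi> \<phi>^-1 = 1. This and its companions
  create or cancel pairs around the pentagon.\<close>

lemma asc_asci_cop1:
  assumes F: "quadrilin F"
  shows "asc (\<lambda>X Y Z. asci (\<lambda>x y z. cop X (\<lambda>X1 X2. cop x (\<lambda>x1 x2.
    F (X1 * x1) (X2 * x2) (Y * y) (Z * z))))) = F 1 1 1 1"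
proof -
  note GD = quadrilinD[OF F]
  have b: "bilin (\<lambda>u v. F u v c d)" for c d by (simp add: lin_defs multilinear GD)
  have t: "trilin (\<lambda>a c d. cop a (\<lambda>u v. F u v c d))" by (simp add: lin_defs multilinear GD)
  show ?thesis using asc_asci[OF t] by (simp add: cop_mult[OF b] cop_one[OF b])
qed

lemma asc_asci_cop2:
  assumes F: "quadrilin F"
  shows "asc (\<lambda>X Y Z. asci (\<lambda>x y z. cop Y (\<lambda>Y1 Y2. cop y (\<lambda>y1 y2.
    F (X * x) (Y1 * y1) (Y2 * y2) (Z * z))))) = F 1 1 1 1"
proof -
  note GD = quadrilinD[OF F]
  have b: "bilin (\<lambda>u v. F c u v d)" for c d by (simp add: lin_defs multilinear GD)
  have t: "trilin (\<lambda>c a d. cop a (\<lambda>u v. F c u v d))" by (simp add: lin_defs multilinear GD)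
  show ?thesis using asc_asci[OF t] by (simp add: cop_mult[OF b] cop_one[OF b])
qed

lemma asci_asc_cop3:
  assumes F: "quadrilin F"
  shows "asci (\<lambda>x y z. asc (\<lambda>X Y Z. cop z (\<lambda>z1 z2. cop Z (\<lambda>Z1 Z2.
    F (x * X) (y * Y) (z1 * Z1) (z2 * Z2))))) = F 1 1 1 1"
proof -
  note GD = quadrilinD[OF F]
  have b: "bilin (\<lambda>u v. F c d u v)" for c d by (simp add: lin_defs multilinear GD)
  have t: "trilin (\<lambda>c d a. cop a (\<lambda>u v. F c d u v))" by (simp add: lin_defs multilinear GD)
  show ?thesis using asci_asc[OF t] by (simp add: cop_mult[OF b] cop_one[OF b])
qed

text \<open>The pentagon solved for (1 \<otimes> \<phi>^-1)(id \<otimes> id \<otimes>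
  \<Delta>)(\<phi>) = (id \<otimes> \<Delta> \<otimes> id)(\<phi>)(\<phi> \<otimes> 1)(\<Delta>
  \<otimes> id \<otimes> id)(\<phi>^-1): a trivial pair is inserted on the right, the pentagon is
  applied, and 1 \<otimes> \<phi> is cancelled on the left. The left-hand side is the tensor from
  which \<gamma> is built.\<close>

lemma pentagon_left:
  assumes F: "quadrilin F"
  shows "asci (\<lambda>x y z. asc (\<lambda>X Y Z. cop Z (\<lambda>Z1 Z2. F X (x * Y) (y * Z1) (z * Z2)))) =
    asc (\<lambda>X Y Z. cop Y (\<lambda>Y1 Y2. asc (\<lambda>X' Y' Z'. asci (\<lambda>x y z. cop x (\<lambda>x1 x2.
      F (X * X' * x1) (Y1 * Y' * x2) (Y2 * Z' * y) (Z * z))))))"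
proof -
  note GD = quadrilinD[OF F]
  let ?F = "\<lambda>a b c d. asci (\<lambda>x' y' z'. asci (\<lambda>x y z. cop x (\<lambda>x1 x2.
    F (a * x1) (x' * b * x2) (y' * c * y) (z' * d * z))))"
  have q: "quadrilin ?F" by (simp add: lin_defs multilinear GD)
  have q1: "quadrilin (\<lambda>a b c d. F (X * a) (x * Y * b) (y * Z1 * c) (z * Z2 * d))" for x y z X Y Z1 Z2
    by (simp add: lin_defs multilinear GD)
  have t: "trilin (\<lambda>a b c. asc (\<lambda>X' Y' Z'. cop Y' (\<lambda>Y1 Y2. asc (\<lambda>X'' Y'' Z''. asci (\<lambda>x y z.
    cop x (\<lambda>x1 x2. F (X' * X'' * x1) (a * Y1 * Y'' * x2) (b * Y2 * Z'' * y) (c * Z' * z)))))))"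
    by (simp add: lin_defs multilinear GD)
  have "asci (\<lambda>x y z. asc (\<lambda>X Y Z. cop Z (\<lambda>Z1 Z2. F X (x * Y) (y * Z1) (z * Z2)))) =
    asci (\<lambda>x' y' z'. asc (\<lambda>X Y Z. cop Z (\<lambda>Z1 Z2. asc (\<lambda>X' Y' Z'. asci (\<lambda>x y z.
      cop X' (\<lambda>X1 X2. cop x (\<lambda>x1 x2. F (X * (X1 * x1)) (x' * Y * (X2 * x2))
        (y' * Z1 * (Y' * y)) (z' * Z2 * (Z' * z)))))))))"
    by (simp add: asc_asci_cop1[OF q1])
  also have "\<dots> = asc (\<lambda>X Y Z. cop Z (\<lambda>Z1 Z2. asc (\<lambda>X' Y' Z'. cop X' (\<lambda>X1 X2.
      ?F (X * X1) (Y * X2) (Z1 * Y') (Z2 * Z')))))"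
    by ((unfold mult_simps)?, (rule ev_reorder)+)
  also have "\<dots> = asc (\<lambda>X Y Z. asc (\<lambda>X' Y' Z'. cop Y' (\<lambda>Y1 Y2. asc (\<lambda>X'' Y'' Z''.
      ?F (X' * X'') (X * (Y1 * Y'')) (Y * (Y2 * Z'')) (Z * Z')))))"
    by (rule pentagon_ev[OF q])
  also have "\<dots> = asci (\<lambda>x y z. asc (\<lambda>X Y Z. asc (\<lambda>X' Y' Z'. cop Y' (\<lambda>Y1 Y2.
      asc (\<lambda>X'' Y'' Z''. asci (\<lambda>x' y' z'. cop x' (\<lambda>x1 x2. F (X' * X'' * x1)
        (x * X * Y1 * Y'' * x2) (y * Y * Y2 * Z'' * y') (z * Z * Z' * z'))))))))"
    by ((unfold mult_simps)?, (rule ev_reorder)+)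
  also have "\<dots> = asc (\<lambda>X Y Z. cop Y (\<lambda>Y1 Y2. asc (\<lambda>X' Y' Z'. asci (\<lambda>x y z. cop x (\<lambda>x1 x2.
      F (X * X' * x1) (Y1 * Y' * x2) (Y2 * Z' * y) (Z * z))))))"
    using asci_asc[OF t] by simp
  finally show ?thesis .
qed

text \<open>The pentagon in the form (\<Delta> \<otimes> id \<otimes> id)(\<phi>)(\<phi>^-1
  \<otimes> 1)(id \<otimes> \<Delta> \<otimes> id)(\<phi>^-1) = (id \<otimes> id \<otimes>
  \<Delta>)(\<phi>^-1)(1 \<otimes> \<phi>). Contracting its middle legs with \<beta> and \<alpha>
  makes both inner coproducts collapse, which is how it is used.\<close>

lemma pentagon_right:
  assumes F: "quadrilin F"
  shows "asc (\<lambda>X Y Z. cop X (\<lambda>X1 X2. asci (\<lambda>x' y' z'. cop y' (\<lambda>y1 y2. asci (\<lambda>x y z.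
      F (X1 * x * x') (X2 * y * y1) (Y * z * y2) (Z * z')))))) =
    asci (\<lambda>x y z. cop z (\<lambda>z1 z2. asc (\<lambda>X Y Z. F x (y * X) (z1 * Y) (z2 * Z))))"
proof -
  note GD = quadrilinD[OF F]
  let ?F = "\<lambda>a b c d. asci (\<lambda>u v w. cop w (\<lambda>w1 w2. asci (\<lambda>x' y' z'. cop y' (\<lambda>y1 y2.
    asci (\<lambda>x y z. F (u * a * x * x') (v * b * y * y1) (w1 * c * z * y2) (w2 * d * z'))))))"
  have q: "quadrilin ?F" by (simp add: lin_defs multilinear GD)
  have q1: "quadrilin (\<lambda>a b c d. asc (\<lambda>X Y Z. cop X (\<lambda>X1 X2. asci (\<lambda>x' y' z'. cop y' (\<lambda>y1 y2. asci (\<lambda>x y z.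
      F (a * X1 * x * x') (b * X2 * y * y1) (c * Y * z * y2) (d * Z * z')))))))"
    by (simp add: lin_defs multilinear GD)
  have t: "trilin (\<lambda>a b c. F (u * X' * a * x') (v * X * Y1 * b * y1) (w1 * Y * Y2 * c * y2) (w2 * Z * Z' * z'))"
    for u X' x' v X Y1 y1 w1 Y Y2 y2 w2 Z Z' z' by (simp add: lin_defs multilinear GD)
  have q2: "quadrilin (\<lambda>a b c d. F (u * a) (v * X * b) (w1 * Y * c) (w2 * Z * d))"
    for u v X w1 Y w2 Z by (simp add: lin_defs multilinear GD)
  have "asc (\<lambda>X Y Z. cop X (\<lambda>X1 X2. asci (\<lambda>x' y' z'. cop y' (\<lambda>y1 y2. asci (\<lambda>x y z.
      F (X1 * x * x') (X2 * y * y1) (Y * z * y2) (Z * z')))))) =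
    asci (\<lambda>u v w. asc (\<lambda>X Y Z. cop w (\<lambda>w1 w2. cop Z (\<lambda>Z1 Z2. asc (\<lambda>X' Y' Z'. cop X' (\<lambda>X1 X2.
      asci (\<lambda>x' y' z'. cop y' (\<lambda>y1 y2. asci (\<lambda>x y z.
      F (u * X * X1 * x * x') (v * Y * X2 * y * y1) (w1 * Z1 * Y' * z * y2) (w2 * Z2 * Z' * z'))))))))))"
    using asci_asc_cop3[OF q1] by simp
  also have "\<dots> = asc (\<lambda>X Y Z. cop Z (\<lambda>Z1 Z2. asc (\<lambda>X' Y' Z'. cop X' (\<lambda>X1 X2.
      ?F (X * X1) (Y * X2) (Z1 * Y') (Z2 * Z')))))"
    by ((unfold mult_simps)?, (rule ev_reorder)+)
  also have "\<dots> = asc (\<lambda>X Y Z. asc (\<lambda>X' Y' Z'. cop Y' (\<lambda>Y1 Y2. asc (\<lambda>X'' Y'' Z''.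
      ?F (X' * X'') (X * (Y1 * Y'')) (Y * (Y2 * Z'')) (Z * Z')))))"
    by (rule pentagon_ev[OF q])
  also have "\<dots> = asci (\<lambda>u v w. cop w (\<lambda>w1 w2. asc (\<lambda>X Y Z. asc (\<lambda>X' Y' Z'. asci (\<lambda>x' y' z'.
      cop Y' (\<lambda>Y1 Y2. cop y' (\<lambda>y1 y2. asc (\<lambda>X'' Y'' Z''. asci (\<lambda>x y z.
      F (u * X' * (X'' * x) * x') (v * X * Y1 * (Y'' * y) * y1) (w1 * Y * Y2 * (Z'' * z) * y2) (w2 * Z * Z' * z'))))))))))"
    by ((unfold mult_simps)?, (rule ev_reorder)+)
  also have "\<dots> = asci (\<lambda>u v w. cop w (\<lambda>w1 w2. asc (\<lambda>X Y Z. asc (\<lambda>X' Y' Z'. asci (\<lambda>x' y' z'.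
      cop Y' (\<lambda>Y1 Y2. cop y' (\<lambda>y1 y2.
      F (u * (X' * x')) (v * X * (Y1 * y1)) (w1 * Y * (Y2 * y2)) (w2 * Z * (Z' * z')))))))))"
    by (simp only: asc_asci[OF t], simp only: mult.assoc mult_1_left mult_1_right)
  also have "\<dots> = asci (\<lambda>x y z. cop z (\<lambda>z1 z2. asc (\<lambda>X Y Z. F x (y * X) (z1 * Y) (z2 * Z))))"
    by (simp add: asc_asci_cop2[OF q2])
  finally show ?thesis .
qed

section \<open>The counit on the legs of the reassociator\<close>

lemma asc_counit2: "bilin G \<Longrightarrow> asc (\<lambda>X Y Z. \<epsilon> Y * G X Z) = G 1 1"
proof -
  assume G: "bilin G"
  note GD = bilinD[OF G]
  have "ev2 (lift3 (\<lambda>x y z. smult H (\<epsilon> y) x \<otimes> z) \<phi>) G = asc (\<lambda>X Y Z. ev2 (smult H (\<epsilon> Y) X \<otimes> Z) G)"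
    by (rule lift3_ev[OF vs2 reassoc_closed, of _ "\<lambda>w. ev2 w G"])
      (simp_all add: linear_scale vs2 multilinear ev2_tensor ev2_ten G lin_defs GD fun_eq_iff algebra_simps
        scale_left_distrib scale_right_distrib)
  then show ?thesis by (simp add: counit_reassoc ev2_ten G GD)
qed

text \<open>Put e = (\<epsilon> \<otimes> id \<otimes> id)(\<phi>). Applying \<epsilon> \<otimes>
  \<epsilon> \<otimes> id \<otimes> id to the pentagon gives e = e e, the remaining factors
  collapsing by the counit axioms. Since e is invertible, with inverse (\<epsilon> \<otimes> id
  \<otimes> id)(\<phi>^-1), it is 1 \<otimes> 1.\<close>

lemma asc_counit1:
  assumes G: "bilin G"
  shows "asc (\<lambda>X Y Z. \<epsilon> X * G Y Z) = G 1 1"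
proof -
  note GD = bilinD[OF G]
  have idem: "asc (\<lambda>X Y Z. \<epsilon> X * G Y Z) =
    asc (\<lambda>X Y Z. asc (\<lambda>X' Y' Z'. \<epsilon> X * (\<epsilon> X' * G (Y * Y') (Z * Z'))))" if G: "bilin G" for G
  proof -
    note GD = bilinD[OF G]
    have q: "quadrilin (\<lambda>a b c d. \<epsilon> a * (\<epsilon> b * G c d))" by (simp add: lin_defs multilinear GD algebra_simps)
    have b1: "bilin (\<lambda>X Z. \<epsilon> X * cop Z (\<lambda>Z1 Z2. asc (\<lambda>X' Y' Z'. \<epsilon> X' * G (Z1 * Y') (Z2 * Z'))))"
      by (simp add: lin_defs multilinear GD algebra_simps)
    have b1': "bilin (\<lambda>Z1 Z2. asc (\<lambda>X' Y' Z'. \<epsilon> X' * G (Z1 * Y') (Z2 * Z')))"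
      by (simp add: lin_defs multilinear GD algebra_simps)
    have b2: "bilin (\<lambda>X'' Z''. \<epsilon> X'' * G (Y * (Y2 * Z'')) (Z * Z'))" for Y Y2 Z Z'
      by (simp add: lin_defs multilinear GD algebra_simps)
    have f: "(\<lambda>Y2. G (Y * Y2) Z) \<in> dual" for Y Z by (simp add: lin_defs multilinear GD)
    have "asc (\<lambda>X Y Z. cop Z (\<lambda>Z1 Z2. asc (\<lambda>X' Y' Z'. cop X' (\<lambda>X1 X2.
      \<epsilon> (X * X1) * (\<epsilon> (Y * X2) * G (Z1 * Y') (Z2 * Z')))))) =
      asc (\<lambda>X Y Z. \<epsilon> Y * (\<epsilon> X * cop Z (\<lambda>Z1 Z2. asc (\<lambda>X' Y' Z'.
        cop X' (\<lambda>X1 X2. \<epsilon> X1 * \<epsilon> X2) * G (Z1 * Y') (Z2 * Z')))))"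
      by (simp add: \<epsilon>_props pull_in algebra_simps)
    also have "\<dots> = asc (\<lambda>X Y Z. \<epsilon> X * G Y Z)"
      by (simp add: cop_counit_left \<epsilon>_props asc_counit2[OF b1] cop_one[OF b1'])
    finally have L: "asc (\<lambda>X Y Z. cop Z (\<lambda>Z1 Z2. asc (\<lambda>X' Y' Z'. cop X' (\<lambda>X1 X2.
      \<epsilon> (X * X1) * (\<epsilon> (Y * X2) * G (Z1 * Y') (Z2 * Z')))))) = asc (\<lambda>X Y Z. \<epsilon> X * G Y Z)" .
    have "asc (\<lambda>X Y Z. asc (\<lambda>X' Y' Z'. cop Y' (\<lambda>Y1 Y2. asc (\<lambda>X'' Y'' Z''.
      \<epsilon> (X' * X'') * (\<epsilon> (X * (Y1 * Y'')) * G (Y * (Y2 * Z'')) (Z * Z')))))) =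
      asc (\<lambda>X Y Z. asc (\<lambda>X' Y' Z'. \<epsilon> X * (\<epsilon> X' * cop Y' (\<lambda>Y1 Y2. \<epsilon> Y1 * asc (\<lambda>X'' Y'' Z''.
        \<epsilon> Y'' * (\<epsilon> X'' * G (Y * (Y2 * Z'')) (Z * Z')))))))"
      by (simp add: \<epsilon>_props pull_in algebra_simps)
    also have "\<dots> = asc (\<lambda>X Y Z. asc (\<lambda>X' Y' Z'. \<epsilon> X * (\<epsilon> X' * G (Y * Y') (Z * Z'))))"
      by (simp add: asc_counit2[OF b2] \<epsilon>_props cop_counit_left[OF f])
    finally show ?thesis using pentagon_ev[OF q] L by simp
  qed
  have t: "trilin (\<lambda>a b c. \<epsilon> a * G b c)" "trilin (\<lambda>a b c. \<epsilon> a * asc (\<lambda>X Y Z. \<epsilon> X * G (b * Y) (c * Z)))"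
    by (simp_all add: lin_defs multilinear GD algebra_simps)
  have bb: "bilin (\<lambda>b c. G (y * b) (z * c))" for y z by (simp add: lin_defs multilinear GD)
  have "G 1 1 = asci (\<lambda>x y z. asc (\<lambda>X Y Z. \<epsilon> (x * X) * G (y * Y) (z * Z)))"
    using asci_asc[OF t(1)] by (simp add: \<epsilon>_props)
  also have "\<dots> = asci (\<lambda>x y z. \<epsilon> x * asc (\<lambda>X Y Z. \<epsilon> X * G (y * Y) (z * Z)))"
    by (simp add: \<epsilon>_props pull_in mult.assoc)
  also have "\<dots> = asci (\<lambda>x y z. \<epsilon> x * asc (\<lambda>X Y Z. asc (\<lambda>X' Y' Z'. \<epsilon> X * (\<epsilon> X' * G (y * (Y * Y')) (z * (Z * Z'))))))"
    by (simp add: idem[OF bb])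
  also have "\<dots> = asci (\<lambda>x y z. asc (\<lambda>X Y Z. \<epsilon> (x * X) * asc (\<lambda>X' Y' Z'. \<epsilon> X' * G (y * Y * Y') (z * Z * Z'))))"
    by (simp add: \<epsilon>_props pull_in mult.assoc)
  also have "\<dots> = asc (\<lambda>X Y Z. \<epsilon> X * G Y Z)"
    using asci_asc[OF t(2)] by (simp add: \<epsilon>_props)
  finally show ?thesis by simp
qed

text \<open>Mirror image of \<open>asc_counit1\<close>: the counit is applied to the last two legs
  of the pentagon.\<close>

lemma asc_counit3:
  assumes G: "bilin G"
  shows "asc (\<lambda>X Y Z. \<epsilon> Z * G X Y) = G 1 1"
proof -
  note GD = bilinD[OF G]
  have idem: "asc (\<lambda>X Y Z. \<epsilon> Z * G X Y) =
    asc (\<lambda>X Y Z. asc (\<lambda>X' Y' Z'. \<epsilon> Z * (\<epsilon> Z' * G (X * X') (Y * Y'))))" if G: "bilin G" for G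
  proof -
    note GD = bilinD[OF G]
    have q: "quadrilin (\<lambda>a b c d. \<epsilon> c * (\<epsilon> d * G a b))" by (simp add: lin_defs multilinear GD algebra_simps)
    have b1: "bilin (\<lambda>X' Z'. \<epsilon> Z' * cop X' (\<lambda>X1 X2. G (X * X1) (Y * X2)))" for X Y
      by (simp add: lin_defs multilinear GD algebra_simps)
    have b1': "bilin (\<lambda>Z1 Z2. G (X * Z1) (Y * Z2))" for X Y
      by (simp add: lin_defs multilinear GD algebra_simps)
    have b2: "bilin (\<lambda>X Z. \<epsilon> Z * asc (\<lambda>X' Y' Z'. \<epsilon> Z' * asc (\<lambda>X'' Y'' Z''.
        \<epsilon> Z'' * cop Y' (\<lambda>Y1 Y2. \<epsilon> Y2 * G (X' * X'') (X * (Y1 * Y''))))))"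
      by (simp add: lin_defs multilinear GD algebra_simps)
    have f: "(\<lambda>Y2. G X (Y2 * Y)) \<in> dual" for X Y by (simp add: lin_defs multilinear GD)
    have "asc (\<lambda>X Y Z. cop Z (\<lambda>Z1 Z2. asc (\<lambda>X' Y' Z'. cop X' (\<lambda>X1 X2.
      \<epsilon> (Z1 * Y') * (\<epsilon> (Z2 * Z') * G (X * X1) (Y * X2)))))) =
      asc (\<lambda>X Y Z. cop Z (\<lambda>Z1 Z2. \<epsilon> Z1 * \<epsilon> Z2 * asc (\<lambda>X' Y' Z'.
        \<epsilon> Y' * (\<epsilon> Z' * cop X' (\<lambda>X1 X2. G (X * X1) (Y * X2))))))"
      by (simp add: \<epsilon>_props pull_in algebra_simps)
    also have "\<dots> = asc (\<lambda>X Y Z. cop Z (\<lambda>Z1 Z2. \<epsilon> Z1 * \<epsilon> Z2) * asc (\<lambda>X' Y' Z'.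
        \<epsilon> Y' * (\<epsilon> Z' * cop X' (\<lambda>X1 X2. G (X * X1) (Y * X2)))))"
      by (simp only: ev2_form_right)
    also have "\<dots> = asc (\<lambda>X Y Z. \<epsilon> Z * G X Y)"
      by (simp add: cop_counit_left \<epsilon>_props asc_counit2[OF b1] cop_one[OF b1'])
    finally have L: "asc (\<lambda>X Y Z. cop Z (\<lambda>Z1 Z2. asc (\<lambda>X' Y' Z'. cop X' (\<lambda>X1 X2.
      \<epsilon> (Z1 * Y') * (\<epsilon> (Z2 * Z') * G (X * X1) (Y * X2)))))) = asc (\<lambda>X Y Z. \<epsilon> Z * G X Y)" .
    have "asc (\<lambda>X Y Z. asc (\<lambda>X' Y' Z'. cop Y' (\<lambda>Y1 Y2. asc (\<lambda>X'' Y'' Z''.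
      \<epsilon> (Y * (Y2 * Z'')) * (\<epsilon> (Z * Z') * G (X' * X'') (X * (Y1 * Y''))))))) =
      asc (\<lambda>X Y Z. asc (\<lambda>X' Y' Z'. asc (\<lambda>X'' Y'' Z''. cop Y' (\<lambda>Y1 Y2.
      \<epsilon> (Y * (Y2 * Z'')) * (\<epsilon> (Z * Z') * G (X' * X'') (X * (Y1 * Y'')))))))"
      by (rule ev_reorder)+
    also have "\<dots> = asc (\<lambda>X Y Z. \<epsilon> Y * (\<epsilon> Z * asc (\<lambda>X' Y' Z'. \<epsilon> Z' * asc (\<lambda>X'' Y'' Z''.
        \<epsilon> Z'' * cop Y' (\<lambda>Y1 Y2. \<epsilon> Y2 * G (X' * X'') (X * (Y1 * Y'')))))))"
      by (simp add: \<epsilon>_props pull_in algebra_simps)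
    also have "\<dots> = asc (\<lambda>X Y Z. asc (\<lambda>X' Y' Z'. \<epsilon> Z * (\<epsilon> Z' * G (X * X') (Y * Y'))))"
      by (simp only: asc_counit2[OF b2])
        (simp add: \<epsilon>_props cop_counit_right[OF f] ev3_form(2))
    finally show ?thesis using pentagon_ev[OF q] L by simp
  qed
  have t: "trilin (\<lambda>b c a. \<epsilon> a * G b c)" "trilin (\<lambda>b c a. \<epsilon> a * asc (\<lambda>X Y Z. \<epsilon> Z * G (b * X) (c * Y)))"
    by (simp_all add: lin_defs multilinear GD algebra_simps)
  have bb: "bilin (\<lambda>b c. G (y * b) (z * c))" for y z by (simp add: lin_defs multilinear GD)
  have "G 1 1 = asci (\<lambda>x y z. asc (\<lambda>X Y Z. \<epsilon> (z * Z) * G (x * X) (y * Y)))"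
    using asci_asc[OF t(1)] by (simp add: \<epsilon>_props)
  also have "\<dots> = asci (\<lambda>x y z. \<epsilon> z * asc (\<lambda>X Y Z. \<epsilon> Z * G (x * X) (y * Y)))"
    by (simp add: \<epsilon>_props pull_in mult.assoc)
  also have "\<dots> = asci (\<lambda>x y z. \<epsilon> z * asc (\<lambda>X Y Z. asc (\<lambda>X' Y' Z'. \<epsilon> Z * (\<epsilon> Z' * G (x * (X * X')) (y * (Y * Y'))))))"
    by (simp add: idem[OF bb])
  also have "\<dots> = asci (\<lambda>x y z. asc (\<lambda>X Y Z. \<epsilon> (z * Z) * asc (\<lambda>X' Y' Z'. \<epsilon> Z' * G (x * X * X') (y * Y * Y'))))"
    by (simp add: \<epsilon>_props pull_in mult.assoc)
  also have "\<dots> = asc (\<lambda>X Y Z. \<epsilon> Z * G X Y)"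
    using asci_asc[OF t(2)] by (simp add: \<epsilon>_props)
  finally show ?thesis by simp
qed

lemma asci_counit:
  assumes G: "bilin G"
  shows asci_counit1: "asci (\<lambda>x y z. \<epsilon> x * G y z) = G 1 1"
    and asci_counit2: "asci (\<lambda>x y z. \<epsilon> y * G x z) = G 1 1"
    and asci_counit3: "asci (\<lambda>x y z. \<epsilon> z * G x y) = G 1 1"
proof -
  note GD = bilinD[OF G]
  have b: "bilin (\<lambda>c d. G (y * c) (z * d))" for y z by (simp add: lin_defs multilinear GD)
  have t: "trilin (\<lambda>a b c. \<epsilon> a * G b c)" "trilin (\<lambda>b a c. \<epsilon> a * G b c)" "trilin (\<lambda>b c a. \<epsilon> a * G b c)"
    by (simp_all add: lin_defs multilinear GD algebra_simps)
  show "asci (\<lambda>x y z. \<epsilon> x * G y z) = G 1 1"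
    using asci_asc[OF t(1)] by (simp add: \<epsilon>_props mult.assoc multilinear asc_counit1[OF b])
  show "asci (\<lambda>x y z. \<epsilon> y * G x z) = G 1 1"
    using asci_asc[OF t(2)] by (simp add: \<epsilon>_props mult.assoc multilinear asc_counit2[OF b])
  show "asci (\<lambda>x y z. \<epsilon> z * G x y) = G 1 1"
    using asci_asc[OF t(3)] by (simp add: \<epsilon>_props mult.assoc multilinear asc_counit3[OF b])
qed

text \<open>\<open>coassoc\<close> multiplied by \<phi>^-1 on both sides: \<phi>^-1 \<phi> is
  inserted on the left and \<phi> \<phi>^-1 disappears on the right.\<close>

lemma coassoc_inv:
  assumes F: "trilin F"
  shows "cop a (\<lambda>a1 a2. cop a1 (\<lambda>a11 a12. asci (\<lambda>x y z. F (a11 * x) (a12 * y) (a2 * z)))) =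
    asci (\<lambda>x y z. cop a (\<lambda>a1 a2. cop a2 (\<lambda>a21 a22. F (x * a1) (y * a21) (z * a22))))"
proof -
  note GD = trilinD[OF F]
  let ?F = "\<lambda>u v w. asci (\<lambda>x' y' z'. asci (\<lambda>x y z. F (x' * u * x) (y' * v * y) (z' * w * z)))"
  have t: "trilin ?F" by (simp add: lin_defs multilinear GD)
  have t1: "trilin (\<lambda>u v w. F (x' * a1 * u) (y' * a21 * v) (z' * a22 * w))" for x' y' z' a1 a21 a22 by (simp add: lin_defs multilinear GD)
  have t2: "trilin (\<lambda>u v w. cop a (\<lambda>a1 a2. cop a1 (\<lambda>a11 a12. asci (\<lambda>x y z. F (u * a11 * x) (v * a12 * y) (w * a2 * z)))))"
    by (simp add: lin_defs multilinear GD)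
  have "cop a (\<lambda>a1 a2. cop a1 (\<lambda>a11 a12. asci (\<lambda>x y z. F (a11 * x) (a12 * y) (a2 * z)))) =
    asci (\<lambda>x' y' z'. asc (\<lambda>X Y Z. cop a (\<lambda>a1 a2. cop a1 (\<lambda>a11 a12. asci (\<lambda>x y z.
      F (x' * X * a11 * x) (y' * Y * a12 * y) (z' * Z * a2 * z))))))"
    using asci_asc[OF t2] by simp
  also have "\<dots> = asc (\<lambda>X Y Z. cop a (\<lambda>a1 a2. cop a1 (\<lambda>a11 a12. ?F (X * a11) (Y * a12) (Z * a2))))"
    by ((unfold mult_simps)?, (rule ev_reorder)+)
  also have "\<dots> = cop a (\<lambda>a1 a2. cop a2 (\<lambda>a21 a22. asc (\<lambda>X Y Z. ?F (a1 * X) (a21 * Y) (a22 * Z))))"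
    by (rule coassoc[OF t, symmetric])
  also have "\<dots> = asci (\<lambda>x y z. cop a (\<lambda>a1 a2. cop a2 (\<lambda>a21 a22. asc (\<lambda>X Y Z. asci (\<lambda>x' y' z'.
      F (x * a1 * (X * x')) (y * a21 * (Y * y')) (z * a22 * (Z * z')))))))"
    by ((unfold mult_simps)?, (rule ev_reorder)+)
  also have "\<dots> = asci (\<lambda>x y z. cop a (\<lambda>a1 a2. cop a2 (\<lambda>a21 a22. F (x * a1) (y * a21) (z * a22))))"
    by (simp only: asc_asci[OF t1] mult_1_right)
  finally show ?thesis .
qed

text \<open>
  The principle behind the uniqueness of the antipode: both contractions of a form with the
  coproduct being trivial, an element can be moved through the inverse reassociator.
\<close>

lemma asci_transfer:
  assumes F: "trilin F"
    and L: "\<And>a x y z. cop a (\<lambda>a1 a2. F (a1 * x) (a2 * y) z) = \<epsilon> a * F x y z"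
    and R: "\<And>a x y z. cop a (\<lambda>a1 a2. F x (y * a1) (z * a2)) = \<epsilon> a * F x y z"
  shows "asci (\<lambda>x y z. F x y (a * z)) = asci (\<lambda>x y z. F (x * a) y z)"
proof -
  note GD = trilinD[OF F]
  have f: "(\<lambda>a2. asci (\<lambda>x y z. F x y (a2 * z))) \<in> dual" "(\<lambda>a. asci (\<lambda>x y z. F (x * a) y z)) \<in> dual"
    by (simp add: lin_defs multilinear GD)+
  have "asci (\<lambda>x y z. F x y (a * z)) = cop a (\<lambda>a1 a2. \<epsilon> a1 * asci (\<lambda>x y z. F x y (a2 * z)))"
    by (rule cop_counit_left[OF f(1), symmetric])
  also have "\<dots> = cop a (\<lambda>a1 a2. asci (\<lambda>x y z. cop a1 (\<lambda>a11 a12. F (a11 * x) (a12 * y) (a2 * z))))"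
    by (simp only: L pull_in)
  also have "\<dots> = cop a (\<lambda>a1 a2. cop a1 (\<lambda>a11 a12. asci (\<lambda>x y z. F (a11 * x) (a12 * y) (a2 * z))))"
    by (rule ev_reorder)+
  also have "\<dots> = asci (\<lambda>x y z. cop a (\<lambda>a1 a2. cop a2 (\<lambda>a21 a22. F (x * a1) (y * a21) (z * a22))))"
    by (rule coassoc_inv[OF F])
  also have "\<dots> = asci (\<lambda>x y z. cop a (\<lambda>a1 a2. \<epsilon> a2 * F (x * a1) y z))"
    by (simp only: R)
  also have "\<dots> = cop a (\<lambda>a1 a2. \<epsilon> a2 * asci (\<lambda>x y z. F (x * a1) y z))"
    unfolding pull_in by (rule ev_reorder)+
  also have "\<dots> = asci (\<lambda>x y z. F (x * a) y z)"
    by (rule cop_counit_right[OF f(2)])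
  finally show ?thesis .
qed

section \<open>The elements q_R and p_R\<close>

lemma q_props: "q_R \<in> tensors2"
  "bilin F \<Longrightarrow> ev2 q_R F = asc (\<lambda>X Y Z. F X (S_inv (\<alpha> * Z) * Y))"
proof -
  have lin: "Vector_Spaces.linear (smult H) scale2 (\<lambda>x. x \<otimes> (S_inv (\<alpha> * z) * y))"
    "Vector_Spaces.linear (smult H) scale2 (\<lambda>y. x \<otimes> (S_inv (\<alpha> * z) * y))"
    "Vector_Spaces.linear (smult H) scale2 (\<lambda>z. x \<otimes> (S_inv (\<alpha> * z) * y))" for x y z
    by (simp_all add: linear_scale vs2 multilinear)
  show "q_R \<in> tensors2" unfolding q_R_def
    by (intro lift3_closed[OF reassoc_closed lin vs2] tensors2_closed)
  assume F: "bilin F"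
  show "ev2 q_R F = asc (\<lambda>X Y Z. F X (S_inv (\<alpha> * Z) * Y))" unfolding q_R_def
    by (subst lift3_ev[OF vs2 reassoc_closed lin, of "\<lambda>w. ev2 w F"])
      (simp_all add: ev2_tensor ev2_ten F lin_defs multilinear bilinD[OF F])
qed

lemma p_props: "p_R \<in> tensors2"
  "bilin F \<Longrightarrow> ev2 p_R F = asci (\<lambda>x y z. F x (y * \<beta> * S z))"
proof -
  have lin: "Vector_Spaces.linear (smult H) scale2 (\<lambda>x. x \<otimes> (y * \<beta> * S z))"
    "Vector_Spaces.linear (smult H) scale2 (\<lambda>y. x \<otimes> (y * \<beta> * S z))"
    "Vector_Spaces.linear (smult H) scale2 (\<lambda>z. x \<otimes> (y * \<beta> * S z))" for x y z
    by (simp_all add: linear_scale vs2 multilinear)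
  show "p_R \<in> tensors2" unfolding p_R_def
    by (intro lift3_closed[OF \<phi>_inv_closed lin vs2] tensors2_closed)
  assume F: "bilin F"
  show "ev2 p_R F = asci (\<lambda>x y z. F x (y * \<beta> * S z))" unfolding p_R_def
    by (subst lift3_ev[OF vs2 \<phi>_inv_closed lin, of "\<lambda>w. ev2 w F"])
      (simp_all add: ev2_tensor ev2_ten F lin_defs multilinear bilinD[OF F])
qed

text \<open>Since X \<otimes> S(Y) \<alpha> Z is (id \<otimes> S)(q_R), this is the covariance (1
  \<otimes> S^-1(a2)) q_R \<Delta>(a1) = (a \<otimes> 1) q_R with S applied to the second leg.
  Coassociativity brings S(a21) \<alpha> a22 together.\<close>

lemma qs_cov:
  assumes G: "bilin G"
  shows "cop a (\<lambda>a1 a2. cop a1 (\<lambda>a11 a12. asc (\<lambda>X Y Z. G (X * a11) (S (Y * a12) * \<alpha> * (Z * a2))))) =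
    asc (\<lambda>X Y Z. G (a * X) (S Y * \<alpha> * Z))"
proof -
  note GD = bilinD[OF G]
  have t: "trilin (\<lambda>u v w. G u (S v * \<alpha> * w))" by (simp add: lin_defs multilinear GD)
  have f: "(\<lambda>t. G (a1 * X) (S Y * t * Z)) \<in> dual" "(\<lambda>t. G (t * X) (S Y * \<alpha> * Z)) \<in> dual" for a1 X Y Z by (simp add: lin_defs multilinear GD)+
  have "cop a (\<lambda>a1 a2. cop a1 (\<lambda>a11 a12. asc (\<lambda>X Y Z. G (X * a11) (S (Y * a12) * \<alpha> * (Z * a2))))) =
    asc (\<lambda>X Y Z. cop a (\<lambda>a1 a2. cop a1 (\<lambda>a11 a12. G (X * a11) (S (Y * a12) * \<alpha> * (Z * a2)))))"
    by (rule ev_reorder)+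
  also have "\<dots> = cop a (\<lambda>a1 a2. cop a2 (\<lambda>a21 a22. asc (\<lambda>X Y Z. G (a1 * X) (S (a21 * Y) * \<alpha> * (a22 * Z)))))"
    by (rule coassoc[OF t, symmetric])
  also have "\<dots> = asc (\<lambda>X Y Z. cop a (\<lambda>a1 a2. cop a2 (\<lambda>a21 a22. G (a1 * X) (S Y * (S a21 * \<alpha> * a22) * Z))))"
    by ((unfold mult_simps)?, (rule ev_reorder)+)
  also have "\<dots> = asc (\<lambda>X Y Z. G (a * X) (S Y * \<alpha> * Z))"
    by (simp only: cop_alpha[OF f(1)] cop_counit_right[OF f(2)])
  finally show ?thesis .
qed

text \<open>Covariance of p_R, \<Delta>(a1) p_R (1 \<otimes> S(a2)) = p_R (a \<otimes> 1).
  Coassociativity brings a21 \<beta> S(a22) together.\<close>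

lemma p_cov:
  assumes G: "bilin G"
  shows "cop a (\<lambda>a1 a2. cop a1 (\<lambda>a11 a12. ev2 p_R (\<lambda>p1 p2. G (a11 * p1) (a12 * p2 * S a2)))) =
    ev2 p_R (\<lambda>p1 p2. G (p1 * a) p2)"
proof -
  note GD = bilinD[OF G]
  have t: "trilin (\<lambda>u v w. G u (v * \<beta> * S w))" by (simp add: lin_defs multilinear GD)
  have b: "bilin (\<lambda>p1 p2. G (a11 * p1) (a12 * p2 * S a2))" "bilin (\<lambda>p1 p2. G (p1 * a) p2)" for a11 a12 a2 by (simp add: lin_defs multilinear GD)+
  have f: "(\<lambda>t. G (X * a1) (Y * t * S Z)) \<in> dual" "(\<lambda>t. G (X * t) (Y * \<beta> * S Z)) \<in> dual" for a1 X Y Z by (simp add: lin_defs multilinear GD)+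
  have "cop a (\<lambda>a1 a2. cop a1 (\<lambda>a11 a12. ev2 p_R (\<lambda>p1 p2. G (a11 * p1) (a12 * p2 * S a2)))) =
    cop a (\<lambda>a1 a2. cop a1 (\<lambda>a11 a12. asci (\<lambda>x y z. G (a11 * x) (a12 * y * \<beta> * S (a2 * z)))))"
    by (simp only: p_props(2)[OF b(1)], simp only: mult_simps)
  also have "\<dots> = asci (\<lambda>x y z. cop a (\<lambda>a1 a2. cop a2 (\<lambda>a21 a22. G (x * a1) (y * a21 * \<beta> * S (z * a22)))))"
    by (rule coassoc_inv[OF t])
  also have "\<dots> = asci (\<lambda>x y z. cop a (\<lambda>a1 a2. cop a2 (\<lambda>a21 a22. G (x * a1) (y * (a21 * \<beta> * S a22) * S z))))"
    by ((unfold mult_simps)?, (rule ev_reorder)+)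
  also have "\<dots> = asci (\<lambda>x y z. G (x * a) (y * \<beta> * S z))"
    by (simp only: cop_beta[OF f(1)] cop_counit_right[OF f(2)])
  also have "\<dots> = ev2 p_R (\<lambda>p1 p2. G (p1 * a) p2)"
    by (simp only: p_props(2)[OF b(2)])
  finally show ?thesis .
qed

text \<open>In tensors, \<Delta>(q1) p_R (1 \<otimes> S(q2)) = 1 \<otimes> 1 for q_R = q1 \<otimes>
  q2. The two reassociators are completed to the left-hand side of \<open>pentagon_right\<close>; on
  the other side all coproducts collapse and X \<beta> S(Y) \<alpha> Z = 1 remains.\<close>

lemma q_p_cancel:
  assumes G: "bilin G"
  shows "asc (\<lambda>X Y Z. cop X (\<lambda>X1 X2. ev2 p_R (\<lambda>p1 p2. G (X1 * p1) (X2 * p2 * (S Y * \<alpha> * Z))))) = G 1 1"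
proof -
  note GD = bilinD[OF G]
  have q: "quadrilin (\<lambda>a b c d. G a (b * \<beta> * S c * \<alpha> * d))" by (simp add: lin_defs multilinear GD)
  have b: "bilin (\<lambda>p1 p2. G (X1 * p1) (X2 * p2 * (S Y * \<alpha> * Z)))" for X1 X2 Y Z by (simp add: lin_defs multilinear GD)
  have b2: "bilin (\<lambda>x' z'. asc (\<lambda>X Y Z. cop X (\<lambda>X1 X2. asci (\<lambda>x y z.
      G (X1 * x * x') (X2 * y * \<beta> * (S z * (S Y * (\<alpha> * (Z * z')))))))))" by (simp add: lin_defs multilinear GD)
  have f1: "(\<lambda>t. asc (\<lambda>X Y Z. cop X (\<lambda>X1 X2. asci (\<lambda>x y z.
      G (X1 * x * x') (X2 * y * t * (S z * (S Y * (\<alpha> * (Z * z'))))))))) \<in> dual" for x' z' by (simp add: lin_defs multilinear GD)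
  have f2: "(\<lambda>t. asc (\<lambda>X Y Z. G x (y * X * \<beta> * S Y * t * Z))) \<in> dual" for x y by (simp add: lin_defs multilinear GD)
  have b3: "bilin (\<lambda>x y. asc (\<lambda>X Y Z. G x (y * X * \<beta> * S Y * \<alpha> * Z)))" by (simp add: lin_defs multilinear GD)
  have f3: "(\<lambda>t. G 1 t) \<in> dual" by (simp add: lin_defs multilinear GD)
  have "asc (\<lambda>X Y Z. cop X (\<lambda>X1 X2. ev2 p_R (\<lambda>p1 p2. G (X1 * p1) (X2 * p2 * (S Y * \<alpha> * Z))))) =
    asc (\<lambda>X Y Z. cop X (\<lambda>X1 X2. asci (\<lambda>x y z. G (X1 * x * 1) (X2 * y * \<beta> * (S z * (S Y * (\<alpha> * (Z * 1))))))))"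
    by (simp only: p_props(2)[OF b], simp only: mult_simps mult_1_right)
  \<comment> \<open>A fresh \<phi>^-1 enters through its trivial counit; next \<epsilon>(y') \<beta>
    is spread to y1 \<beta> S(y2), the factor (id \<otimes> \<Delta> \<otimes> id)(\<phi>^-1) that
    \<open>pentagon_right\<close> still lacks.\<close>
  also have "\<dots> = asci (\<lambda>x' y' z'. \<epsilon> y' * asc (\<lambda>X Y Z. cop X (\<lambda>X1 X2. asci (\<lambda>x y z.
      G (X1 * x * x') (X2 * y * \<beta> * (S z * (S Y * (\<alpha> * (Z * z')))))))))"
    by (rule asci_counit2[OF b2, symmetric])
  also have "\<dots> = asci (\<lambda>x' y' z'. cop y' (\<lambda>y1 y2. asc (\<lambda>X Y Z. cop X (\<lambda>X1 X2. asci (\<lambda>x y z.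
      G (X1 * x * x') (X2 * y * (y1 * \<beta> * S y2) * (S z * (S Y * (\<alpha> * (Z * z'))))))))))"
    by (simp only: cop_beta[OF f1])
  also have "\<dots> = asc (\<lambda>X Y Z. cop X (\<lambda>X1 X2. asci (\<lambda>x' y' z'. cop y' (\<lambda>y1 y2. asci (\<lambda>x y z.
      G (X1 * x * x') (X2 * y * y1 * \<beta> * S (Y * z * y2) * \<alpha> * (Z * z')))))))"
    by ((unfold mult_simps)?, (rule ev_reorder)+)
  also have "\<dots> = asci (\<lambda>x y z. cop z (\<lambda>z1 z2. asc (\<lambda>X Y Z. G x (y * X * \<beta> * S (z1 * Y) * \<alpha> * (z2 * Z)))))"
    by (rule pentagon_right[OF q])
  also have "\<dots> = asci (\<lambda>x y z. cop z (\<lambda>z1 z2. asc (\<lambda>X Y Z. G x (y * X * \<beta> * S Y * (S z1 * \<alpha> * z2) * Z))))"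
    by ((unfold mult_simps)?, (rule ev_reorder)+)
  also have "\<dots> = asc (\<lambda>X Y Z. G 1 (X * \<beta> * S Y * \<alpha> * Z))"
    by (simp only: cop_alpha[OF f2] asci_counit3[OF b3] mult_1_left)
  also have "\<dots> = G 1 1" by (rule asc_antipode[OF f3])
  finally show ?thesis .
qed

text \<open>The companion relation (1 \<otimes> S^-1(p2)) q_R \<Delta>(p1) = 1 \<otimes> 1 for p_R =
  p1 \<otimes> p2, with S applied to the second leg. It follows from \<open>pentagon_left\<close> in
  the same manner.\<close>

lemma p_q_cancel:
  assumes G: "bilin G"
  shows "ev2 p_R (\<lambda>p1 p2. cop p1 (\<lambda>p11 p12. asc (\<lambda>X Y Z. G (X * p11) (S (Y * p12) * \<alpha> * Z * p2)))) = G 1 1"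
proof -
  note GD = bilinD[OF G]
  have q: "quadrilin (\<lambda>a b c d. G a (S b * \<alpha> * c * \<beta> * S d))" by (simp add: lin_defs multilinear GD)
  have b: "bilin (\<lambda>p1 p2. cop p1 (\<lambda>p11 p12. asc (\<lambda>X Y Z. G (X * p11) (S (Y * p12) * \<alpha> * Z * p2))))" by (simp add: lin_defs multilinear GD)
  have f1: "(\<lambda>t. asc (\<lambda>X' Y' Z'. asci (\<lambda>x y z. cop x (\<lambda>x1 x2.
      G (X * X' * x1) (S (Y' * x2) * t * Z' * y * \<beta> * S (Z * z)))))) \<in> dual" for X Z by (simp add: lin_defs multilinear GD)
  have b1: "bilin (\<lambda>X Z. asc (\<lambda>X' Y' Z'. asci (\<lambda>x y z. cop x (\<lambda>x1 x2.
      G (X * X' * x1) (S (Y' * x2) * \<alpha> * Z' * y * \<beta> * S (Z * z))))))" by (simp add: lin_defs multilinear GD)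
  have f2: "(\<lambda>t. G X (S (x * Y) * \<alpha> * y * t * S z)) \<in> dual" for X x Y y z by (simp add: lin_defs multilinear GD)
  have b2: "bilin (\<lambda>X Y. G X (S (x * Y) * \<alpha> * y * \<beta> * S z))" for x y z by (simp add: lin_defs multilinear GD)
  have f3: "(\<lambda>t. G 1 t) \<in> dual" by (simp add: lin_defs multilinear GD)
  have "ev2 p_R (\<lambda>p1 p2. cop p1 (\<lambda>p11 p12. asc (\<lambda>X Y Z. G (X * p11) (S (Y * p12) * \<alpha> * Z * p2)))) =
    asc (\<lambda>X' Y' Z'. asci (\<lambda>x y z. cop x (\<lambda>x1 x2. G (1 * X' * x1) (S (Y' * x2) * \<alpha> * Z' * y * \<beta> * S (1 * z)))))"
    by (simp only: p_props(2)[OF b] mult_1_left) ((unfold mult_simps)?, (rule ev_reorder)+)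
  \<comment> \<open>A fresh \<phi> enters through its counit, and \<epsilon>(Y) \<alpha> becomes
    S(Y1) \<alpha> Y2, as \<open>pentagon_left\<close> demands.\<close>
  also have "\<dots> = asc (\<lambda>X Y Z. \<epsilon> Y * asc (\<lambda>X' Y' Z'. asci (\<lambda>x y z. cop x (\<lambda>x1 x2.
      G (X * X' * x1) (S (Y' * x2) * \<alpha> * Z' * y * \<beta> * S (Z * z))))))"
    by (rule asc_counit2[OF b1, symmetric])
  also have "\<dots> = asc (\<lambda>X Y Z. cop Y (\<lambda>Y1 Y2. asc (\<lambda>X' Y' Z'. asci (\<lambda>x y z. cop x (\<lambda>x1 x2.
      G (X * X' * x1) (S (Y' * x2) * (S Y1 * \<alpha> * Y2) * Z' * y * \<beta> * S (Z * z)))))))"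
    by (simp only: cop_alpha[OF f1])
  also have "\<dots> = asc (\<lambda>X Y Z. cop Y (\<lambda>Y1 Y2. asc (\<lambda>X' Y' Z'. asci (\<lambda>x y z. cop x (\<lambda>x1 x2.
      G (X * X' * x1) (S (Y1 * Y' * x2) * \<alpha> * (Y2 * Z' * y) * \<beta> * S (Z * z)))))))"
    by ((unfold mult_simps)?, (rule ev_reorder)+)
  also have "\<dots> = asci (\<lambda>x y z. asc (\<lambda>X Y Z. cop Z (\<lambda>Z1 Z2.
      G X (S (x * Y) * \<alpha> * (y * Z1) * \<beta> * S (z * Z2)))))"
    by (rule pentagon_left[OF q, symmetric])
  also have "\<dots> = asci (\<lambda>x y z. asc (\<lambda>X Y Z. cop Z (\<lambda>Z1 Z2.
      G X (S (x * Y) * \<alpha> * y * (Z1 * \<beta> * S Z2) * S z))))"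
    by ((unfold mult_simps)?, (rule ev_reorder)+)
  also have "\<dots> = asci (\<lambda>x y z. G 1 (S x * \<alpha> * y * \<beta> * S z))"
    by (simp only: cop_beta[OF f2] asc_counit3[OF b2] mult_1_right)
  also have "\<dots> = G 1 1" by (rule asci_antipode[OF f3])
  finally show ?thesis .
qed

section \<open>The element \<gamma>\<close>

lemma gamma_props: "gamma \<in> tensors2"
  "bilin F \<Longrightarrow> ev2 gamma F = asci (\<lambda>x y z. asc (\<lambda>X Y Z. cop Z (\<lambda>Z1 Z2.
    F (S (x * Y) * \<alpha> * (y * Z1)) (S X * \<alpha> * (z * Z2)))))"
proof -
  let ?T = "one_ten3 \<phi>_inv \<bullet>\<^sub>4 id_id_comult \<phi>"
  have T: "?T \<in> tensors4"
    by (intro mult4_closed one_ten3_closed id_id_comult_closed reassoc_closed \<phi>_inv_closed)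
  have lin: "Vector_Spaces.linear (smult H) scale2 (\<lambda>t. (S u * \<alpha> * v) \<otimes> (S t * \<alpha> * w))"
    "Vector_Spaces.linear (smult H) scale2 (\<lambda>u. (S u * \<alpha> * v) \<otimes> (S t * \<alpha> * w))"
    "Vector_Spaces.linear (smult H) scale2 (\<lambda>v. (S u * \<alpha> * v) \<otimes> (S t * \<alpha> * w))"
    "Vector_Spaces.linear (smult H) scale2 (\<lambda>w. (S u * \<alpha> * v) \<otimes> (S t * \<alpha> * w))" for t u v w
    by (simp_all add: linear_scale vs2 multilinear)
  show "gamma \<in> tensors2" unfolding gamma_def
    by (intro lift4_closed[OF T lin vs2] tensors2_closed)
  assume F: "bilin F"
  note GD = bilinD[OF F]
  have q: "quadrilin (\<lambda>t u v w. F (S u * \<alpha> * v) (S t * \<alpha> * w))" by (simp add: lin_defs multilinear GD)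
  have q1: "quadrilin (\<lambda>t u v w. F (S (x * u) * \<alpha> * (y * v)) (S (x' * t) * \<alpha> * (z * w)))" for x y z x' by (simp add: lin_defs multilinear GD)
  have q2: "quadrilin (\<lambda>t' u' v' w'. asc (\<lambda>X Y Z. cop Z (\<lambda>Z1 Z2. F (S (u' * Y) * \<alpha> * (v' * Z1)) (S (t' * X) * \<alpha> * (w' * Z2)))))" by (simp add: lin_defs multilinear GD)
  have "ev2 gamma F = ev4 ?T (\<lambda>t u v w. F (S u * \<alpha> * v) (S t * \<alpha> * w))" unfolding gamma_def
    by (subst lift4_ev[OF vs2 T lin, of "\<lambda>w. ev2 w F"])
      (simp_all add: ev2_tensor ev2_ten F lin_defs multilinear GD)
  also have "\<dots> = asci (\<lambda>x y z. asc (\<lambda>X Y Z. cop Z (\<lambda>Z1 Z2.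
      F (S (x * Y) * \<alpha> * (y * Z1)) (S X * \<alpha> * (z * Z2)))))"
    by (simp only: ev4_mult[OF one_ten3_closed[OF \<phi>_inv_closed] id_id_comult_closed[OF reassoc_closed] q]
      ev4_id_id_comult[OF reassoc_closed q1] ev4_one_ten3[OF \<phi>_inv_closed q2] mult_1_left)
  finally show "ev2 gamma F = asci (\<lambda>x y z. asc (\<lambda>X Y Z. cop Z (\<lambda>Z1 Z2.
    F (S (x * Y) * \<alpha> * (y * Z1)) (S X * \<alpha> * (z * Z2)))))" .
qed

text \<open>\<open>pentagon_left\<close> rewrites the defining tensor of \<gamma>; in the result the
  factor (id \<otimes> \<Delta> \<otimes> id)(\<phi>) contracts to \<alpha>. This form is easier to
  use: it contains one \<phi>, one \<phi>^-1 and a single coproduct.\<close>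

lemma gamma_alt:
  assumes F: "bilin F"
  shows "ev2 gamma F = asc (\<lambda>X Y Z. asci (\<lambda>x y z. cop x (\<lambda>x1 x2.
    F (S (Y * x2) * \<alpha> * (Z * y)) (S (X * x1) * \<alpha> * z))))"
proof -
  note GD = bilinD[OF F]
  have q: "quadrilin (\<lambda>t u v w. F (S u * \<alpha> * v) (S t * \<alpha> * w))" by (simp add: lin_defs multilinear GD)
  have f: "(\<lambda>t. asc (\<lambda>X' Y' Z'. asci (\<lambda>x y z. cop x (\<lambda>x1 x2.
      F (S (Y' * x2) * t * (Z' * y)) (S (X * X' * x1) * \<alpha> * (Z * z)))))) \<in> dual" for X Z by (simp add: lin_defs multilinear GD)
  have b: "bilin (\<lambda>X Z. asc (\<lambda>X' Y' Z'. asci (\<lambda>x y z. cop x (\<lambda>x1 x2.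
      F (S (Y' * x2) * \<alpha> * (Z' * y)) (S (X * X' * x1) * \<alpha> * (Z * z))))))" by (simp add: lin_defs multilinear GD)
  have "ev2 gamma F = asc (\<lambda>X Y Z. cop Y (\<lambda>Y1 Y2. asc (\<lambda>X' Y' Z'. asci (\<lambda>x y z. cop x (\<lambda>x1 x2.
      F (S (Y1 * Y' * x2) * \<alpha> * (Y2 * Z' * y)) (S (X * X' * x1) * \<alpha> * (Z * z)))))))"
    unfolding gamma_props(2)[OF F] by (rule pentagon_left[OF q])
  also have "\<dots> = asc (\<lambda>X Y Z. cop Y (\<lambda>Y1 Y2. asc (\<lambda>X' Y' Z'. asci (\<lambda>x y z. cop x (\<lambda>x1 x2.
      F (S (Y' * x2) * (S Y1 * \<alpha> * Y2) * (Z' * y)) (S (X * X' * x1) * \<alpha> * (Z * z)))))))"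
    by ((unfold mult_simps)?, (rule ev_reorder)+)
  also have "\<dots> = asc (\<lambda>X' Y' Z'. asci (\<lambda>x y z. cop x (\<lambda>x1 x2.
      F (S (Y' * x2) * \<alpha> * (Z' * y)) (S (1 * X' * x1) * \<alpha> * (1 * z)))))"
    by (simp only: cop_alpha[OF f] asc_counit2[OF b])
  finally show ?thesis by simp
qed

text \<open>The counterpart for \<gamma> of S(a1) \<alpha> a2 = \<epsilon>(a) \<alpha>, to be
  expected since \<gamma> will turn out to be f \<Delta>(\<alpha>). In the form
  \<open>gamma_alt\<close>, coassociativity is applied first at \<phi>^-1 and then at \<phi>; the
  coproducts then contract around the two copies of \<alpha>.\<close>

lemma gamma_cov:
  assumes F: "bilin F"
  shows "cop a (\<lambda>a1 a2. cop a1 (\<lambda>a11 a12. ev2 gamma (\<lambda>g1 g2. cop a2 (\<lambda>a21 a22.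
    F (S a12 * g1 * a21) (S a11 * g2 * a22))))) = \<epsilon> a * ev2 gamma F"
proof -
  note GD = bilinD[OF F]
  have b: "bilin (\<lambda>g1 g2. cop a2 (\<lambda>a21 a22. F (S a12 * g1 * a21) (S a11 * g2 * a22)))" for a2 a12 a11 by (simp add: lin_defs multilinear GD)
  let ?F1 = "\<lambda>X Y Z u v w. cop u (\<lambda>u1 u2. F (S (Y * u2) * \<alpha> * (Z * v)) (S (X * u1) * \<alpha> * w))"
  have t1: "trilin (?F1 X Y Z)" for X Y Z by (simp add: lin_defs multilinear GD)
  have cm: "cop (x * y) (\<lambda>u1 u2. F (S (Y * u2) * \<alpha> * (Z * v)) (S (X * u1) * \<alpha> * w)) =
    cop x (\<lambda>x1 x2. cop y (\<lambda>y1 y2. F (S (Y * (x2 * y2)) * \<alpha> * (Z * v)) (S (X * (x1 * y1)) * \<alpha> * w)))"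
    for x y X Y Z v w
    by (rule cop_mult) (simp add: lin_defs multilinear GD)
  have t2: "trilin (\<lambda>u v w. F (S (v * x2) * \<alpha> * (w * y)) (S (u * x1) * \<alpha> * (a2 * z)))" for x1 x2 y z a2 by (simp add: lin_defs multilinear GD)
  have f1: "(\<lambda>t. asc (\<lambda>X Y Z. asci (\<lambda>x y z. cop x (\<lambda>x1 x2.
      F (S x2 * S Y * t * Z * y) (S (X * x1) * S a11 * \<alpha> * (a2 * z)))))) \<in> dual" for a2 a11 by (simp add: lin_defs multilinear GD)
  have f2: "(\<lambda>a11. asc (\<lambda>X Y Z. asci (\<lambda>x y z. cop x (\<lambda>x1 x2.
      F (S x2 * S Y * \<alpha> * Z * y) (S (X * x1) * S a11 * \<alpha> * (a2 * z)))))) \<in> dual" for a2 by (simp add: lin_defs multilinear GD)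
  have f3: "(\<lambda>t. asc (\<lambda>X Y Z. asci (\<lambda>x y z. cop x (\<lambda>x1 x2.
      F (S x2 * S Y * \<alpha> * Z * y) (S (X * x1) * t * z))))) \<in> dual" by (simp add: lin_defs multilinear GD)
  have "cop a (\<lambda>a1 a2. cop a1 (\<lambda>a11 a12. ev2 gamma (\<lambda>g1 g2. cop a2 (\<lambda>a21 a22.
      F (S a12 * g1 * a21) (S a11 * g2 * a22))))) =
    cop a (\<lambda>a1 a2. cop a1 (\<lambda>a11 a12. asc (\<lambda>X Y Z. asci (\<lambda>x y z. cop x (\<lambda>x1 x2. cop a2 (\<lambda>a21 a22.
      F (S a12 * (S (Y * x2) * \<alpha> * (Z * y)) * a21) (S a11 * (S (X * x1) * \<alpha> * z) * a22)))))))"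
    by (simp only: gamma_alt[OF b])
  also have "\<dots> = asc (\<lambda>X Y Z. asci (\<lambda>x y z. cop a (\<lambda>a1 a2. cop a2 (\<lambda>a21 a22. ?F1 X Y Z (x * a1) (y * a21) (z * a22)))))"
    unfolding cm by ((unfold mult_simps)?, (rule ev_reorder)+)
  also have "\<dots> = asc (\<lambda>X Y Z. cop a (\<lambda>a1 a2. cop a1 (\<lambda>a11 a12. asci (\<lambda>x y z. ?F1 X Y Z (a11 * x) (a12 * y) (a2 * z)))))"
    by (simp only: coassoc_inv[OF t1])
  also have "\<dots> = cop a (\<lambda>a1 a2. asci (\<lambda>x y z. cop x (\<lambda>x1 x2. asc (\<lambda>X Y Z. cop a1 (\<lambda>a11 a12. cop a11 (\<lambda>a111 a112.
      F (S (Y * a112 * x2) * \<alpha> * (Z * a12 * y)) (S (X * a111 * x1) * \<alpha> * (a2 * z))))))))"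
    unfolding cm by ((unfold mult_simps)?, (rule ev_reorder)+)
  also have "\<dots> = cop a (\<lambda>a1 a2. asci (\<lambda>x y z. cop x (\<lambda>x1 x2. cop a1 (\<lambda>a11 a12. cop a12 (\<lambda>a121 a122. asc (\<lambda>X Y Z.
      F (S (a121 * Y * x2) * \<alpha> * (a122 * Z * y)) (S (a11 * X * x1) * \<alpha> * (a2 * z))))))))"
    by (simp only: coassoc[OF t2])
  also have "\<dots> = cop a (\<lambda>a1 a2. cop a1 (\<lambda>a11 a12. cop a12 (\<lambda>a121 a122. asc (\<lambda>X Y Z. asci (\<lambda>x y z. cop x (\<lambda>x1 x2.
      F (S x2 * S Y * (S a121 * \<alpha> * a122) * Z * y) (S (X * x1) * S a11 * \<alpha> * (a2 * z))))))))"
    by ((unfold mult_simps)?, (rule ev_reorder)+)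
  also have "\<dots> = cop a (\<lambda>a1 a2. asc (\<lambda>X Y Z. asci (\<lambda>x y z. cop x (\<lambda>x1 x2.
      F (S x2 * S Y * \<alpha> * Z * y) (S (X * x1) * S a1 * \<alpha> * (a2 * z))))))"
    by (simp only: cop_alpha[OF f1] cop_counit_right[OF f2])
  also have "\<dots> = cop a (\<lambda>a1 a2. asc (\<lambda>X Y Z. asci (\<lambda>x y z. cop x (\<lambda>x1 x2.
      F (S x2 * S Y * \<alpha> * Z * y) (S (X * x1) * (S a1 * \<alpha> * a2) * z)))))"
    by ((unfold mult_simps)?, (rule ev_reorder)+)
  also have "\<dots> = \<epsilon> a * asc (\<lambda>X Y Z. asci (\<lambda>x y z. cop x (\<lambda>x1 x2.
      F (S x2 * S Y * \<alpha> * Z * y) (S (X * x1) * \<alpha> * z))))"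
    by (rule cop_alpha[OF f3])
  also have "\<dots> = \<epsilon> a * ev2 gamma F"
    by (simp add: gamma_alt[OF F] mult_simps)
  finally show ?thesis .
qed

section \<open>The Drinfeld element\<close>

text \<open>
  \<open>gamma_form G x y\<close> evaluates \<open>G\<close> on \<open>(S \<otimes> S)(\<Delta>\<^sup>o\<^sup>p(x)) \<gamma> \<Delta>(y)\<close>, so that \<open>f\<close> is the contraction of
  the inverse reassociator with \<open>gamma_form\<close>.
\<close>

definition gamma_form :: "('h \<Rightarrow> 'h \<Rightarrow> 'k) \<Rightarrow> 'h \<Rightarrow> 'h \<Rightarrow> 'k" where
  "gamma_form G x y = cop x (\<lambda>x1 x2. ev2 gamma (\<lambda>g1 g2. cop y (\<lambda>y1 y2.
    G (S x2 * g1 * y1) (S x1 * g2 * y2))))"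

lemma gamma_form_bilin:
  assumes G: "bilin G"
  shows "bilin (gamma_form G)"
  unfolding gamma_form_def by (simp add: lin_defs multilinear bilinD[OF G])

lemma gamma_form_form [multilinear]:
  "gamma_form (\<lambda>u v. F u v + G u v) x y = gamma_form F x y + gamma_form G x y"
  "gamma_form (\<lambda>u v. c * F u v) x y = c * gamma_form F x y"
  by (simp_all add: gamma_form_def multilinear)

lemma gamma_form_one: "bilin G \<Longrightarrow> gamma_form G 1 1 = ev2 gamma G"
proof -
  assume G: "bilin G"
  note GD = bilinD[OF G]
  have b: "bilin (\<lambda>x1 x2. ev2 gamma (\<lambda>g1 g2. cop 1 (\<lambda>y1 y2. G (S x2 * g1 * y1) (S x1 * g2 * y2))))"
    "bilin (\<lambda>y1 y2. G (S 1 * g1 * y1) (S 1 * g2 * y2))" for g1 g2 by (simp add: lin_defs multilinear GD)+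
  show ?thesis unfolding gamma_form_def cop_one[OF b(1)] unfolding cop_one[OF b(2)]
    by (simp only: antipode_one mult_1_left mult_1_right)
qed

lemma gamma_form_mult_right:
  assumes G: "bilin G"
  shows "gamma_form (\<lambda>u v. cop c (\<lambda>c1 c2. G (u * c1) (v * c2))) x y = gamma_form G x (y * c)"
proof -
  note GD = bilinD[OF G]
  have b: "bilin (\<lambda>y1 y2. G (S x2 * g1 * y1) (S x1 * g2 * y2))" for x1 x2 g1 g2 by (simp add: lin_defs multilinear GD)
  show ?thesis unfolding gamma_form_def unfolding cop_mult[OF b] by (simp only: mult.assoc)
qed

lemma gamma_form_mult_left:
  assumes G: "bilin G"
  shows "gamma_form (\<lambda>u v. cop c (\<lambda>c1 c2. G (S c2 * u) (S c1 * v))) x y = gamma_form G (x * c) y"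
proof -
  note GD = bilinD[OF G]
  have b: "bilin (\<lambda>x1 x2. ev2 gamma (\<lambda>g1 g2. cop y (\<lambda>y1 y2. G (S x2 * g1 * y1) (S x1 * g2 * y2))))" by (simp add: lin_defs multilinear GD)
  show ?thesis unfolding gamma_form_def unfolding cop_mult[OF b] by ((unfold mult_simps)?, (rule ev_reorder)+)
qed

lemma gamma_form_cov:
  assumes G: "bilin G"
  shows "cop a (\<lambda>a1 a2. gamma_form G (a1 * x) (a2 * y)) = \<epsilon> a * gamma_form G x y"
proof -
  note GD = bilinD[OF G]
  have b: "bilin (\<lambda>x1 x2. ev2 gamma (\<lambda>g1 g2. cop y (\<lambda>y1 y2. G (S x2 * g1 * y1) (S x1 * g2 * y2))))"
    "bilin (\<lambda>y1 y2. G (S x2 * g1 * y1) (S x1 * g2 * y2))" for y x1 x2 g1 g2 by (simp add: lin_defs multilinear GD)+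
  have b3: "bilin (\<lambda>u v. cop x (\<lambda>x1 x2. cop y (\<lambda>y1 y2. G (S x2 * u * y1) (S x1 * v * y2))))" by (simp add: lin_defs multilinear GD)
  have "cop a (\<lambda>a1 a2. gamma_form G (a1 * x) (a2 * y)) = cop a (\<lambda>a1 a2. cop a1 (\<lambda>a11 a12. ev2 gamma (\<lambda>g1 g2.
    cop a2 (\<lambda>a21 a22. cop x (\<lambda>x1 x2. cop y (\<lambda>y1 y2.
      G (S x2 * (S a12 * g1 * a21) * y1) (S x1 * (S a11 * g2 * a22) * y2)))))))"
    unfolding gamma_form_def unfolding cop_mult[OF b(1)] unfolding cop_mult[OF b(2)] by ((unfold mult_simps)?, (rule ev_reorder)+)
  also have "\<dots> = \<epsilon> a * ev2 gamma (\<lambda>u v. cop x (\<lambda>x1 x2. cop y (\<lambda>y1 y2. G (S x2 * u * y1) (S x1 * v * y2))))"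
    by (rule gamma_cov[OF b3])
  also have "ev2 gamma (\<lambda>u v. cop x (\<lambda>x1 x2. cop y (\<lambda>y1 y2. G (S x2 * u * y1) (S x1 * v * y2)))) = gamma_form G x y"
    unfolding gamma_form_def by (rule ev_reorder)+
  finally show ?thesis .
qed

lemma f_props: "drinfeld_f \<in> tensors2"
  "bilin G \<Longrightarrow> ev2 drinfeld_f G = asci (\<lambda>x y z. gamma_form G x (y * \<beta> * S z))"
proof -
  let ?J = "\<lambda>x w. map2 S S (flip (\<Delta> x)) \<bullet> gamma \<bullet> \<Delta> w"
  have m: "map2 S S (flip (\<Delta> x)) \<in> tensors2" for x
    by (intro map2_closed flip_closed comult_closed S_linear)
  have cl: "?J x w \<in> tensors2" for x w
    by (intro mult2_closed m gamma_props(1) comult_closed)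
  have ev: "ev2 (?J x w) G = gamma_form G x w" if G: "bilin G" for G x w
  proof -
    note GD = bilinD[OF G]
    have b: "bilin (\<lambda>a b. cop w (\<lambda>c d. G (a * c) (b * d)))"
      "bilin (\<lambda>a b. ev2 gamma (\<lambda>c d. cop w (\<lambda>c' d'. G (a * c * c') (b * d * d'))))"
      "bilin (\<lambda>a b. ev2 gamma (\<lambda>c d. cop w (\<lambda>c' d'. G (S a * c * c') (S b * d * d'))))"
      by (simp add: lin_defs multilinear GD)+
    show ?thesis
      by (simp only: ev2_mult[OF mult2_closed[OF m gamma_props(1)] comult_closed G] ev2_mult[OF m gamma_props(1) b(1)]
        ev2_map2[OF flip_closed[OF comult_closed] S_linear S_linear b(2)] ev2_flip[OF comult_closed b(3)] gamma_form_def)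
  qed
  note KD = bilinD[OF gamma_form_bilin]
  \<comment> \<open>Linearity of the summand is read off from its evaluations, which are values of
    the bilinear \<open>gamma_form\<close>.\<close>
  have J: "?J (x + x') w = ?J x w + ?J x' w" "?J (smult H c x) w = scale2 c (?J x w)"
    "?J x (w + w') = ?J x w + ?J x w'" "?J x (smult H c w) = scale2 c (?J x w)" for x x' w w' c
    by (rule tensors2_eqI; simp add: cl tensors2_closed tensors2_scale ev ev2_tensor KD del: plus_fun_apply)+
  have lin: "Vector_Spaces.linear (smult H) scale2 (\<lambda>x. ?J x (y * \<beta> * S z))"
    "Vector_Spaces.linear (smult H) scale2 (\<lambda>y. ?J x (y * \<beta> * S z))"
    "Vector_Spaces.linear (smult H) scale2 (\<lambda>z. ?J x (y * \<beta> * S z))" for x y z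
    by (simp_all add: linear_scale vs2 multilinear J del: plus_fun_apply)
  show "drinfeld_f \<in> tensors2" unfolding drinfeld_f_def
    by (intro lift3_closed[OF \<phi>_inv_closed lin vs2] cl tensors2_closed)
  assume G: "bilin G"
  show "ev2 drinfeld_f G = asci (\<lambda>x y z. gamma_form G x (y * \<beta> * S z))" unfolding drinfeld_f_def
    by (subst lift3_ev[OF vs2 \<phi>_inv_closed lin, of "\<lambda>w. ev2 w G"])
      (simp_all add: ev[OF G] ev2_tensor lin_defs multilinear bilinD[OF gamma_form_bilin[OF G]])
qed

text \<open>In tensors, f \<Delta>(S(a)) = (S \<otimes> S)(\<Delta>^op(a)) f. Both factors move into
  \<open>gamma_form\<close>, and \<open>asci_transfer\<close> carries \<open>a\<close> from the
  third leg of \<phi>^-1 to the first: one contraction it asks for is the covariance of \<gamma>,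
  the other the axiom for \<beta>.\<close>

lemma f_antipode:
  assumes G: "bilin G"
  shows "cop (S a) (\<lambda>s1 s2. ev2 drinfeld_f (\<lambda>f1 f2. G (f1 * s1) (f2 * s2))) =
    cop a (\<lambda>a1 a2. ev2 drinfeld_f (\<lambda>f1 f2. G (S a2 * f1) (S a1 * f2)))"
proof -
  note GD = bilinD[OF G]
  note KD = bilinD[OF gamma_form_bilin[OF G]]
  have b: "bilin (\<lambda>f1 f2. cop (S a) (\<lambda>s1 s2. G (f1 * s1) (f2 * s2)))"
    "bilin (\<lambda>f1 f2. cop a (\<lambda>a1 a2. G (S a2 * f1) (S a1 * f2)))" by (simp add: lin_defs multilinear GD)+
  have t: "trilin (\<lambda>x y z. gamma_form G x (y * \<beta> * S z))"
    by (simp add: lin_defs multilinear KD)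
  have f: "(\<lambda>t. gamma_form G x (y * t * S z)) \<in> dual" for x y z
    by (simp add: lin_defs multilinear KD)
  have "cop (S a) (\<lambda>s1 s2. ev2 drinfeld_f (\<lambda>f1 f2. G (f1 * s1) (f2 * s2))) =
    ev2 drinfeld_f (\<lambda>f1 f2. cop (S a) (\<lambda>s1 s2. G (f1 * s1) (f2 * s2)))"
    by (rule ev_reorder)+
  also have "\<dots> = asci (\<lambda>x y z. gamma_form G x (y * \<beta> * S (a * z)))"
    by (simp only: f_props(2)[OF b(1)] gamma_form_mult_right[OF G] mult_simps)
  also have "\<dots> = asci (\<lambda>x y z. gamma_form G (x * a) (y * \<beta> * S z))"
  proof (rule asci_transfer[OF t])
    show "cop a (\<lambda>a1 a2. gamma_form G (a1 * x) (a2 * y * \<beta> * S z)) = \<epsilon> a * gamma_form G x (y * \<beta> * S z)" for a x y z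
      using gamma_form_cov[OF G, of a x "y * \<beta> * S z"] by (simp only: mult.assoc)
    show "cop a (\<lambda>a1 a2. gamma_form G x (y * a1 * \<beta> * S (z * a2))) = \<epsilon> a * gamma_form G x (y * \<beta> * S z)" for a x y z
      using cop_beta[OF f, of a x y z] by (simp only: mult_simps)
  qed
  also have "\<dots> = ev2 drinfeld_f (\<lambda>f1 f2. cop a (\<lambda>a1 a2. G (S a2 * f1) (S a1 * f2)))"
    by (simp only: f_props(2)[OF b(2)] gamma_form_mult_left[OF G])
  also have "\<dots> = cop a (\<lambda>a1 a2. ev2 drinfeld_f (\<lambda>f1 f2. G (S a2 * f1) (S a1 * f2)))"
    by (rule ev_reorder)+
  finally show ?thesis .
qed

text \<open>In tensors, f \<Delta>(\<alpha>) = \<gamma>. The scheme is that of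
  \<open>q_p_cancel\<close> with \<open>gamma_form\<close> as the form, but \<phi> must be inserted
  too: it enters through \<epsilon>(X), which the covariance of \<open>gamma_form\<close> spreads to
  \<Delta>(X).\<close>

lemma f_alpha:
  assumes G: "bilin G"
  shows "cop \<alpha> (\<lambda>s1 s2. ev2 drinfeld_f (\<lambda>f1 f2. G (f1 * s1) (f2 * s2))) = ev2 gamma G"
proof -
  note GD = bilinD[OF G]
  note KD = bilinD[OF gamma_form_bilin[OF G]]
  have b: "bilin (\<lambda>f1 f2. cop \<alpha> (\<lambda>s1 s2. G (f1 * s1) (f2 * s2)))" by (simp add: lin_defs multilinear GD)
  have q: "quadrilin (\<lambda>a b c d. gamma_form G a (b * \<beta> * S c * \<alpha> * d))"
    by (simp add: lin_defs multilinear KD)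
  have b1: "bilin (\<lambda>Y Z. asci (\<lambda>x y z. gamma_form G x (y * \<beta> * S (Y * z) * \<alpha> * Z)))"
    by (simp add: lin_defs multilinear KD)
  have b2: "bilin (\<lambda>x' z'. asc (\<lambda>X Y Z. cop X (\<lambda>X1 X2. asci (\<lambda>x y z.
      gamma_form G (X1 * x * x') (X2 * (y * \<beta> * S (Y * z) * \<alpha> * (Z * z')))))))"
    by (simp add: lin_defs multilinear KD)
  have f1: "(\<lambda>t. asc (\<lambda>X Y Z. cop X (\<lambda>X1 X2. asci (\<lambda>x y z.
      gamma_form G (X1 * x * x') (X2 * (y * t * S (Y * z) * \<alpha> * (Z * z'))))))) \<in> dual" for x' z'
    by (simp add: lin_defs multilinear KD)
  have f2: "(\<lambda>t. asc (\<lambda>X Y Z. gamma_form G x (y * X * \<beta> * S Y * t * Z))) \<in> dual" for x y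
    by (simp add: lin_defs multilinear KD)
  have b3: "bilin (\<lambda>x y. asc (\<lambda>X Y Z. gamma_form G x (y * X * \<beta> * S Y * \<alpha> * Z)))"
    by (simp add: lin_defs multilinear KD)
  have f3: "(\<lambda>t. gamma_form G 1 t) \<in> dual" by (simp add: lin_defs multilinear KD)
  have "cop \<alpha> (\<lambda>s1 s2. ev2 drinfeld_f (\<lambda>f1 f2. G (f1 * s1) (f2 * s2))) =
    ev2 drinfeld_f (\<lambda>f1 f2. cop \<alpha> (\<lambda>s1 s2. G (f1 * s1) (f2 * s2)))" by (rule ev_reorder)+
  also have "\<dots> = asci (\<lambda>x y z. gamma_form G x (y * \<beta> * S (1 * z) * \<alpha> * 1))"
    by (simp only: f_props(2)[OF b] gamma_form_mult_right[OF G] mult_1_left mult_1_right)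
  also have "\<dots> = asc (\<lambda>X Y Z. \<epsilon> X * asci (\<lambda>x y z. gamma_form G x (y * \<beta> * S (Y * z) * \<alpha> * Z)))"
    by (rule asc_counit1[OF b1, symmetric])
  also have "\<dots> = asc (\<lambda>X Y Z. asci (\<lambda>x y z. \<epsilon> X * gamma_form G x (y * \<beta> * S (Y * z) * \<alpha> * Z)))"
    by (simp only: pull_in)
  also have "\<dots> = asc (\<lambda>X Y Z. asci (\<lambda>x y z. cop X (\<lambda>X1 X2.
      gamma_form G (X1 * x) (X2 * (y * \<beta> * S (Y * z) * \<alpha> * Z)))))"
    by (simp only: gamma_form_cov[OF G])
  also have "\<dots> = asc (\<lambda>X Y Z. cop X (\<lambda>X1 X2. asci (\<lambda>x y z.
      gamma_form G (X1 * x * 1) (X2 * (y * \<beta> * S (Y * z) * \<alpha> * (Z * 1))))))"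
    unfolding mult_1_right by (rule ev_reorder)+
  also have "\<dots> = asci (\<lambda>x' y' z'. \<epsilon> y' * asc (\<lambda>X Y Z. cop X (\<lambda>X1 X2. asci (\<lambda>x y z.
      gamma_form G (X1 * x * x') (X2 * (y * \<beta> * S (Y * z) * \<alpha> * (Z * z')))))))"
    by (rule asci_counit2[OF b2, symmetric])
  also have "\<dots> = asci (\<lambda>x' y' z'. cop y' (\<lambda>y1 y2. asc (\<lambda>X Y Z. cop X (\<lambda>X1 X2. asci (\<lambda>x y z.
      gamma_form G (X1 * x * x') (X2 * (y * (y1 * \<beta> * S y2) * S (Y * z) * \<alpha> * (Z * z'))))))))"
    by (simp only: cop_beta[OF f1])
  also have "\<dots> = asc (\<lambda>X Y Z. cop X (\<lambda>X1 X2. asci (\<lambda>x' y' z'. cop y' (\<lambda>y1 y2. asci (\<lambda>x y z.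
      gamma_form G (X1 * x * x') (X2 * y * y1 * \<beta> * S (Y * z * y2) * \<alpha> * (Z * z')))))))"
    by ((unfold mult_simps)?, (rule ev_reorder)+)
  also have "\<dots> = asci (\<lambda>x y z. cop z (\<lambda>z1 z2. asc (\<lambda>X Y Z. gamma_form G x (y * X * \<beta> * S (z1 * Y) * \<alpha> * (z2 * Z)))))"
    by (rule pentagon_right[OF q])
  also have "\<dots> = asci (\<lambda>x y z. cop z (\<lambda>z1 z2. asc (\<lambda>X Y Z. gamma_form G x (y * X * \<beta> * S Y * (S z1 * \<alpha> * z2) * Z))))"
    by ((unfold mult_simps)?, (rule ev_reorder)+)
  also have "\<dots> = asc (\<lambda>X Y Z. gamma_form G 1 (X * \<beta> * S Y * \<alpha> * Z))"
    by (simp only: cop_alpha[OF f2] asci_counit3[OF b3] mult_1_left)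
  also have "\<dots> = gamma_form G 1 1" by (rule asc_antipode[OF f3])
  also have "\<dots> = ev2 gamma G" by (rule gamma_form_one[OF G])
  finally show ?thesis .
qed

text \<open>\<open>f_antipode\<close> carries f past \<Delta>(S(a)), then \<open>f_alpha\<close>
  applies. Hence f disappears in favour of \<gamma> wherever it meets \<Delta>(S(a) \<alpha>
  b).\<close>

lemma f_antipode_alpha:
  assumes G: "bilin G"
  shows "cop (S a * \<alpha> * b) (\<lambda>c1 c2. ev2 drinfeld_f (\<lambda>f1 f2. G (f1 * c1) (f2 * c2))) = gamma_form G a b"
proof -
  note GD = bilinD[OF G]
  have b1: "bilin (\<lambda>c1 c2. ev2 drinfeld_f (\<lambda>f1 f2. G (f1 * c1) (f2 * c2)))"
    "bilin (\<lambda>c1 c2. cop b (\<lambda>b1 b2. ev2 drinfeld_f (\<lambda>f1 f2. G (f1 * (c1 * b1)) (f2 * (c2 * b2)))))" by (simp add: lin_defs multilinear GD)+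
  have b2: "bilin (\<lambda>u v. cop \<alpha> (\<lambda>\<alpha>1 \<alpha>2. cop b (\<lambda>b1 b2. G (u * \<alpha>1 * b1) (v * \<alpha>2 * b2))))" by (simp add: lin_defs multilinear GD)
  have b3: "bilin (\<lambda>u v. cop b (\<lambda>b1 b2. G (S a2 * u * b1) (S a1 * v * b2)))" for a1 a2 by (simp add: lin_defs multilinear GD)
  have "cop (S a * \<alpha> * b) (\<lambda>c1 c2. ev2 drinfeld_f (\<lambda>f1 f2. G (f1 * c1) (f2 * c2))) =
    cop (S a) (\<lambda>s1 s2. ev2 drinfeld_f (\<lambda>f1 f2. cop \<alpha> (\<lambda>\<alpha>1 \<alpha>2. cop b (\<lambda>b1 b2.
      G (f1 * s1 * \<alpha>1 * b1) (f2 * s2 * \<alpha>2 * b2)))))"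
    unfolding cop_mult[OF b1(1)] unfolding cop_mult[OF b1(2)] by ((unfold mult_simps)?, (rule ev_reorder)+)
  also have "\<dots> = cop a (\<lambda>a1 a2. ev2 drinfeld_f (\<lambda>f1 f2. cop \<alpha> (\<lambda>\<alpha>1 \<alpha>2. cop b (\<lambda>b1 b2.
      G (S a2 * f1 * \<alpha>1 * b1) (S a1 * f2 * \<alpha>2 * b2)))))"
    by (rule f_antipode[OF b2])
  also have "\<dots> = cop a (\<lambda>a1 a2. cop \<alpha> (\<lambda>\<alpha>1 \<alpha>2. ev2 drinfeld_f (\<lambda>f1 f2. cop b (\<lambda>b1 b2.
      G (S a2 * (f1 * \<alpha>1) * b1) (S a1 * (f2 * \<alpha>2) * b2)))))"
    by ((unfold mult_simps)?, (rule ev_reorder)+)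
  also have "\<dots> = gamma_form G a b"
    by (simp only: f_alpha[OF b3] gamma_form_def)
  finally show ?thesis .
qed

section \<open>Invertibility of the Drinfeld element\<close>

lemma asci_asc_cop1:
  assumes F: "quadrilin F"
  shows "asci (\<lambda>x y z. asc (\<lambda>X Y Z. cop x (\<lambda>x1 x2. cop X (\<lambda>X1 X2.
    F (x1 * X1) (x2 * X2) (y * Y) (z * Z))))) = F 1 1 1 1"
proof -
  note GD = quadrilinD[OF F]
  have b: "bilin (\<lambda>u v. F u v c d)" for c d by (simp add: lin_defs multilinear GD)
  have t: "trilin (\<lambda>a c d. cop a (\<lambda>u v. F u v c d))" by (simp add: lin_defs multilinear GD)
  show ?thesis using asci_asc[OF t] by (simp add: cop_mult[OF b] cop_one[OF b])
qed

text \<open>A candidate for f^-1, built so that f can be multiplied into it: in front of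
  \<Delta>(S(a) \<alpha>) the element f becomes (S \<otimes> S)(\<Delta>^op(a)) \<gamma>, and the
  other factors are arranged so that \<open>gamma_alt\<close>, \<open>qs_cov\<close>,
  \<open>p_q_cancel\<close> and finally \<open>asci_antipode\<close> reduce the product to 1
  \<otimes> 1. It is written as a functional of the form, which spares nested lifts.\<close>

definition f_inv_form :: "('h \<Rightarrow> 'h \<Rightarrow> 'k) \<Rightarrow> 'k" where
  "f_inv_form F = asci (\<lambda>x y z. cop x (\<lambda>x1 x2. ev2 p_R (\<lambda>p1 p2. asc (\<lambda>X Y Z. asc (\<lambda>X' Y' Z'.
    cop X' (\<lambda>X1' X2'. ev2 p_R (\<lambda>p1' p2'. cop (S (X * x1 * p1) * \<alpha>) (\<lambda>c1 c2.
    F (c1 * X1' * p1' * Y * x2 * p2) (c2 * X2' * p2' * (S Y' * \<alpha> * Z') * Z * y * \<beta> * S z)))))))))"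

lemma f_right_inverse:
  assumes F: "bilin F"
  shows "ev2 drinfeld_f (\<lambda>f1 f2. f_inv_form (\<lambda>u v. F (f1 * u) (f2 * v))) = F 1 1"
proof -
  note GD = bilinD[OF F]
  have b1: "bilin (\<lambda>u v. F (u * w) (v * w'))" for w w' by (simp add: lin_defs multilinear GD)
  have K1: "cop (S a * \<alpha>) (\<lambda>c1 c2. ev2 drinfeld_f (\<lambda>f1 f2. F (f1 * c1 * w) (f2 * c2 * w'))) =
    cop a (\<lambda>a1 a2. ev2 gamma (\<lambda>g1 g2. F (S a2 * g1 * w) (S a1 * g2 * w')))" for a w w'
  proof -
    have b: "bilin (\<lambda>y1 y2. F (S x2 * g1 * y1 * w) (S x1 * g2 * y2 * w'))" for x1 x2 g1 g2 by (simp add: lin_defs multilinear GD)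
    show ?thesis
      using f_antipode_alpha[OF b1, of a 1 w w'] by (simp add: gamma_form_def cop_one[OF b])
  qed
  have b2: "bilin (\<lambda>u v. cop (X * x1 * p1) (\<lambda>a1 a2. ev2 gamma (\<lambda>g1 g2.
      F (S a2 * g1 * u * (Y * x2 * p2)) (S a1 * g2 * v * (Z * y * \<beta> * S z)))))" for X x1 p1 Y x2 p2 Z y z by (simp add: lin_defs multilinear GD)
  have b3: "bilin (\<lambda>g1 g2. F (S a2 * g1 * w) (S a1 * g2 * w'))" for a1 a2 w w' by (simp add: lin_defs multilinear GD)
  have b4: "bilin (\<lambda>a1 a2. asc (\<lambda>X' Y' Z'. asci (\<lambda>x' y' z'. cop x' (\<lambda>x1' x2'.
      F (S a2 * (S (Y' * x2') * \<alpha> * (Z' * y')) * w) (S a1 * (S (X' * x1') * \<alpha> * z') * w')))))" for w w' by (simp add: lin_defs multilinear GD)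
  have b5: "bilin (\<lambda>a1 a2. asc (\<lambda>X' Y' Z'. asci (\<lambda>x' y' z'. cop x' (\<lambda>x1' x2'.
      F (S (c2 * a2) * (S (Y' * x2') * \<alpha> * (Z' * y')) * w) (S (c1 * a1) * (S (X' * x1') * \<alpha> * z') * w')))))"
    for w w' c1 c2 by (simp add: lin_defs multilinear GD)
  have K2: "cop (X * x1 * p1) (\<lambda>a1 a2. ev2 gamma (\<lambda>g1 g2. F (S a2 * g1 * w) (S a1 * g2 * w'))) =
    cop X (\<lambda>X1 X2. cop x1 (\<lambda>x11 x12. cop p1 (\<lambda>p11 p12. asc (\<lambda>X' Y' Z'. asci (\<lambda>x' y' z'. cop x' (\<lambda>x1' x2'.
    F (S (X2 * (x12 * p12)) * (S (Y' * x2') * \<alpha> * (Z' * y')) * w)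
      (S (X1 * (x11 * p11)) * (S (X' * x1') * \<alpha> * z') * w')))))))" for X x1 p1 w w'
    by (simp only: gamma_alt[OF b3], simp only: mult.assoc[of X x1 p1] cop_mult[OF b4],
      simp only: cop_mult[OF b5])
  have q: "quadrilin (\<lambda>a b c d. F (S (Y'' * b * x12 * p12) * \<alpha> * (Z'' * c * x2 * p2))
      (S (X'' * a * x11 * p11) * \<alpha> * (d * y * \<beta> * S z)))"
    for X'' Y'' Z'' x11 x12 x2 p11 p12 p2 y z by (simp add: lin_defs multilinear GD)
  have b6: "bilin (\<lambda>u v. F (S p12 * v * p2) (S p11 * S u * \<alpha> * y * \<beta> * S z))" for p12 p2 p11 y z by (simp add: lin_defs multilinear GD)
  have b7: "bilin (\<lambda>u v. F v (S u * S x * \<alpha> * y * \<beta> * S z))" for x y z by (simp add: lin_defs multilinear GD)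
  have f: "(\<lambda>t. F 1 t) \<in> dual" by (simp add: lin_defs multilinear GD)
  have "ev2 drinfeld_f (\<lambda>f1 f2. f_inv_form (\<lambda>u v. F (f1 * u) (f2 * v))) =
    asci (\<lambda>x y z. cop x (\<lambda>x1 x2. ev2 p_R (\<lambda>p1 p2. asc (\<lambda>X Y Z. asc (\<lambda>X' Y' Z'.
    cop X' (\<lambda>X1' X2'. ev2 p_R (\<lambda>p1' p2'. cop (S (X * x1 * p1) * \<alpha>) (\<lambda>c1 c2. ev2 drinfeld_f (\<lambda>f1 f2.
    F (f1 * c1 * (X1' * p1' * (Y * x2 * p2))) (f2 * c2 * (X2' * p2' * (S Y' * \<alpha> * Z') * (Z * y * \<beta> * S z))))))))))))"
    unfolding f_inv_form_def by ((unfold mult_simps)?, (rule ev_reorder)+)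
  also have "\<dots> = asci (\<lambda>x y z. cop x (\<lambda>x1 x2. ev2 p_R (\<lambda>p1 p2. asc (\<lambda>X Y Z. asc (\<lambda>X' Y' Z'.
    cop X' (\<lambda>X1' X2'. ev2 p_R (\<lambda>p1' p2'. cop (X * x1 * p1) (\<lambda>a1 a2. ev2 gamma (\<lambda>g1 g2.
    F (S a2 * g1 * (X1' * p1') * (Y * x2 * p2)) (S a1 * g2 * (X2' * p2' * (S Y' * \<alpha> * Z')) * (Z * y * \<beta> * S z)))))))))))"
    by (simp only: K1, simp only: mult.assoc)
  \<comment> \<open>The contraction \<Delta>(X') p_R (1 \<otimes> S(Y') \<alpha> Z') equals 1
    \<otimes> 1.\<close>
  also have "\<dots> = asci (\<lambda>x y z. cop x (\<lambda>x1 x2. ev2 p_R (\<lambda>p1 p2. asc (\<lambda>X Y Z. cop (X * x1 * p1) (\<lambda>a1 a2. ev2 gamma (\<lambda>g1 g2.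
    F (S a2 * g1 * (Y * x2 * p2)) (S a1 * g2 * (Z * y * \<beta> * S z))))))))"
    by (simp only: q_p_cancel[OF b2] mult_1_right)
  also have "\<dots> = asci (\<lambda>x y z. cop x (\<lambda>x1 x2. ev2 p_R (\<lambda>p1 p2. asc (\<lambda>X Y Z. cop X (\<lambda>X1 X2. cop x1 (\<lambda>x11 x12. cop p1 (\<lambda>p11 p12.
    asc (\<lambda>X' Y' Z'. asci (\<lambda>x' y' z'. cop x' (\<lambda>x1' x2'.
    F (S (X2 * (x12 * p12)) * (S (Y' * x2') * \<alpha> * (Z' * y')) * (Y * x2 * p2))
      (S (X1 * (x11 * p11)) * (S (X' * x1') * \<alpha> * z') * (Z * y * \<beta> * S z))))))))))))"
    by (simp only: K2)
  also have "\<dots> = asci (\<lambda>x y z. cop x (\<lambda>x1 x2. ev2 p_R (\<lambda>p1 p2. asc (\<lambda>X Y Z. asc (\<lambda>X' Y' Z'. cop x1 (\<lambda>x11 x12. cop p1 (\<lambda>p11 p12. asci (\<lambda>x' y' z'. cop x' (\<lambda>x1' x2'. cop X (\<lambda>X1 X2.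
    F (S (Y' * (x2' * X2) * x12 * p12) * \<alpha> * (Z' * (y' * Y) * x2 * p2))
      (S (X' * (x1' * X1) * x11 * p11) * \<alpha> * (z' * Z * y * \<beta> * S z))))))))))))"
    by ((unfold mult_simps)?, (rule ev_reorder)+)
  \<comment> \<open>Two copies of \<phi> trade places. The swap is named, because congruence would
    pair equal tensors in the order displayed.\<close>
  also have "\<dots> = asci (\<lambda>x y z. cop x (\<lambda>x1 x2. ev2 p_R (\<lambda>p1 p2. asc (\<lambda>X' Y' Z'. asc (\<lambda>X Y Z. cop x1 (\<lambda>x11 x12. cop p1 (\<lambda>p11 p12. asci (\<lambda>x' y' z'. cop x' (\<lambda>x1' x2'. cop X (\<lambda>X1 X2.
    F (S (Y' * (x2' * X2) * x12 * p12) * \<alpha> * (Z' * (y' * Y) * x2 * p2))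
      (S (X' * (x1' * X1) * x11 * p11) * \<alpha> * (z' * Z * y * \<beta> * S z))))))))))))"
    by (rule ev3_cong, rule ev2_cong, rule ev2_cong, rule ev33_swap)
  \<comment> \<open>Now the \<phi>^-1 from \<gamma> stands immediately to the left of the \<phi> of
    \<open>f_inv_form\<close>, both with comultiplied first leg, ready to cancel.\<close>
  also have "\<dots> = asci (\<lambda>x y z. cop x (\<lambda>x1 x2. ev2 p_R (\<lambda>p1 p2. cop x1 (\<lambda>x11 x12. cop p1 (\<lambda>p11 p12.
    asc (\<lambda>X' Y' Z'. asci (\<lambda>x' y' z'. asc (\<lambda>X Y Z. cop x' (\<lambda>x1' x2'. cop X (\<lambda>X1 X2.
    F (S (Y' * (x2' * X2) * x12 * p12) * \<alpha> * (Z' * (y' * Y) * x2 * p2))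
      (S (X' * (x1' * X1) * x11 * p11) * \<alpha> * (z' * Z * y * \<beta> * S z))))))))))))"
    by ((unfold mult_simps)?, (rule ev_reorder)+)
  also have "\<dots> = asci (\<lambda>x y z. cop x (\<lambda>x1 x2. ev2 p_R (\<lambda>p1 p2. cop x1 (\<lambda>x11 x12. cop p1 (\<lambda>p11 p12.
    asc (\<lambda>X' Y' Z'. F (S (Y' * 1 * x12 * p12) * \<alpha> * (Z' * 1 * x2 * p2))
      (S (X' * 1 * x11 * p11) * \<alpha> * (1 * y * \<beta> * S z))))))))"
    by (simp only: asci_asc_cop1[OF q])
  also have "\<dots> = asci (\<lambda>x y z. ev2 p_R (\<lambda>p1 p2. cop p1 (\<lambda>p11 p12. cop x (\<lambda>x1 x2. cop x1 (\<lambda>x11 x12.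
    asc (\<lambda>X Y Z. F (S p12 * (S (Y * x12) * \<alpha> * (Z * x2)) * p2) (S p11 * S (X * x11) * \<alpha> * y * \<beta> * S z)))))))"
    unfolding mult_1_right mult_1_left by ((unfold mult_simps)?, (rule ev_reorder)+)
  also have "\<dots> = asci (\<lambda>x y z. ev2 p_R (\<lambda>p1 p2. cop p1 (\<lambda>p11 p12.
    asc (\<lambda>X Y Z. F (S p12 * (S Y * \<alpha> * Z) * p2) (S p11 * S (x * X) * \<alpha> * y * \<beta> * S z)))))"
    by (simp only: qs_cov[OF b6])
  also have "\<dots> = asci (\<lambda>x y z. ev2 p_R (\<lambda>p1 p2. cop p1 (\<lambda>p11 p12.
    asc (\<lambda>X Y Z. F (S (Y * p12) * \<alpha> * Z * p2) (S (X * p11) * S x * \<alpha> * y * \<beta> * S z)))))"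
    by (simp only: mult_simps)
  also have "\<dots> = asci (\<lambda>x y z. F 1 (S x * \<alpha> * y * \<beta> * S z))"
    by (simp only: p_q_cancel[OF b7] antipode_one mult_1_left)
  also have "\<dots> = F 1 1" by (rule asci_antipode[OF f])
  finally show ?thesis .
qed

abbreviation f_inv where "f_inv \<equiv> inverse2 drinfeld_f"

text \<open>The functional \<open>f_inv_form\<close> is tensorial, hence given by a tensor
  \<open>g\<close> with f g = 1 \<otimes> 1; finite dimension supplies g f = 1 \<otimes> 1.\<close>

lemma f_inverse: "is_inverse2 drinfeld_f f_inv"
proof -
  have "tensorial f_inv_form"
    unfolding f_inv_form_def by (intro tensorial_ev2 tensorial_ev3 tensorial_ten)
  then obtain g where g: "g \<in> tensors2" "\<And>F. bilin F \<Longrightarrow> ev2 g F = f_inv_form F"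
    by (auto simp: tensorial_def)
  have fg: "drinfeld_f \<bullet> g = 1 \<otimes> 1"
  proof (rule tensors2_eqI)
    fix F assume F: "bilin F"
    note GD = bilinD[OF F]
    have b: "bilin (\<lambda>c d. F (a * c) (b * d))" for a b by (simp add: lin_defs multilinear GD)
    show "ev2 (drinfeld_f \<bullet> g) F = ev2 (1 \<otimes> 1) F"
      by (simp only: ev2_mult[OF f_props(1) g(1) F] g(2)[OF b] f_right_inverse[OF F] ev2_ten[OF F])
  qed (simp_all add: mult2_closed f_props(1) g tensors2_closed)
  have "is_inverse2 drinfeld_f g"
    using fg mult2_left_inverse[OF f_props(1) g(1) fg] g(1) by (simp add: is_inverse2_def)
  then show ?thesis by (rule is_inverse2_inverse2[OF f_props(1)])
qed

lemma f_inv_closed: "f_inv \<in> tensors2"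
  using f_inverse by (simp add: is_inverse2_def)

lemma f_f_inv: "bilin F \<Longrightarrow> ev2 drinfeld_f (\<lambda>a b. ev2 f_inv (\<lambda>c d. F (a * c) (b * d))) = F 1 1"
  using ev2_mult[OF f_props(1) f_inv_closed, of F] f_inverse
  by (simp add: is_inverse2_def ev2_ten)

section \<open>The elements U and V\<close>

lemma U_props: "tensor_U \<in> tensors2"
  "bilin F \<Longrightarrow> ev2 tensor_U F = ev2 f_inv (\<lambda>g1 g2. asc (\<lambda>X Y Z. F (g1 * (S Y * \<alpha> * Z)) (g2 * S X)))"
proof -
  have m: "map2 S S (flip q_R) \<in> tensors2"
    by (intro map2_closed flip_closed q_props(1) S_linear)
  show "tensor_U \<in> tensors2"
    unfolding tensor_U_def by (intro mult2_closed f_inv_closed m)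
  assume F: "bilin F"
  note GD = bilinD[OF F]
  have b: "bilin (\<lambda>c d. F (a * c) (b * d))" "bilin (\<lambda>c d. F (a * S c) (b * S d))" "bilin (\<lambda>d c. F (a * S c) (b * S d))" for a b
    by (simp add: lin_defs multilinear GD)+
  show "ev2 tensor_U F = ev2 f_inv (\<lambda>g1 g2. asc (\<lambda>X Y Z. F (g1 * (S Y * \<alpha> * Z)) (g2 * S X)))"
    unfolding tensor_U_def
    by (simp only: ev2_mult[OF f_inv_closed m F] ev2_map2[OF flip_closed[OF q_props(1)] S_linear S_linear b(1)]
      ev2_flip[OF q_props(1) b(2)] q_props(2)[OF b(3)], simp only: mult_simps S_S_inv)
qed

lemma V_props: "tensor_V \<in> tensors2"
  "bilin F \<Longrightarrow> ev2 tensor_V F = ev2 drinfeld_f (\<lambda>f1 f2. ev2 p_R (\<lambda>p1 p2. F (S_inv (f2 * p2)) (S_inv (f1 * p1))))"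
proof -
  have m: "map2 S_inv S_inv (flip p_R) \<in> tensors2" "drinfeld_h \<in> tensors2"
    unfolding drinfeld_h_def by (intro map2_closed flip_closed p_props(1) f_props(1) S_inv_linear)+
  show "tensor_V \<in> tensors2"
    unfolding tensor_V_def by (intro mult2_closed m)
  assume F: "bilin F"
  note GD = bilinD[OF F]
  have b: "bilin (\<lambda>c d. F (a * c) (b * d))" "bilin (\<lambda>c d. F (a * S_inv c) (b * S_inv d))"
    "bilin (\<lambda>d c. F (a * S_inv c) (b * S_inv d))" for a b
    by (simp add: lin_defs multilinear GD)+
  have b': "bilin (\<lambda>a b. ev2 drinfeld_f (\<lambda>d c. F (a * S_inv c) (b * S_inv d)))"
    "bilin (\<lambda>a b. ev2 drinfeld_f (\<lambda>d c. F (S_inv a * S_inv c) (S_inv b * S_inv d)))" by (simp add: lin_defs multilinear GD)+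
  have "ev2 tensor_V F = ev2 p_R (\<lambda>p1 p2. ev2 drinfeld_f (\<lambda>f1 f2. F (S_inv p2 * S_inv f2) (S_inv p1 * S_inv f1)))"
    unfolding tensor_V_def
    by (simp only: ev2_mult[OF m F], unfold drinfeld_h_def, simp only: ev2_map2[OF flip_closed[OF f_props(1)] S_inv_linear S_inv_linear b(1)]
      ev2_flip[OF f_props(1) b(2)] ev2_map2[OF flip_closed[OF p_props(1)] S_inv_linear S_inv_linear b'(1)]
      ev2_flip[OF p_props(1) b'(2)])
  also have "\<dots> = ev2 drinfeld_f (\<lambda>f1 f2. ev2 p_R (\<lambda>p1 p2. F (S_inv (f2 * p2)) (S_inv (f1 * p1))))"
    unfolding S_inv_mult by (rule ev_reorder)+
  finally show "ev2 tensor_V F = ev2 drinfeld_f (\<lambda>f1 f2. ev2 p_R (\<lambda>p1 p2. F (S_inv (f2 * p2)) (S_inv (f1 * p1))))" .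
qed

lemma comult_bar_props: "comult_bar a \<in> tensors2"
  "bilin F \<Longrightarrow> ev2 (comult_bar a) F = ev2 tensor_V (\<lambda>v1 v2. cop a (\<lambda>a1 a2. ev2 tensor_U (\<lambda>u1 u2.
    F (v1 * a1 * u1) (v2 * a2 * u2))))"
proof -
  show "comult_bar a \<in> tensors2"
    unfolding comult_bar_def by (intro mult2_closed U_props V_props comult_closed)
  assume F: "bilin F"
  note GD = bilinD[OF F]
  have b: "bilin (\<lambda>a b. ev2 tensor_U (\<lambda>c d. F (a * c) (b * d)))" by (simp add: lin_defs multilinear GD)
  show "ev2 (comult_bar a) F = ev2 tensor_V (\<lambda>v1 v2. cop a (\<lambda>a1 a2. ev2 tensor_U (\<lambda>u1 u2.
    F (v1 * a1 * u1) (v2 * a2 * u2))))"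
    unfolding comult_bar_def
    by (simp only: ev2_mult[OF mult2_closed[OF V_props(1) comult_closed] U_props(1) F] ev2_mult[OF V_props(1) comult_closed b])
qed

text \<open>\<open>f_antipode\<close> read backwards at S^-1(c). Since V contains S^-1 of f and of
  p_R, the coproduct of S^-1(c) slips between them as a coproduct of c.\<close>

lemma V_antipode:
  assumes G: "bilin G"
  shows "ev2 tensor_V (\<lambda>v1 v2. cop (S_inv c) (\<lambda>e1 e2. G (v1 * e1) (v2 * e2))) =
    cop c (\<lambda>c1 c2. ev2 drinfeld_f (\<lambda>f1 f2. ev2 p_R (\<lambda>p1 p2. G (S_inv (f2 * c2 * p2)) (S_inv (f1 * c1 * p1)))))"
proof -
  note GD = bilinD[OF G]
  have b: "bilin (\<lambda>v1 v2. cop (S_inv c) (\<lambda>e1 e2. G (v1 * e1) (v2 * e2)))" by (simp add: lin_defs multilinear GD)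
  have b2: "bilin (\<lambda>u v. ev2 p_R (\<lambda>p1 p2. G (S_inv (v * p2)) (S_inv (u * p1))))" by (simp add: lin_defs multilinear GD)
  have "ev2 tensor_V (\<lambda>v1 v2. cop (S_inv c) (\<lambda>e1 e2. G (v1 * e1) (v2 * e2))) =
    cop (S_inv c) (\<lambda>e1 e2. ev2 drinfeld_f (\<lambda>f1 f2. ev2 p_R (\<lambda>p1 p2.
      G (S_inv (S e1 * f2 * p2)) (S_inv (S e2 * f1 * p1)))))"
    unfolding V_props(2)[OF b] unfolding mult_simps S_inv_S by (rule ev_reorder)+
  also have "\<dots> = cop (S (S_inv c)) (\<lambda>c1 c2. ev2 drinfeld_f (\<lambda>f1 f2. ev2 p_R (\<lambda>p1 p2.
      G (S_inv (f2 * c2 * p2)) (S_inv (f1 * c1 * p1)))))"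
    by (rule f_antipode[OF b2, symmetric])
  finally show ?thesis by simp
qed

text \<open>Stated for three arbitrary tensors, which the reordering rules can tell apart, and
  applied to three copies of \<phi>.\<close>

lemma ev333_rotate:
  "ev3 s (\<lambda>a b c. ev3 t (\<lambda>d e f. ev3 u (F a b c d e f))) =
    ev3 u (\<lambda>g h i. ev3 s (\<lambda>a b c. ev3 t (\<lambda>d e f. F a b c d e f g h i)))"
  by (rule ev_reorder)+

text \<open>The right-hand side evaluates S(x) \<alpha> y \<otimes> z, usually called q_L. The
  pentagon is used twice: \<open>pentagon_left\<close> joins one \<phi> to the \<phi>^-1 of
  \<gamma>, and later three copies of \<phi> are recombined by \<open>pentagon_ev\<close> from right
  to left. In between, every coproduct is brought around an \<alpha> or a \<beta> and
  collapses.\<close>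

lemma gamma_form_tilde:
  assumes G: "bilin G"
  shows "asc (\<lambda>X' Y' Z'. asc (\<lambda>X Y Z. gamma_form (\<lambda>u v. G (S Z * u) (X' * X * \<beta> * S Y * v)) Y' Z')) =
    asci (\<lambda>x y z. G (S x * \<alpha> * y) z)"
proof -
  note GD = bilinD[OF G]
  have b1: "bilin (\<lambda>g1 g2. cop Z' (\<lambda>Z1' Z2'. G (S Z * (S b2 * g1 * Z1')) (X' * X * \<beta> * S Y * (S b1 * g2 * Z2'))))"
    for X Y Z X' Z' b1 b2 by (simp add: lin_defs multilinear GD)
  let ?K = "\<lambda>a b c d. asc (\<lambda>X Y Z. asc (\<lambda>X'' Y'' Z''. cop b (\<lambda>b1 b2.
    G (S (Y'' * b2 * Z) * \<alpha> * (Z'' * c)) (a * X * \<beta> * S (X'' * b1 * Y) * \<alpha> * d))))"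
  have q: "quadrilin ?K" by (simp add: lin_defs multilinear GD)
  have bb: "bilin (\<lambda>b1 b2. G (S (Y'' * b2 * Z) * \<alpha> * (Z'' * c)) (a * X * \<beta> * S (X'' * b1 * Y) * \<alpha> * d))"
    for Y'' Z Z'' c a X X'' Y d by (simp add: lin_defs multilinear GD)
  have bb2: "bilin (\<lambda>b1 b2. cop v (\<lambda>v1 v2. G (S (Y'' * (b2 * v2) * Z) * \<alpha> * (Z'' * c)) (a * X * \<beta> * S (X'' * (b1 * v1) * Y) * \<alpha> * d)))"
    for Y'' Z Z'' c a X X'' Y d v by (simp add: lin_defs multilinear GD)
  have K3: "cop (p * v * w) (\<lambda>b1 b2. G (S (Y'' * b2 * Z) * \<alpha> * (Z'' * c)) (a * X * \<beta> * S (X'' * b1 * Y) * \<alpha> * d)) =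
    cop p (\<lambda>p1 p2. cop v (\<lambda>v1 v2. cop w (\<lambda>w1 w2.
      G (S (Y'' * (p2 * (v2 * w2)) * Z) * \<alpha> * (Z'' * c)) (a * X * \<beta> * S (X'' * (p1 * (v1 * w1)) * Y) * \<alpha> * d))))"
    for p v w Y'' Z Z'' c a X X'' Y d
    by (simp only: cop_mult[OF bb], simp only: cop_mult[OF bb2], simp only: mult.assoc)
  have t1: "trilin (\<lambda>u v w. G (S (v * (V2 * x22) * Z) * \<alpha> * (w * W * y))
        (X' * U * x1 * X * \<beta> * S (u * (V1 * x21) * Y) * \<alpha> * (Z' * z)))" for V2 x22 Z W y X' U x1 X V1 x21 Y Z' z by (simp add: lin_defs multilinear GD)
  have t2: "trilin (\<lambda>u v w. asc (\<lambda>X'' Y'' Z''. G (S (Y'' * (V2 * w)) * \<alpha> * (Z'' * W * y))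
        (X' * U * u * \<beta> * S (X'' * (V1 * v)) * S Y' * \<alpha> * (Z' * z))))" for V2 W y X' U V1 Y' Z' z by (simp add: lin_defs multilinear GD)
  have f1: "(\<lambda>t. G (S (Y'' * (V2 * x22) * Z) * t * (Z'' * W * y))
        (X' * U * x1 * X * \<beta> * S (X'' * (V1 * x21) * Y) * S Y1' * \<alpha> * (Z' * z))) \<in> dual"
    for Y'' V2 x22 Z Z'' W y X' U x1 X X'' V1 x21 Y Y1' Z' z by (simp add: lin_defs multilinear GD)
  have f2: "(\<lambda>t. G (S (Y'' * (V2 * x22) * Z) * \<alpha> * (Z'' * W * y))
        (X' * U * x1 * X * \<beta> * S (X'' * (V1 * x21) * Y) * S t * \<alpha> * (Z' * z))) \<in> dual"
    for Y'' V2 x22 Z Z'' W y X' U x1 X X'' V1 x21 Y Z' z by (simp add: lin_defs multilinear GD)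
  have f3: "(\<lambda>t. G (S (Y'' * (V2 * (Z * x2))) * \<alpha> * (Z'' * W * y))
        (X' * U * X * t * S (X'' * (V1 * Y)) * S Y' * \<alpha> * (Z' * z))) \<in> dual"
    for Y'' V2 Z x2 Z'' W y X' U X X'' V1 Y Y' Z' z by (simp add: lin_defs multilinear GD)
  have f4: "(\<lambda>t. G (S (Y'' * (V2 * (Z * t))) * \<alpha> * (Z'' * W * y))
        (X' * U * X * \<beta> * S (X'' * (V1 * Y)) * S Y' * \<alpha> * (Z' * z))) \<in> dual"
    for Y'' V2 Z Z'' W y X' U X X'' V1 Y Y' Z' z by (simp add: lin_defs multilinear GD)
  have q3: "quadrilin (\<lambda>a b c d. G (S (c * x) * \<alpha> * (d * y)) (X' * a * \<beta> * S b * S Y' * \<alpha> * (Z' * z)))"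
    for x y X' Y' Z' z by (simp add: lin_defs multilinear GD)
  have f5: "(\<lambda>t. G (S (V * x) * u * (W * y)) (X' * X * t * w)) \<in> dual" for V x u W y X' X w by (simp add: lin_defs multilinear GD)
  have b5: "bilin (\<lambda>V W. G (S (V * x) * u * (W * y)) (X' * X * \<beta> * w))" for x u y X' X w by (simp add: lin_defs multilinear GD)
  have f6: "(\<lambda>t. G (S (1 * x) * t * (1 * y)) w) \<in> dual" for x y w by (simp add: lin_defs multilinear GD)
  have b6: "bilin (\<lambda>X Y. G (S (1 * x) * \<alpha> * (1 * y)) (X' * X * \<beta> * (S Y * S Y' * \<alpha> * (Z' * z))))" for x y X' Y' Z' z by (simp add: lin_defs multilinear GD)
  have f7: "(\<lambda>t. G (S x * \<alpha> * y) (t * z)) \<in> dual" for x y z by (simp add: lin_defs multilinear GD)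
  have "asc (\<lambda>X' Y' Z'. asc (\<lambda>X Y Z. gamma_form (\<lambda>u v. G (S Z * u) (X' * X * \<beta> * S Y * v)) Y' Z')) =
    asc (\<lambda>X' Y' Z'. asc (\<lambda>X Y Z. cop Y' (\<lambda>Y1' Y2'. asc (\<lambda>X'' Y'' Z''. asci (\<lambda>x y z. cop x (\<lambda>x1 x2. cop Z' (\<lambda>Z1' Z2'.
      G (S Z * (S Y2' * (S (Y'' * x2) * \<alpha> * (Z'' * y)) * Z1')) (X' * X * \<beta> * S Y * (S Y1' * (S (X'' * x1) * \<alpha> * z) * Z2')))))))))"
    unfolding gamma_form_def gamma_alt[OF b1] ..
  also have "\<dots> = asci (\<lambda>x y z. asc (\<lambda>X' Y' Z'. cop Z' (\<lambda>Z1' Z2'. asc (\<lambda>X Y Z. asc (\<lambda>X'' Y'' Z''. cop x (\<lambda>x1 x2. cop Y' (\<lambda>Y1' Y2'.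
      G (S (Y'' * (x2 * Y2') * Z) * \<alpha> * (Z'' * (y * Z1'))) (X' * X * \<beta> * S (X'' * (x1 * Y1') * Y) * \<alpha> * (z * Z2')))))))))"
    by ((unfold mult_simps)?, (rule ev_reorder)+)
  also have "\<dots> = asci (\<lambda>x y z. asc (\<lambda>X' Y' Z'. cop Z' (\<lambda>Z1' Z2'. ?K X' (x * Y') (y * Z1') (z * Z2'))))"
    by (simp only: cop_mult[OF bb])
  also have "\<dots> = asc (\<lambda>X' Y' Z'. cop Y' (\<lambda>Y1' Y2'. asc (\<lambda>U V W. asci (\<lambda>x y z. cop x (\<lambda>x1 x2.
      ?K (X' * U * x1) (Y1' * V * x2) (Y2' * W * y) (Z' * z))))))"
    by (rule pentagon_left[OF q])
  also have "\<dots> = asc (\<lambda>X' Y' Z'. cop Y' (\<lambda>Y1' Y2'. asc (\<lambda>U V W. asci (\<lambda>x y z. cop x (\<lambda>x1 x2.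
      asc (\<lambda>X Y Z. asc (\<lambda>X'' Y'' Z''. cop Y1' (\<lambda>Y11' Y12'. cop V (\<lambda>V1 V2. cop x2 (\<lambda>x21 x22.
      G (S (Y'' * (Y12' * (V2 * x22)) * Z) * \<alpha> * (Z'' * (Y2' * W * y)))
        (X' * U * x1 * X * \<beta> * S (X'' * (Y11' * (V1 * x21)) * Y) * \<alpha> * (Z' * z))))))))))))"
    by (simp only: K3)
  also have "\<dots> = asc (\<lambda>X' Y' Z'. asc (\<lambda>U V W. asci (\<lambda>x y z. cop x (\<lambda>x1 x2. cop V (\<lambda>V1 V2. cop x2 (\<lambda>x21 x22.
      asc (\<lambda>X Y Z. asc (\<lambda>X'' Y'' Z''. cop Y' (\<lambda>Y1' Y2'. cop Y1' (\<lambda>Y11' Y12'.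
      G (S (Y'' * Y12' * (V2 * x22) * Z) * \<alpha> * (Z'' * Y2' * W * y))
        (X' * U * x1 * X * \<beta> * S (X'' * Y11' * (V1 * x21) * Y) * \<alpha> * (Z' * z))))))))))))"
    by ((unfold mult_simps)?, (rule ev_reorder)+)
  \<comment> \<open>Coassociativity changes the bracketing of \<Delta>^2(Y') so that its last two
    factors enclose \<alpha>.\<close>
  also have "\<dots> = asc (\<lambda>X' Y' Z'. asc (\<lambda>U V W. asci (\<lambda>x y z. cop x (\<lambda>x1 x2. cop V (\<lambda>V1 V2. cop x2 (\<lambda>x21 x22.
      asc (\<lambda>X Y Z. cop Y' (\<lambda>Y1' Y2'. cop Y2' (\<lambda>Y21' Y22'. asc (\<lambda>X'' Y'' Z''.
      G (S (Y21' * Y'' * (V2 * x22) * Z) * \<alpha> * (Y22' * Z'' * W * y))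
        (X' * U * x1 * X * \<beta> * S (Y1' * X'' * (V1 * x21) * Y) * \<alpha> * (Z' * z))))))))))))"
    by (simp only: coassoc[OF t1])
  also have "\<dots> = asc (\<lambda>X' Y' Z'. asc (\<lambda>U V W. asci (\<lambda>x y z. asc (\<lambda>X Y Z. asc (\<lambda>X'' Y'' Z''.
      cop x (\<lambda>x1 x2. cop V (\<lambda>V1 V2. cop x2 (\<lambda>x21 x22. cop Y' (\<lambda>Y1' Y2'. cop Y2' (\<lambda>Y21' Y22'.
      G (S (Y'' * (V2 * x22) * Z) * (S Y21' * \<alpha> * Y22') * (Z'' * W * y))
        (X' * U * x1 * X * \<beta> * S (X'' * (V1 * x21) * Y) * S Y1' * \<alpha> * (Z' * z))))))))))))"
    by ((unfold mult_simps)?, (rule ev_reorder)+)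
  also have "\<dots> = asc (\<lambda>X' Y' Z'. asc (\<lambda>U V W. asci (\<lambda>x y z. asc (\<lambda>X Y Z. asc (\<lambda>X'' Y'' Z''.
      cop x (\<lambda>x1 x2. cop V (\<lambda>V1 V2. cop x2 (\<lambda>x21 x22.
      G (S (Y'' * (V2 * x22) * Z) * \<alpha> * (Z'' * W * y))
        (X' * U * x1 * X * \<beta> * S (X'' * (V1 * x21) * Y) * S Y' * \<alpha> * (Z' * z))))))))))"
    by (simp only: cop_alpha[OF f1] cop_counit_right[OF f2])
  also have "\<dots> = asc (\<lambda>X' Y' Z'. asc (\<lambda>U V W. asci (\<lambda>x y z. cop V (\<lambda>V1 V2. cop x (\<lambda>x1 x2. cop x2 (\<lambda>x21 x22.
      asc (\<lambda>X Y Z. asc (\<lambda>X'' Y'' Z''.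
      G (S (Y'' * (V2 * (x22 * Z))) * \<alpha> * (Z'' * W * y))
        (X' * U * (x1 * X) * \<beta> * S (X'' * (V1 * (x21 * Y))) * S Y' * \<alpha> * (Z' * z))))))))))"
    by ((unfold mult_simps)?, (rule ev_reorder)+)
  also have "\<dots> = asc (\<lambda>X' Y' Z'. asc (\<lambda>U V W. asci (\<lambda>x y z. cop V (\<lambda>V1 V2. asc (\<lambda>X Y Z. cop x (\<lambda>x1 x2. cop x1 (\<lambda>x11 x12.
      asc (\<lambda>X'' Y'' Z''.
      G (S (Y'' * (V2 * (Z * x2))) * \<alpha> * (Z'' * W * y))
        (X' * U * (X * x11) * \<beta> * S (X'' * (V1 * (Y * x12))) * S Y' * \<alpha> * (Z' * z))))))))))"
    by (simp only: coassoc[OF t2])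
  also have "\<dots> = asc (\<lambda>X' Y' Z'. asci (\<lambda>x y z. asc (\<lambda>U V W. asc (\<lambda>X Y Z. asc (\<lambda>X'' Y'' Z''. cop V (\<lambda>V1 V2.
      cop x (\<lambda>x1 x2. cop x1 (\<lambda>x11 x12.
      G (S (Y'' * (V2 * (Z * x2))) * \<alpha> * (Z'' * W * y))
        (X' * U * X * (x11 * \<beta> * S x12) * S (X'' * (V1 * Y)) * S Y' * \<alpha> * (Z' * z))))))))))"
    by ((unfold mult_simps)?, (rule ev_reorder)+)
  also have "\<dots> = asc (\<lambda>X' Y' Z'. asci (\<lambda>x y z. asc (\<lambda>U V W. asc (\<lambda>X Y Z. asc (\<lambda>X'' Y'' Z''. cop V (\<lambda>V1 V2.
      G (S (Y'' * (V2 * (Z * x))) * \<alpha> * (Z'' * W * y))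
        (X' * U * X * \<beta> * S (X'' * (V1 * Y)) * S Y' * \<alpha> * (Z' * z))))))))"
    by (simp only: cop_beta[OF f3] cop_counit_left[OF f4])
  \<comment> \<open>The third copy of \<phi> is rotated to the front, giving the order in which
    \<open>pentagon_ev\<close> lists its factors.\<close>
  also have "\<dots> = asc (\<lambda>X' Y' Z'. asci (\<lambda>x y z. asc (\<lambda>X'' Y'' Z''. asc (\<lambda>U V W. asc (\<lambda>X Y Z. cop V (\<lambda>V1 V2.
      G (S (Y'' * (V2 * (Z * x))) * \<alpha> * (Z'' * W * y))
        (X' * U * X * \<beta> * S (X'' * (V1 * Y)) * S Y' * \<alpha> * (Z' * z))))))))"
    by (rule ev3_cong, rule ev3_cong, rule ev333_rotate)
  also have "\<dots> = asc (\<lambda>X' Y' Z'. asci (\<lambda>x y z. asc (\<lambda>X'' Y'' Z''. asc (\<lambda>U V W. cop V (\<lambda>V1 V2. asc (\<lambda>X Y Z.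
      G (S (Y'' * (V2 * Z) * x) * \<alpha> * (Z'' * W * y))
        (X' * (U * X) * \<beta> * S (X'' * (V1 * Y)) * S Y' * \<alpha> * (Z' * z))))))))"
    by ((unfold mult_simps)?, (rule ev_reorder)+)
  also have "\<dots> = asc (\<lambda>X' Y' Z'. asci (\<lambda>x y z. asc (\<lambda>X Y Z. cop Z (\<lambda>Z1 Z2. asc (\<lambda>U V W. cop U (\<lambda>U1 U2.
      G (S (Z1 * V * x) * \<alpha> * (Z2 * W * y))
        (X' * (X * U1) * \<beta> * S (Y * U2) * S Y' * \<alpha> * (Z' * z))))))))"
    by (simp only: pentagon_ev[OF q3])
  also have "\<dots> = asc (\<lambda>X' Y' Z'. asci (\<lambda>x y z. asc (\<lambda>X Y Z. cop Z (\<lambda>Z1 Z2. asc (\<lambda>U V W. cop U (\<lambda>U1 U2.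
      G (S (V * x) * (S Z1 * \<alpha> * Z2) * (W * y))
        (X' * X * (U1 * \<beta> * S U2) * (S Y * S Y' * \<alpha> * (Z' * z)))))))))"
    by ((unfold mult_simps)?, (rule ev_reorder)+)
  also have "\<dots> = asc (\<lambda>X' Y' Z'. asci (\<lambda>x y z. G (S (1 * x) * \<alpha> * (1 * y))
        (X' * 1 * \<beta> * (S 1 * S Y' * \<alpha> * (Z' * z)))))"
    by (simp only: cop_beta[OF f5] asc_counit1[OF b5] cop_alpha[OF f6] asc_counit3[OF b6])
  also have "\<dots> = asci (\<lambda>x y z. asc (\<lambda>X' Y' Z'. G (S x * \<alpha> * y) (X' * \<beta> * S Y' * \<alpha> * Z' * z)))"
    by ((unfold mult_simps mult_1_left mult_1_right)?, (rule ev_reorder)+)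
  also have "\<dots> = asci (\<lambda>x y z. G (S x * \<alpha> * y) z)"
    by (simp only: asc_antipode[OF f7] mult_1_left)
  finally show ?thesis .
qed

section \<open>Casimir identities for right integrals\<close>

context
  fixes r :: 'h
  assumes r: "right_integral r"
begin

lemma int_absorb:
  assumes G: "bilin G"
  shows "cop r (\<lambda>r1 r2. cop a (\<lambda>a1 a2. G (r1 * a1) (r2 * a2))) = \<epsilon> a * cop r G"
  using cop_mult[OF G, of r a] r by (simp add: right_integral_def cop_linear)

text \<open>\<Delta>(r) absorbs a coproduct \<Delta>(a1) at the cost of \<epsilon>(a1). Thus
  \<Delta>(r) p_R (1 \<otimes> S(a)) equals \<Delta>(r) \<Delta>(a1) p_R (1 \<otimes> S(a2)), where
  \<open>p_cov\<close> applies. Both Casimir identities and the elimination of U rest on such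
  moves.\<close>

lemma int_move:
  assumes G: "bilin G"
  shows "cop r (\<lambda>r1 r2. ev2 p_R (\<lambda>p1 p2. G (r1 * p1 * a) (r2 * p2))) =
    cop r (\<lambda>r1 r2. ev2 p_R (\<lambda>p1 p2. G (r1 * p1) (r2 * p2 * S a)))"
proof -
  note GD = bilinD[OF G]
  have f: "(\<lambda>t. cop r (\<lambda>r1 r2. ev2 p_R (\<lambda>p1 p2. G (r1 * p1) (r2 * p2 * S t)))) \<in> dual" by (simp add: lin_defs multilinear GD)
  have b: "bilin (\<lambda>u v. ev2 p_R (\<lambda>p1 p2. G (u * p1) (v * p2 * S t)))" for t by (simp add: lin_defs multilinear GD)
  have b2: "bilin (\<lambda>u v. G (r1 * u) (r2 * v))" for r1 r2 by (simp add: lin_defs multilinear GD)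
  have "cop r (\<lambda>r1 r2. ev2 p_R (\<lambda>p1 p2. G (r1 * p1) (r2 * p2 * S a))) =
    cop a (\<lambda>a1 a2. \<epsilon> a1 * cop r (\<lambda>r1 r2. ev2 p_R (\<lambda>p1 p2. G (r1 * p1) (r2 * p2 * S a2))))"
    by (rule cop_counit_left[OF f, symmetric])
  also have "\<dots> = cop a (\<lambda>a1 a2. cop r (\<lambda>r1 r2. cop a1 (\<lambda>a11 a12. ev2 p_R (\<lambda>p1 p2. G (r1 * a11 * p1) (r2 * a12 * p2 * S a2)))))"
    by (simp only: int_absorb[OF b])
  also have "\<dots> = cop r (\<lambda>r1 r2. cop a (\<lambda>a1 a2. cop a1 (\<lambda>a11 a12. ev2 p_R (\<lambda>p1 p2. G (r1 * (a11 * p1)) (r2 * (a12 * p2 * S a2))))))"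
    by ((unfold mult_simps)?, (rule ev_reorder)+)
  also have "\<dots> = cop r (\<lambda>r1 r2. ev2 p_R (\<lambda>p1 p2. G (r1 * p1 * a) (r2 * p2)))"
    by (simp only: p_cov[OF b2], simp only: mult.assoc)
  finally show ?thesis by simp
qed

text \<open>\<alpha> is replaced by \<epsilon>(X) S(Y) \<alpha> Z; next to \<Delta>(r) the scalar
  \<epsilon>(X) may be traded for \<Delta>(X), and then \<open>q_p_cancel\<close> removes
  p_R.\<close>

lemma int_alpha:
  assumes G: "bilin G"
  shows "cop r (\<lambda>r1 r2. ev2 p_R (\<lambda>p1 p2. G (r1 * p1) (r2 * p2 * \<alpha>))) = cop r G"
proof -
  note GD = bilinD[OF G]
  have b: "bilin (\<lambda>Y Z. cop r (\<lambda>r1 r2. ev2 p_R (\<lambda>p1 p2. G (r1 * p1) (r2 * p2 * (S Y * \<alpha> * Z)))))" by (simp add: lin_defs multilinear GD)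
  have b2: "bilin (\<lambda>u v. ev2 p_R (\<lambda>p1 p2. G (u * p1) (v * p2 * (S Y * \<alpha> * Z))))" for Y Z by (simp add: lin_defs multilinear GD)
  have b3: "bilin (\<lambda>u v. G (r1 * u) (r2 * v))" for r1 r2 by (simp add: lin_defs multilinear GD)
  have "cop r (\<lambda>r1 r2. ev2 p_R (\<lambda>p1 p2. G (r1 * p1) (r2 * p2 * (S 1 * \<alpha> * 1)))) =
    asc (\<lambda>X Y Z. \<epsilon> X * cop r (\<lambda>r1 r2. ev2 p_R (\<lambda>p1 p2. G (r1 * p1) (r2 * p2 * (S Y * \<alpha> * Z)))))"
    by (rule asc_counit1[OF b, symmetric])
  also have "\<dots> = asc (\<lambda>X Y Z. cop r (\<lambda>r1 r2. cop X (\<lambda>X1 X2. ev2 p_R (\<lambda>p1 p2. G (r1 * X1 * p1) (r2 * X2 * p2 * (S Y * \<alpha> * Z))))))"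
    by (simp only: int_absorb[OF b2])
  also have "\<dots> = cop r (\<lambda>r1 r2. asc (\<lambda>X Y Z. cop X (\<lambda>X1 X2. ev2 p_R (\<lambda>p1 p2. G (r1 * (X1 * p1)) (r2 * (X2 * p2 * (S Y * \<alpha> * Z)))))))"
    by ((unfold mult_simps)?, (rule ev_reorder)+)
  also have "\<dots> = cop r G"
    by (simp only: q_p_cancel[OF b3] mult_1_right)
  finally show ?thesis by (simp add: antipode_one)
qed

text \<open>In tensors, \<Delta>(r) p_R (\<beta> \<otimes> 1) f = \<Delta>(r). Each antipode that f
  and \<gamma> put on the second leg returns to the first by \<open>int_move\<close> and meets
  \<beta> there. What remains is \<Delta>(r) p_R (1 \<otimes> \<alpha>) \<Delta>(\<beta>) =
  \<epsilon>(\<beta>) \<Delta>(r), and here the normalisation of \<beta> enters.\<close>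

lemma int_f:
  assumes G: "bilin G"
  shows "cop r (\<lambda>r1 r2. ev2 p_R (\<lambda>p1 p2. ev2 drinfeld_f (\<lambda>f1 f2. G (r1 * p1 * \<beta> * f1) (r2 * p2 * f2)))) = cop r G"
proof -
  note GD = bilinD[OF G]
  have b1: "bilin (\<lambda>f1 f2. G (u * \<beta> * f1) (v * f2))" for u v by (simp add: lin_defs multilinear GD)
  have b2: "bilin (\<lambda>u v. G (u * \<beta> * S x2 * g1 * c1) (v * g2 * c2))" for x2 g1 c1 g2 c2 by (simp add: lin_defs multilinear GD)
  have f1: "(\<lambda>t. cop r (\<lambda>r1 r2. ev2 p_R (\<lambda>p1 p2. ev2 gamma (\<lambda>g1 g2. cop c (\<lambda>c1 c2.
      G (r1 * p1 * t * g1 * c1) (r2 * p2 * g2 * c2)))))) \<in> dual" for c by (simp add: lin_defs multilinear GD)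
  have b3: "bilin (\<lambda>y z. cop r (\<lambda>r1 r2. ev2 p_R (\<lambda>p1 p2. ev2 gamma (\<lambda>g1 g2. cop (y * \<beta> * S z) (\<lambda>c1 c2.
      G (r1 * p1 * \<beta> * g1 * c1) (r2 * p2 * g2 * c2))))))" by (simp add: lin_defs multilinear GD)
  have b4: "bilin (\<lambda>g1 g2. cop \<beta> (\<lambda>c1 c2. G (r1 * p1 * \<beta> * g1 * c1) (r2 * p2 * g2 * c2)))" for r1 p1 r2 p2 by (simp add: lin_defs multilinear GD)
  have b5: "bilin (\<lambda>u v. G (u * \<beta> * S x2 * S Y * \<alpha> * Z * y * c1) (v * \<alpha> * z * c2))" for x2 Y Z y z c1 c2 by (simp add: lin_defs multilinear GD)
  have f2: "(\<lambda>t. asc (\<lambda>X Y Z. cop r (\<lambda>r1 r2. ev2 p_R (\<lambda>p1 p2. cop \<beta> (\<lambda>c1 c2.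
      G (r1 * p1 * X * t * S Y * \<alpha> * Z * y * c1) (r2 * p2 * \<alpha> * z * c2)))))) \<in> dual" for y z by (simp add: lin_defs multilinear GD)
  have b6: "bilin (\<lambda>y z. asc (\<lambda>X Y Z. cop r (\<lambda>r1 r2. ev2 p_R (\<lambda>p1 p2. cop \<beta> (\<lambda>c1 c2.
      G (r1 * p1 * X * \<beta> * S Y * \<alpha> * Z * y * c1) (r2 * p2 * \<alpha> * z * c2))))))" by (simp add: lin_defs multilinear GD)
  have f3: "(\<lambda>t. cop r (\<lambda>r1 r2. ev2 p_R (\<lambda>p1 p2. cop \<beta> (\<lambda>c1 c2. G (r1 * p1 * t * c1) (r2 * p2 * \<alpha> * c2))))) \<in> dual" by (simp add: lin_defs multilinear GD)
  have b7: "bilin (\<lambda>u v. cop \<beta> (\<lambda>c1 c2. G (u * c1) (v * c2)))" by (simp add: lin_defs multilinear GD)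
  have "cop r (\<lambda>r1 r2. ev2 p_R (\<lambda>p1 p2. ev2 drinfeld_f (\<lambda>f1 f2. G (r1 * p1 * \<beta> * f1) (r2 * p2 * f2)))) =
    cop r (\<lambda>r1 r2. ev2 p_R (\<lambda>p1 p2. asci (\<lambda>x y z. cop x (\<lambda>x1 x2. ev2 gamma (\<lambda>g1 g2. cop (y * \<beta> * S z) (\<lambda>c1 c2.
      G (r1 * p1 * \<beta> * (S x2 * g1 * c1)) (r2 * p2 * (S x1 * g2 * c2))))))))"
    by (simp only: f_props(2)[OF b1] gamma_form_def)
  also have "\<dots> = asci (\<lambda>x y z. cop x (\<lambda>x1 x2. ev2 gamma (\<lambda>g1 g2. cop (y * \<beta> * S z) (\<lambda>c1 c2.
      cop r (\<lambda>r1 r2. ev2 p_R (\<lambda>p1 p2. G (r1 * p1 * \<beta> * S x2 * g1 * c1) (r2 * p2 * S x1 * g2 * c2)))))))"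
    by ((unfold mult_simps)?, (rule ev_reorder)+)
  also have "\<dots> = asci (\<lambda>x y z. cop x (\<lambda>x1 x2. ev2 gamma (\<lambda>g1 g2. cop (y * \<beta> * S z) (\<lambda>c1 c2.
      cop r (\<lambda>r1 r2. ev2 p_R (\<lambda>p1 p2. G (r1 * p1 * x1 * \<beta> * S x2 * g1 * c1) (r2 * p2 * g2 * c2)))))))"
    by (simp only: int_move[OF b2])
  also have "\<dots> = asci (\<lambda>x y z. cop x (\<lambda>x1 x2. cop r (\<lambda>r1 r2. ev2 p_R (\<lambda>p1 p2. ev2 gamma (\<lambda>g1 g2. cop (y * \<beta> * S z) (\<lambda>c1 c2.
      G (r1 * p1 * (x1 * \<beta> * S x2) * g1 * c1) (r2 * p2 * g2 * c2)))))))"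
    by ((unfold mult_simps)?, (rule ev_reorder)+)
  also have "\<dots> = cop r (\<lambda>r1 r2. ev2 p_R (\<lambda>p1 p2. ev2 gamma (\<lambda>g1 g2. cop \<beta> (\<lambda>c1 c2.
      G (r1 * p1 * \<beta> * g1 * c1) (r2 * p2 * g2 * c2)))))"
    by (simp only: cop_beta[OF f1] asci_counit1[OF b3] antipode_one mult_1_left mult_1_right)
  also have "\<dots> = cop r (\<lambda>r1 r2. ev2 p_R (\<lambda>p1 p2. asc (\<lambda>X Y Z. asci (\<lambda>x y z. cop x (\<lambda>x1 x2. cop \<beta> (\<lambda>c1 c2.
      G (r1 * p1 * \<beta> * (S (Y * x2) * \<alpha> * (Z * y)) * c1) (r2 * p2 * (S (X * x1) * \<alpha> * z) * c2)))))))"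
    by (simp only: gamma_alt[OF b4])
  also have "\<dots> = asc (\<lambda>X Y Z. asci (\<lambda>x y z. cop x (\<lambda>x1 x2. cop \<beta> (\<lambda>c1 c2. cop r (\<lambda>r1 r2. ev2 p_R (\<lambda>p1 p2.
      G (r1 * p1 * \<beta> * S x2 * S Y * \<alpha> * Z * y * c1) (r2 * p2 * S (X * x1) * \<alpha> * z * c2)))))))"
    by ((unfold mult_simps)?, (rule ev_reorder)+)
  also have "\<dots> = asc (\<lambda>X Y Z. asci (\<lambda>x y z. cop x (\<lambda>x1 x2. cop \<beta> (\<lambda>c1 c2. cop r (\<lambda>r1 r2. ev2 p_R (\<lambda>p1 p2.
      G (r1 * p1 * (X * x1) * \<beta> * S x2 * S Y * \<alpha> * Z * y * c1) (r2 * p2 * \<alpha> * z * c2)))))))"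
    by (simp only: int_move[OF b5])
  also have "\<dots> = asci (\<lambda>x y z. cop x (\<lambda>x1 x2. asc (\<lambda>X Y Z. cop r (\<lambda>r1 r2. ev2 p_R (\<lambda>p1 p2. cop \<beta> (\<lambda>c1 c2.
      G (r1 * p1 * X * (x1 * \<beta> * S x2) * S Y * \<alpha> * Z * y * c1) (r2 * p2 * \<alpha> * z * c2)))))))"
    by ((unfold mult_simps)?, (rule ev_reorder)+)
  also have "\<dots> = asc (\<lambda>X Y Z. cop r (\<lambda>r1 r2. ev2 p_R (\<lambda>p1 p2. cop \<beta> (\<lambda>c1 c2.
      G (r1 * p1 * (X * \<beta> * S Y * \<alpha> * Z) * c1) (r2 * p2 * \<alpha> * c2)))))"
    by (simp only: cop_beta[OF f2] asci_counit1[OF b6], simp only: mult_1_right mult.assoc)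
  also have "\<dots> = cop r (\<lambda>r1 r2. ev2 p_R (\<lambda>p1 p2. cop \<beta> (\<lambda>c1 c2. G (r1 * p1 * c1) (r2 * p2 * \<alpha> * c2))))"
    by (simp only: asc_antipode[OF f3] mult_1_right)
  also have "\<dots> = cop r (\<lambda>r1 r2. cop \<beta> (\<lambda>c1 c2. G (r1 * c1) (r2 * c2)))"
    by (rule int_alpha[OF b7])
  also have "\<dots> = cop r G" by (simp only: int_absorb[OF G] counit_beta mult_1_left)
  finally show ?thesis .
qed

lemma int_f_inv:
  assumes G: "bilin G"
  shows "cop r (\<lambda>r1 r2. ev2 f_inv (\<lambda>g1 g2. G (r1 * g1) (r2 * g2))) =
    cop r (\<lambda>r1 r2. ev2 p_R (\<lambda>p1 p2. G (r1 * p1 * \<beta>) (r2 * p2)))"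
proof -
  note GD = bilinD[OF G]
  have b1: "bilin (\<lambda>u v. ev2 f_inv (\<lambda>g1 g2. G (u * g1) (v * g2)))" by (simp add: lin_defs multilinear GD)
  have b2: "bilin (\<lambda>u v. G (r1 * p1 * \<beta> * u) (r2 * p2 * v))" for r1 p1 r2 p2 by (simp add: lin_defs multilinear GD)
  have "cop r (\<lambda>r1 r2. ev2 f_inv (\<lambda>g1 g2. G (r1 * g1) (r2 * g2))) =
    cop r (\<lambda>r1 r2. ev2 p_R (\<lambda>p1 p2. ev2 drinfeld_f (\<lambda>f1 f2. ev2 f_inv (\<lambda>g1 g2.
      G (r1 * p1 * \<beta> * f1 * g1) (r2 * p2 * f2 * g2)))))"
    by (rule int_f[OF b1, symmetric])
  also have "\<dots> = cop r (\<lambda>r1 r2. ev2 p_R (\<lambda>p1 p2. ev2 drinfeld_f (\<lambda>f1 f2. ev2 f_inv (\<lambda>g1 g2.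
      G (r1 * p1 * \<beta> * (f1 * g1)) (r2 * p2 * (f2 * g2))))))"
    by (simp only: mult.assoc)
  also have "\<dots> = cop r (\<lambda>r1 r2. ev2 p_R (\<lambda>p1 p2. G (r1 * p1 * \<beta>) (r2 * p2)))"
    by (simp only: f_f_inv[OF b2] mult_1_right)
  finally show ?thesis .
qed

text \<open>By \<open>int_f_inv\<close> the left side is \<Delta>(r) p_R (\<beta> S(Y) \<alpha> Z
  \<otimes> S(X)). Moving S(X) to the first leg completes X \<beta> S(Y) \<alpha> Z = 1.\<close>

lemma int_U:
  assumes G: "bilin G"
  shows "cop r (\<lambda>r1 r2. ev2 tensor_U (\<lambda>u1 u2. G (r1 * u1) (r2 * u2))) =
    cop r (\<lambda>r1 r2. ev2 p_R (\<lambda>p1 p2. G (r1 * p1) (r2 * p2)))"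
proof -
  note GD = bilinD[OF G]
  have b1: "bilin (\<lambda>u1 u2. G (r1 * u1) (r2 * u2))" for r1 r2 by (simp add: lin_defs multilinear GD)
  have b2: "bilin (\<lambda>u v. asc (\<lambda>X Y Z. G (u * (S Y * \<alpha> * Z)) (v * S X)))" by (simp add: lin_defs multilinear GD)
  have b3: "bilin (\<lambda>u v. G (u * \<beta> * (S Y * \<alpha> * Z)) v)" for Y Z by (simp add: lin_defs multilinear GD)
  have f: "(\<lambda>t. cop r (\<lambda>r1 r2. ev2 p_R (\<lambda>p1 p2. G (r1 * p1 * t) (r2 * p2)))) \<in> dual" by (simp add: lin_defs multilinear GD)
  have "cop r (\<lambda>r1 r2. ev2 tensor_U (\<lambda>u1 u2. G (r1 * u1) (r2 * u2))) =
    cop r (\<lambda>r1 r2. ev2 f_inv (\<lambda>g1 g2. asc (\<lambda>X Y Z. G (r1 * g1 * (S Y * \<alpha> * Z)) (r2 * g2 * S X))))"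
    by (simp only: U_props(2)[OF b1], simp only: mult.assoc)
  also have "\<dots> = cop r (\<lambda>r1 r2. ev2 p_R (\<lambda>p1 p2. asc (\<lambda>X Y Z. G (r1 * p1 * \<beta> * (S Y * \<alpha> * Z)) (r2 * p2 * S X))))"
    by (rule int_f_inv[OF b2])
  also have "\<dots> = asc (\<lambda>X Y Z. cop r (\<lambda>r1 r2. ev2 p_R (\<lambda>p1 p2. G (r1 * p1 * \<beta> * (S Y * \<alpha> * Z)) (r2 * p2 * S X))))"
    by (rule ev_reorder)+
  also have "\<dots> = asc (\<lambda>X Y Z. cop r (\<lambda>r1 r2. ev2 p_R (\<lambda>p1 p2. G (r1 * p1 * (X * \<beta> * S Y * \<alpha> * Z)) (r2 * p2))))"
    by (simp only: int_move[OF b3, symmetric], simp only: mult.assoc)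
  also have "\<dots> = cop r (\<lambda>r1 r2. ev2 p_R (\<lambda>p1 p2. G (r1 * p1) (r2 * p2)))"
    by (simp only: asc_antipode[OF f] mult_1_right)
  finally show ?thesis .
qed

end

context
  fixes r :: 'h
  assumes r: "right_integral r"
begin

section \<open>The coproduct of the second leg of \<Delta>(r) p_R\<close>

text \<open>In tensors, (id \<otimes> \<Delta>)(\<Delta>(r) p_R) = \<phi> (\<Delta> \<otimes>
  id)(\<Delta>(r) p_R) (p_R \<otimes> 1) (1 \<otimes> f). The calculation starts from the right:
  antipodes produced by f on the third leg are pulled back by \<open>int_move\<close>,
  \<open>p_cov\<close> and \<open>q_p_cancel\<close> remove the inner p_R, \<open>int_alpha\<close>
  the outer one, and \<open>coassoc\<close> moves \<phi> across.\<close>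

lemma int_coprod:
  assumes G: "trilin G"
  shows "cop r (\<lambda>r1 r2. ev2 p_R (\<lambda>p1 p2. cop (r2 * p2) (\<lambda>e1 e2. G (r1 * p1) e1 e2))) =
    asc (\<lambda>X Y Z. cop r (\<lambda>r1 r2. ev2 p_R (\<lambda>p1 p2. cop (r1 * p1) (\<lambda>d1 d2. ev2 p_R (\<lambda>q1 q2. ev2 drinfeld_f (\<lambda>f1 f2.
      G (X * d1 * q1) (Y * d2 * q2 * f1) (Z * r2 * p2 * f2)))))))"
proof -
  note GD = trilinD[OF G]
  have b0: "bilin (\<lambda>f1 f2. G u (v * f1) (w * f2))" for u v w by (simp add: lin_defs multilinear GD)
  have b1: "bilin (\<lambda>u v. cop u (\<lambda>d1 d2. ev2 p_R (\<lambda>q1 q2. G (X * d1 * q1) (Y * d2 * q2 * S x2 * g1 * c1) (Z * v * g2 * c2))))"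
    for X Y Z x2 g1 g2 c1 c2 by (simp add: lin_defs multilinear GD)
  have b1': "bilin (\<lambda>d1 d2. ev2 p_R (\<lambda>q1 q2. G (X * d1 * q1) (Y * d2 * q2 * S x2 * g1 * c1) w))"
    for X Y x2 g1 c1 w by (simp add: lin_defs multilinear GD)
  have b2: "bilin (\<lambda>u v. G (X * d1 * u) (Y * d2 * v * g1 * c1) w)" for X d1 Y d2 g1 c1 w by (simp add: lin_defs multilinear GD)
  have b3: "bilin (\<lambda>g1 g2. G u (v * g1 * c1) (w * g2 * c2))" for u v w c1 c2 by (simp add: lin_defs multilinear GD)
  have b4: "bilin (\<lambda>u v. cop u (\<lambda>d1 d2. ev2 p_R (\<lambda>q1 q2. G (X * d1 * (q1 * x)) (Y * d2 * q2 * S x2' * w1 * c1) (Z * v * \<alpha> * z' * c2))))"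
    for X x Y x2' w1 c1 Z z' c2 by (simp add: lin_defs multilinear GD)
  have b5: "bilin (\<lambda>d1 d2. ev2 p_R (\<lambda>q1 q2. G (X * d1 * (q1 * x)) (Y * d2 * q2 * S x2' * w1 * c1) w))"
    "bilin (\<lambda>d1 d2. cop v (\<lambda>v1 v2. ev2 p_R (\<lambda>q1 q2. G (X * (d1 * v1) * (q1 * x)) (Y * (d2 * v2) * q2 * S x2' * w1 * c1) w)))"
    for X x Y x2' w1 c1 w v by (simp add: lin_defs multilinear GD)+
  have K5: "cop (p * (X' * x1')) (\<lambda>d1 d2. ev2 p_R (\<lambda>q1 q2. G (X * d1 * (q1 * x)) (Y * d2 * q2 * S x2' * w1 * c1) w)) =
    cop p (\<lambda>d1 d2. cop X' (\<lambda>X1 X2. cop x1' (\<lambda>x11 x12. ev2 p_R (\<lambda>q1 q2.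
      G (X * (d1 * X1 * x11) * (q1 * x)) (Y * (d2 * X2 * x12) * q2 * S x2' * w1 * c1) w))))"
    for p X' x1' X x Y x2' w1 c1 w
    by (simp only: mult.assoc[of p X' x1', symmetric] cop_mult[OF b5(1)], simp only: cop_mult[OF b5(2)])
  have b6: "bilin (\<lambda>u v. G (X * d1 * X1 * u * x) (Y * d2 * X2 * v * w1 * c1) w)" for X d1 X1 x Y d2 X2 w1 c1 w by (simp add: lin_defs multilinear GD)
  have b7: "bilin (\<lambda>u v. G (X * d1 * u * x' * x) (Y * d2 * v * y' * c1) w)" for X d1 x' x Y d2 y' c1 w by (simp add: lin_defs multilinear GD)
  have b8: "bilin (\<lambda>u v. cop u (\<lambda>d1 d2. G (X * d1 * (x' * x)) (Y * d2 * (y' * c1)) (Z * v * (z' * c2))))"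
    for X x' x Y y' c1 Z z' c2 by (simp add: lin_defs multilinear GD)
  have t1: "trilin (\<lambda>u v w. G (u * (x' * x)) (v * (y' * c1)) (w * (z' * c2)))" for x' x y' c1 z' c2 by (simp add: lin_defs multilinear GD)
  have t2: "trilin (\<lambda>u v w. G (r1 * u * x) (r21 * v * c1) (r22 * w * c2))" for r1 r21 r22 x c1 c2 by (simp add: lin_defs multilinear GD)
  have b9: "bilin (\<lambda>e1 e2. G u e1 e2)" for u by (simp add: lin_defs multilinear GD)
  have b10: "bilin (\<lambda>p1 p2. cop (r2 * p2) (\<lambda>e1 e2. G (r1 * p1) e1 e2))" for r1 r2 by (simp add: lin_defs multilinear GD)
  have "asc (\<lambda>X Y Z. cop r (\<lambda>r1 r2. ev2 p_R (\<lambda>p1 p2. cop (r1 * p1) (\<lambda>d1 d2. ev2 p_R (\<lambda>q1 q2. ev2 drinfeld_f (\<lambda>f1 f2.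
      G (X * d1 * q1) (Y * d2 * q2 * f1) (Z * r2 * p2 * f2))))))) =
    asc (\<lambda>X Y Z. cop r (\<lambda>r1 r2. ev2 p_R (\<lambda>p1 p2. cop (r1 * p1) (\<lambda>d1 d2. ev2 p_R (\<lambda>q1 q2.
      asci (\<lambda>x y z. cop x (\<lambda>x1 x2. ev2 gamma (\<lambda>g1 g2. cop (y * \<beta> * S z) (\<lambda>c1 c2.
      G (X * d1 * q1) (Y * d2 * q2 * (S x2 * g1 * c1)) (Z * r2 * p2 * (S x1 * g2 * c2)))))))))))"
    by (simp only: f_props(2)[OF b0] gamma_form_def)
  also have "\<dots> = asc (\<lambda>X Y Z. asci (\<lambda>x y z. cop x (\<lambda>x1 x2. ev2 gamma (\<lambda>g1 g2. cop (y * \<beta> * S z) (\<lambda>c1 c2.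
      cop r (\<lambda>r1 r2. ev2 p_R (\<lambda>p1 p2. cop (r1 * p1) (\<lambda>d1 d2. ev2 p_R (\<lambda>q1 q2.
      G (X * d1 * q1) (Y * d2 * q2 * S x2 * g1 * c1) (Z * (r2 * p2 * S x1) * g2 * c2))))))))))"
    by ((unfold mult_simps)?, (rule ev_reorder)+)
  also have "\<dots> = asc (\<lambda>X Y Z. asci (\<lambda>x y z. cop x (\<lambda>x1 x2. ev2 gamma (\<lambda>g1 g2. cop (y * \<beta> * S z) (\<lambda>c1 c2.
      cop r (\<lambda>r1 r2. ev2 p_R (\<lambda>p1 p2. cop (r1 * p1 * x1) (\<lambda>d1 d2. ev2 p_R (\<lambda>q1 q2.
      G (X * d1 * q1) (Y * d2 * q2 * S x2 * g1 * c1) (Z * (r2 * p2) * g2 * c2))))))))))"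
    by (simp only: int_move[OF r b1])
  also have "\<dots> = asc (\<lambda>X Y Z. asci (\<lambda>x y z. cop x (\<lambda>x1 x2. ev2 gamma (\<lambda>g1 g2. cop (y * \<beta> * S z) (\<lambda>c1 c2.
      cop r (\<lambda>r1 r2. ev2 p_R (\<lambda>p1 p2. cop (r1 * p1) (\<lambda>d1 d2. cop x1 (\<lambda>x11 x12. ev2 p_R (\<lambda>q1 q2.
      G (X * (d1 * x11) * q1) (Y * (d2 * x12) * q2 * S x2 * g1 * c1) (Z * (r2 * p2) * g2 * c2)))))))))))"
    by (simp only: cop_mult[OF b1'])
  also have "\<dots> = asc (\<lambda>X Y Z. asci (\<lambda>x y z. ev2 gamma (\<lambda>g1 g2. cop (y * \<beta> * S z) (\<lambda>c1 c2.
      cop r (\<lambda>r1 r2. ev2 p_R (\<lambda>p1 p2. cop (r1 * p1) (\<lambda>d1 d2. cop x (\<lambda>x1 x2. cop x1 (\<lambda>x11 x12. ev2 p_R (\<lambda>q1 q2.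
      G (X * d1 * (x11 * q1)) (Y * d2 * (x12 * q2 * S x2) * g1 * c1) (Z * (r2 * p2) * g2 * c2)))))))))))"
    by ((unfold mult_simps)?, (rule ev_reorder)+)
  also have "\<dots> = asc (\<lambda>X Y Z. asci (\<lambda>x y z. ev2 gamma (\<lambda>g1 g2. cop (y * \<beta> * S z) (\<lambda>c1 c2.
      cop r (\<lambda>r1 r2. ev2 p_R (\<lambda>p1 p2. cop (r1 * p1) (\<lambda>d1 d2. ev2 p_R (\<lambda>q1 q2.
      G (X * d1 * (q1 * x)) (Y * d2 * q2 * g1 * c1) (Z * (r2 * p2) * g2 * c2)))))))))"
    by (simp only: p_cov[OF b2])
  also have "\<dots> = asc (\<lambda>X Y Z. asci (\<lambda>x y z. cop (y * \<beta> * S z) (\<lambda>c1 c2.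
      cop r (\<lambda>r1 r2. ev2 p_R (\<lambda>p1 p2. cop (r1 * p1) (\<lambda>d1 d2. ev2 p_R (\<lambda>q1 q2. ev2 gamma (\<lambda>g1 g2.
      G (X * d1 * (q1 * x)) (Y * d2 * q2 * g1 * c1) (Z * (r2 * p2) * g2 * c2)))))))))"
    by (rule ev_reorder)+
  also have "\<dots> = asc (\<lambda>X Y Z. asci (\<lambda>x y z. cop (y * \<beta> * S z) (\<lambda>c1 c2.
      cop r (\<lambda>r1 r2. ev2 p_R (\<lambda>p1 p2. cop (r1 * p1) (\<lambda>d1 d2. ev2 p_R (\<lambda>q1 q2.
      asc (\<lambda>X' Y' Z'. asci (\<lambda>x' y' z'. cop x' (\<lambda>x1' x2'.
      G (X * d1 * (q1 * x)) (Y * d2 * q2 * (S (Y' * x2') * \<alpha> * (Z' * y')) * c1) (Z * (r2 * p2) * (S (X' * x1') * \<alpha> * z') * c2)))))))))))"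
    by (simp only: gamma_alt[OF b3])
  also have "\<dots> = asc (\<lambda>X Y Z. asci (\<lambda>x y z. asc (\<lambda>X' Y' Z'. asci (\<lambda>x' y' z'. cop x' (\<lambda>x1' x2'. cop (y * \<beta> * S z) (\<lambda>c1 c2.
      cop r (\<lambda>r1 r2. ev2 p_R (\<lambda>p1 p2. cop (r1 * p1) (\<lambda>d1 d2. ev2 p_R (\<lambda>q1 q2.
      G (X * d1 * (q1 * x)) (Y * d2 * q2 * S x2' * (S Y' * \<alpha> * (Z' * y')) * c1) (Z * (r2 * p2 * S (X' * x1')) * \<alpha> * z' * c2)))))))))))"
    by ((unfold mult_simps)?, (rule ev_reorder)+)
  also have "\<dots> = asc (\<lambda>X Y Z. asci (\<lambda>x y z. asc (\<lambda>X' Y' Z'. asci (\<lambda>x' y' z'. cop x' (\<lambda>x1' x2'. cop (y * \<beta> * S z) (\<lambda>c1 c2.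
      cop r (\<lambda>r1 r2. ev2 p_R (\<lambda>p1 p2. cop (r1 * p1 * (X' * x1')) (\<lambda>d1 d2. ev2 p_R (\<lambda>q1 q2.
      G (X * d1 * (q1 * x)) (Y * d2 * q2 * S x2' * (S Y' * \<alpha> * (Z' * y')) * c1) (Z * (r2 * p2) * \<alpha> * z' * c2)))))))))))"
    by (simp only: int_move[OF r b4])
  also have "\<dots> = asc (\<lambda>X Y Z. asci (\<lambda>x y z. asc (\<lambda>X' Y' Z'. asci (\<lambda>x' y' z'. cop x' (\<lambda>x1' x2'. cop (y * \<beta> * S z) (\<lambda>c1 c2.
      cop r (\<lambda>r1 r2. ev2 p_R (\<lambda>p1 p2. cop (r1 * p1) (\<lambda>d1 d2. cop X' (\<lambda>X1 X2. cop x1' (\<lambda>x11 x12. ev2 p_R (\<lambda>q1 q2.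
      G (X * (d1 * X1 * x11) * (q1 * x)) (Y * (d2 * X2 * x12) * q2 * S x2' * (S Y' * \<alpha> * (Z' * y')) * c1) (Z * (r2 * p2) * \<alpha> * z' * c2)))))))))))))"
    by (simp only: K5)
  also have "\<dots> = asc (\<lambda>X Y Z. asci (\<lambda>x y z. asc (\<lambda>X' Y' Z'. asci (\<lambda>x' y' z'. cop (y * \<beta> * S z) (\<lambda>c1 c2.
      cop r (\<lambda>r1 r2. ev2 p_R (\<lambda>p1 p2. cop (r1 * p1) (\<lambda>d1 d2. cop X' (\<lambda>X1 X2. cop x' (\<lambda>x1' x2'. cop x1' (\<lambda>x11 x12. ev2 p_R (\<lambda>q1 q2.
      G (X * d1 * X1 * (x11 * q1) * x) (Y * d2 * X2 * (x12 * q2 * S x2') * (S Y' * \<alpha> * (Z' * y')) * c1) (Z * (r2 * p2) * \<alpha> * z' * c2)))))))))))))"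
    by ((unfold mult_simps)?, (rule ev_reorder)+)
  also have "\<dots> = asc (\<lambda>X Y Z. asci (\<lambda>x y z. asc (\<lambda>X' Y' Z'. asci (\<lambda>x' y' z'. cop (y * \<beta> * S z) (\<lambda>c1 c2.
      cop r (\<lambda>r1 r2. ev2 p_R (\<lambda>p1 p2. cop (r1 * p1) (\<lambda>d1 d2. cop X' (\<lambda>X1 X2. ev2 p_R (\<lambda>q1 q2.
      G (X * d1 * X1 * (q1 * x') * x) (Y * d2 * X2 * q2 * (S Y' * \<alpha> * (Z' * y')) * c1) (Z * (r2 * p2) * \<alpha> * z' * c2)))))))))))"
    by (simp only: p_cov[OF b6])
  also have "\<dots> = asc (\<lambda>X Y Z. asci (\<lambda>x y z. asci (\<lambda>x' y' z'. cop (y * \<beta> * S z) (\<lambda>c1 c2.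
      cop r (\<lambda>r1 r2. ev2 p_R (\<lambda>p1 p2. cop (r1 * p1) (\<lambda>d1 d2. asc (\<lambda>X' Y' Z'. cop X' (\<lambda>X1 X2. ev2 p_R (\<lambda>q1 q2.
      G (X * d1 * (X1 * q1) * x' * x) (Y * d2 * (X2 * q2 * (S Y' * \<alpha> * Z')) * y' * c1) (Z * (r2 * p2) * \<alpha> * z' * c2)))))))))))"
    by ((unfold mult_simps)?, (rule ev_reorder)+)
  also have "\<dots> = asc (\<lambda>X Y Z. asci (\<lambda>x y z. asci (\<lambda>x' y' z'. cop (y * \<beta> * S z) (\<lambda>c1 c2.
      cop r (\<lambda>r1 r2. ev2 p_R (\<lambda>p1 p2. cop (r1 * p1) (\<lambda>d1 d2.
      G (X * d1 * 1 * x' * x) (Y * d2 * 1 * y' * c1) (Z * (r2 * p2) * \<alpha> * z' * c2))))))))"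
    by (simp only: q_p_cancel[OF b7])
  also have "\<dots> = asc (\<lambda>X Y Z. asci (\<lambda>x y z. asci (\<lambda>x' y' z'. cop (y * \<beta> * S z) (\<lambda>c1 c2.
      cop r (\<lambda>r1 r2. ev2 p_R (\<lambda>p1 p2. cop (r1 * p1) (\<lambda>d1 d2.
      G (X * d1 * (x' * x)) (Y * d2 * (y' * c1)) (Z * (r2 * p2 * \<alpha>) * (z' * c2)))))))))"
    by (simp only: mult.assoc mult_1_left)
  also have "\<dots> = asc (\<lambda>X Y Z. asci (\<lambda>x y z. asci (\<lambda>x' y' z'. cop (y * \<beta> * S z) (\<lambda>c1 c2.
      cop r (\<lambda>r1 r2. cop r1 (\<lambda>d1 d2.
      G (X * d1 * (x' * x)) (Y * d2 * (y' * c1)) (Z * r2 * (z' * c2))))))))"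
    by (simp only: int_alpha[OF r b8])
  also have "\<dots> = asci (\<lambda>x y z. asci (\<lambda>x' y' z'. cop (y * \<beta> * S z) (\<lambda>c1 c2. asc (\<lambda>X Y Z.
      cop r (\<lambda>r1 r2. cop r1 (\<lambda>r11 r12.
      G (X * r11 * (x' * x)) (Y * r12 * (y' * c1)) (Z * r2 * (z' * c2))))))))"
    by (rule ev_reorder)+
  also have "\<dots> = asci (\<lambda>x y z. asci (\<lambda>x' y' z'. cop (y * \<beta> * S z) (\<lambda>c1 c2.
      cop r (\<lambda>r1 r2. cop r2 (\<lambda>r21 r22. asc (\<lambda>X Y Z.
      G (r1 * X * (x' * x)) (r21 * Y * (y' * c1)) (r22 * Z * (z' * c2))))))))"
    by (simp only: coassoc[OF t1])
  \<comment> \<open>Two inverse reassociators are left: the one from \<gamma> cancels \<phi>, the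
    one from f is the contraction defining p_R.\<close>
  also have "\<dots> = asci (\<lambda>x y z. cop (y * \<beta> * S z) (\<lambda>c1 c2.
      cop r (\<lambda>r1 r2. cop r2 (\<lambda>r21 r22. asc (\<lambda>X Y Z. asci (\<lambda>x' y' z'.
      G (r1 * (X * x') * x) (r21 * (Y * y') * c1) (r22 * (Z * z') * c2)))))))"
    by ((unfold mult_simps)?, (rule ev_reorder)+)
  also have "\<dots> = asci (\<lambda>x y z. cop (y * \<beta> * S z) (\<lambda>c1 c2.
      cop r (\<lambda>r1 r2. cop r2 (\<lambda>r21 r22. G (r1 * x) (r21 * c1) (r22 * c2)))))"
    by (simp only: asc_asci[OF t2] mult_1_right)
  also have "\<dots> = cop r (\<lambda>r1 r2. asci (\<lambda>x y z. cop r2 (\<lambda>r21 r22. cop (y * \<beta> * S z) (\<lambda>c1 c2.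
      G (r1 * x) (r21 * c1) (r22 * c2)))))"
    by (rule ev_reorder)+
  also have "\<dots> = cop r (\<lambda>r1 r2. ev2 p_R (\<lambda>p1 p2. cop (r2 * p2) (\<lambda>e1 e2. G (r1 * p1) e1 e2)))"
    by (simp only: p_props(2)[OF b10] cop_mult[OF b9, of _ "_ * _ * S _"])
  finally show ?thesis by simp
qed

text \<open>Multiplying \<open>int_coprod\<close> by 1 \<otimes> U cancels f against f^-1; the q_R
  inside U then removes the additional p_R by \<open>q_p_cancel\<close>. In this form the coproduct
  of the second leg can be used inside E(\<lambda>).\<close>

lemma int_coprod_U:
  assumes G: "trilin G"
  shows "cop r (\<lambda>r1 r2. ev2 p_R (\<lambda>p1 p2. cop (r2 * p2) (\<lambda>e1 e2. ev2 tensor_U (\<lambda>u1 u2.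
      G (r1 * p1) (e1 * u1) (e2 * u2))))) =
    asc (\<lambda>X Y Z. cop r (\<lambda>r1 r2. ev2 p_R (\<lambda>p1 p2. cop (r1 * p1) (\<lambda>d1 d2. G (X * d1) (Y * d2) (Z * (r2 * p2))))))"
proof -
  note GD = trilinD[OF G]
  have b0: "bilin (\<lambda>u1 u2. G u (v * u1) (w * u2))" for u v w by (simp add: lin_defs multilinear GD)
  have t0: "trilin (\<lambda>u v w. ev2 f_inv (\<lambda>g1 g2. asc (\<lambda>X Y Z. G u (v * (g1 * (S Y * \<alpha> * Z))) (w * (g2 * S X)))))" by (simp add: lin_defs multilinear GD)
  have b1: "bilin (\<lambda>f1 f2. G u (v * f1 * w) (v' * f2 * w'))" for u v w v' w' by (simp add: lin_defs multilinear GD)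
  have b2: "bilin (\<lambda>u v. cop u (\<lambda>d1 d2. ev2 p_R (\<lambda>q1 q2. G (X * d1 * q1) (Y * d2 * q2 * w) (Z * v))))" for X Y w Z by (simp add: lin_defs multilinear GD)
  have b3: "bilin (\<lambda>d1 d2. ev2 p_R (\<lambda>q1 q2. G (X * d1 * q1) (Y * d2 * q2 * w) w'))" for X Y w w' by (simp add: lin_defs multilinear GD)
  have b4: "bilin (\<lambda>u v. G (X * d1 * u) (Y * d2 * v) w)" for X d1 Y d2 w by (simp add: lin_defs multilinear GD)
  have "cop r (\<lambda>r1 r2. ev2 p_R (\<lambda>p1 p2. cop (r2 * p2) (\<lambda>e1 e2. ev2 tensor_U (\<lambda>u1 u2.
      G (r1 * p1) (e1 * u1) (e2 * u2))))) =
    cop r (\<lambda>r1 r2. ev2 p_R (\<lambda>p1 p2. cop (r2 * p2) (\<lambda>e1 e2. ev2 f_inv (\<lambda>g1 g2. asc (\<lambda>X Y Z.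
      G (r1 * p1) (e1 * (g1 * (S Y * \<alpha> * Z))) (e2 * (g2 * S X)))))))"
    by (simp only: U_props(2)[OF b0])
  also have "\<dots> = asc (\<lambda>X Y Z. cop r (\<lambda>r1 r2. ev2 p_R (\<lambda>p1 p2. cop (r1 * p1) (\<lambda>d1 d2. ev2 p_R (\<lambda>q1 q2. ev2 drinfeld_f (\<lambda>f1 f2.
      ev2 f_inv (\<lambda>g1 g2. asc (\<lambda>X' Y' Z'.
      G (X * d1 * q1) (Y * d2 * q2 * f1 * (g1 * (S Y' * \<alpha> * Z'))) (Z * r2 * p2 * f2 * (g2 * S X'))))))))))"
    by (rule int_coprod[OF t0])
  also have "\<dots> = asc (\<lambda>X Y Z. asc (\<lambda>X' Y' Z'. cop r (\<lambda>r1 r2. ev2 p_R (\<lambda>p1 p2. cop (r1 * p1) (\<lambda>d1 d2. ev2 p_R (\<lambda>q1 q2.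
      ev2 drinfeld_f (\<lambda>f1 f2. ev2 f_inv (\<lambda>g1 g2.
      G (X * d1 * q1) (Y * d2 * q2 * (f1 * g1) * (S Y' * \<alpha> * Z')) (Z * r2 * p2 * (f2 * g2) * S X')))))))))"
    by ((unfold mult_simps)?, (rule ev_reorder)+)
  also have "\<dots> = asc (\<lambda>X Y Z. asc (\<lambda>X' Y' Z'. cop r (\<lambda>r1 r2. ev2 p_R (\<lambda>p1 p2. cop (r1 * p1) (\<lambda>d1 d2. ev2 p_R (\<lambda>q1 q2.
      G (X * d1 * q1) (Y * d2 * q2 * 1 * (S Y' * \<alpha> * Z')) (Z * r2 * p2 * 1 * S X')))))))"
    by (simp only: f_f_inv[OF b1])
  also have "\<dots> = asc (\<lambda>X Y Z. asc (\<lambda>X' Y' Z'. cop r (\<lambda>r1 r2. ev2 p_R (\<lambda>p1 p2. cop (r1 * p1) (\<lambda>d1 d2. ev2 p_R (\<lambda>q1 q2.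
      G (X * d1 * q1) (Y * d2 * q2 * (S Y' * \<alpha> * Z')) (Z * (r2 * p2 * S X'))))))))"
    by (simp only: mult.assoc mult_1_left)
  also have "\<dots> = asc (\<lambda>X Y Z. asc (\<lambda>X' Y' Z'. cop r (\<lambda>r1 r2. ev2 p_R (\<lambda>p1 p2. cop (r1 * p1 * X') (\<lambda>d1 d2. ev2 p_R (\<lambda>q1 q2.
      G (X * d1 * q1) (Y * d2 * q2 * (S Y' * \<alpha> * Z')) (Z * (r2 * p2))))))))"
    by (simp only: int_move[OF r b2])
  also have "\<dots> = asc (\<lambda>X Y Z. asc (\<lambda>X' Y' Z'. cop r (\<lambda>r1 r2. ev2 p_R (\<lambda>p1 p2. cop (r1 * p1) (\<lambda>d1 d2. cop X' (\<lambda>X1 X2. ev2 p_R (\<lambda>q1 q2.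
      G (X * (d1 * X1) * q1) (Y * (d2 * X2) * q2 * (S Y' * \<alpha> * Z')) (Z * (r2 * p2)))))))))"
    by (simp only: cop_mult[OF b3])
  also have "\<dots> = asc (\<lambda>X Y Z. cop r (\<lambda>r1 r2. ev2 p_R (\<lambda>p1 p2. cop (r1 * p1) (\<lambda>d1 d2. asc (\<lambda>X' Y' Z'. cop X' (\<lambda>X1 X2. ev2 p_R (\<lambda>q1 q2.
      G (X * d1 * (X1 * q1)) (Y * d2 * (X2 * q2 * (S Y' * \<alpha> * Z'))) (Z * (r2 * p2)))))))))"
    by ((unfold mult_simps)?, (rule ev_reorder)+)
  also have "\<dots> = asc (\<lambda>X Y Z. cop r (\<lambda>r1 r2. ev2 p_R (\<lambda>p1 p2. cop (r1 * p1) (\<lambda>d1 d2. G (X * d1) (Y * d2) (Z * (r2 * p2))))))"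
    by (simp only: q_p_cancel[OF b4] mult_1_right)
  finally show ?thesis .
qed

section \<open>Moving elements between the legs of the twisted coproduct\<close>

lemma int_comult_bar:
  assumes G: "bilin G"
  shows "ev2 (comult_bar r) G = ev2 tensor_V (\<lambda>v1 v2. cop r (\<lambda>r1 r2. ev2 p_R (\<lambda>p1 p2. G (v1 * r1 * p1) (v2 * r2 * p2))))"
proof -
  note GD = bilinD[OF G]
  have b: "bilin (\<lambda>u v. G (v1 * u) (v2 * v))" for v1 v2 by (simp add: lin_defs multilinear GD)
  show ?thesis
    by (simp only: comult_bar_props(2)[OF G], simp only: mult.assoc, simp only: int_U[OF r b])
qed

lemma casimir_right:
  assumes G: "bilin G"
  shows "ev2 (comult_bar r) (\<lambda>x y. G x (y * S b)) = ev2 (comult_bar r) (\<lambda>x y. G (x * b) y)"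
proof -
  note GD = bilinD[OF G]
  have b: "bilin (\<lambda>x y. G x (y * S b))" "bilin (\<lambda>x y. G (x * b) y)" "bilin (\<lambda>u v. G (v1 * u) (v2 * v))" for v1 v2 by (simp add: lin_defs multilinear GD)+
  have "ev2 (comult_bar r) (\<lambda>x y. G (x * b) y) =
    ev2 tensor_V (\<lambda>v1 v2. cop r (\<lambda>r1 r2. ev2 p_R (\<lambda>p1 p2. G (v1 * (r1 * p1 * b)) (v2 * (r2 * p2)))))"
    by (simp only: int_comult_bar[OF b(2)] mult.assoc)
  also have "\<dots> = ev2 (comult_bar r) (\<lambda>x y. G x (y * S b))"
    by (simp only: int_move[OF r b(3)] int_comult_bar[OF b(1)], simp only: mult.assoc)
  finally show ?thesis by simp
qed

text \<open>The scalar \<mu>(a1) is turned into S^-1(a1) acting on r, whose coproduct passes through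
  V by \<open>V_antipode\<close>. With the factor a2 it forms \<Delta>(a1) p_R (1 \<otimes> S(a2)) =
  p_R (a \<otimes> 1), which amounts to S^-1(a) on the second leg.\<close>

lemma casimir_left:
  assumes G: "bilin G" and \<mu>: "\<And>a. S_inv a * r = smult H (\<mu> a) r"
  shows "ev2 (comult_bar r) (\<lambda>x y. G x (S_inv a * y)) = cop a (\<lambda>a1 a2. \<mu> a1 * ev2 (comult_bar r) (\<lambda>x y. G (a2 * x) y))"
proof -
  note GD = bilinD[OF G]
  have b: "bilin (\<lambda>x y. G x (S_inv a * y))" "bilin (\<lambda>x y. G (a2 * x) y)"
    "bilin (\<lambda>r1 r2. ev2 p_R (\<lambda>p1 p2. G (a2 * v1 * r1 * p1) (v2 * r2 * p2)))"
    "bilin (\<lambda>u v. cop r (\<lambda>r1 r2. ev2 p_R (\<lambda>p1 p2. G (a2 * u * r1 * p1) (v * r2 * p2))))" for a2 v1 v2 by (simp add: lin_defs multilinear GD)+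
  have b2: "bilin (\<lambda>u v. cop r (\<lambda>r1 r2. ev2 p_R (\<lambda>p1 p2.
      G (S_inv (f2 * v) * r1 * p1) (S_inv (f1 * u) * r2 * p2))))" for f1 f2 by (simp add: lin_defs multilinear GD)
  have b3: "bilin (\<lambda>v1 v2. cop r (\<lambda>r1 r2. ev2 p_R (\<lambda>p1 p2. G (v1 * r1 * p1) (S_inv a * v2 * r2 * p2))))" by (simp add: lin_defs multilinear GD)
  have "cop a (\<lambda>a1 a2. \<mu> a1 * ev2 (comult_bar r) (\<lambda>x y. G (a2 * x) y)) =
    cop a (\<lambda>a1 a2. ev2 tensor_V (\<lambda>v1 v2. \<mu> a1 * cop r (\<lambda>r1 r2. ev2 p_R (\<lambda>p1 p2. G (a2 * v1 * r1 * p1) (v2 * r2 * p2)))))"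
    by (simp only: int_comult_bar[OF b(2)] pull_in(1), simp only: mult.assoc)
  also have "\<dots> = cop a (\<lambda>a1 a2. ev2 tensor_V (\<lambda>v1 v2. cop (S_inv a1 * r) (\<lambda>r1 r2. ev2 p_R (\<lambda>p1 p2. G (a2 * v1 * r1 * p1) (v2 * r2 * p2)))))"
    by (simp only: \<mu> cop_linear)
  also have "\<dots> = cop a (\<lambda>a1 a2. ev2 tensor_V (\<lambda>v1 v2. cop (S_inv a1) (\<lambda>e1 e2. cop r (\<lambda>r1 r2. ev2 p_R (\<lambda>p1 p2.
      G (a2 * (v1 * e1) * r1 * p1) (v2 * e2 * r2 * p2))))))"
    by (simp only: cop_mult[OF b(3)], simp only: mult.assoc)
  also have "\<dots> = cop a (\<lambda>a1 a2. cop a1 (\<lambda>c1 c2. ev2 drinfeld_f (\<lambda>f1 f2. ev2 p_R (\<lambda>q1 q2. cop r (\<lambda>r1 r2. ev2 p_R (\<lambda>p1 p2.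
      G (a2 * S_inv (f2 * c2 * q2) * r1 * p1) (S_inv (f1 * c1 * q1) * r2 * p2)))))))"
    by (simp only: V_antipode[OF b(4)])
  also have "\<dots> = ev2 drinfeld_f (\<lambda>f1 f2. cop a (\<lambda>a1 a2. cop a1 (\<lambda>c1 c2. ev2 p_R (\<lambda>q1 q2. cop r (\<lambda>r1 r2. ev2 p_R (\<lambda>p1 p2.
      G (S_inv (f2 * (c2 * q2 * S a2)) * r1 * p1) (S_inv (f1 * (c1 * q1)) * r2 * p2)))))))"
    unfolding mult_simps S_inv_S by (rule ev_reorder)+
  also have "\<dots> = ev2 drinfeld_f (\<lambda>f1 f2. ev2 p_R (\<lambda>q1 q2. cop r (\<lambda>r1 r2. ev2 p_R (\<lambda>p1 p2.
      G (S_inv (f2 * q2) * r1 * p1) (S_inv (f1 * (q1 * a)) * r2 * p2)))))"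
    by (simp only: p_cov[OF b2])
  also have "\<dots> = ev2 drinfeld_f (\<lambda>f1 f2. ev2 p_R (\<lambda>q1 q2. cop r (\<lambda>r1 r2. ev2 p_R (\<lambda>p1 p2.
      G (S_inv (f2 * q2) * r1 * p1) (S_inv a * S_inv (f1 * q1) * r2 * p2)))))"
    by (simp only: mult_simps)
  also have "\<dots> = ev2 (comult_bar r) (\<lambda>x y. G x (S_inv a * y))"
    by (simp only: int_comult_bar[OF b(1)], simp only: mult.assoc[symmetric], simp only: V_props(2)[OF b3])
  finally show ?thesis by simp
qed

end

text \<open>
  \<open>phi_form G t\<^sub>1 t\<^sub>2\<close> evaluates \<open>G\<close> on
  \<open>S(Z) f\<^sup>1 t\<^sub>1\<^sub>,\<^sub>1 \<otimes> S\<^sup>-\<^sup>1(t\<^sub>2) X \<beta> S(Y) f\<^sup>2 t\<^sub>1\<^sub>,\<^sub>2\<close>.  Its value at \<open>t = f\<close> is \<open>q\<^sub>R\<close>; this is the only consequence of the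
  cocycle property of the twist \<open>f\<close> which is needed.
\<close>

definition phi_form :: "('h \<Rightarrow> 'h \<Rightarrow> 'k) \<Rightarrow> 'h \<Rightarrow> 'h \<Rightarrow> 'k" where
  "phi_form G t1 t2 = cop t1 (\<lambda>d1 d2. asc (\<lambda>X Y Z. ev2 drinfeld_f (\<lambda>f1 f2.
    G (S Z * f1 * d1) (S_inv t2 * X * \<beta> * S Y * f2 * d2))))"

lemma phi_form_bilin:
  assumes G: "bilin G"
  shows "bilin (phi_form G)"
  unfolding phi_form_def by (simp add: lin_defs multilinear bilinD[OF G])

text \<open>\<open>f_antipode\<close> carries the coproduct of S(a2) past f, coassociativity of
  \<phi> encloses \<beta> by a11 and S(a12), and only S(a) on the first leg survives.\<close>

lemma phi_form_antipode:
  assumes G: "bilin G"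
  shows "cop a (\<lambda>a1 a2. phi_form G (S a2 * t1) (S a1 * t2)) = phi_form (\<lambda>u v. G (S a * u) v) t1 t2"
proof -
  note GD = bilinD[OF G]
  have b0: "bilin (\<lambda>d1 d2. asc (\<lambda>X Y Z. ev2 drinfeld_f (\<lambda>f1 f2. G (S Z * f1 * d1) (w * X * \<beta> * S Y * f2 * d2))))" for w by (simp add: lin_defs multilinear GD)
  have b1: "bilin (\<lambda>u v. G (S Z * u * d1) (w * X * \<beta> * S Y * v * d2))" for Z d1 w X Y d2 by (simp add: lin_defs multilinear GD)
  have t: "trilin (\<lambda>u v w. G (S w * f1 * d1) (S_inv t2 * u * \<beta> * S v * f2 * d2))" for f1 f2 d1 d2 by (simp add: lin_defs multilinear GD)
  have f1: "(\<lambda>t. G u (w * X * t * w')) \<in> dual" for u w X w' by (simp add: lin_defs multilinear GD)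
  have f2: "(\<lambda>t. G (S (Z * t) * u) w) \<in> dual" for Z u w by (simp add: lin_defs multilinear GD)
  have "cop a (\<lambda>a1 a2. phi_form G (S a2 * t1) (S a1 * t2)) =
    cop a (\<lambda>a1 a2. cop (S a2) (\<lambda>s1 s2. cop t1 (\<lambda>d1 d2. asc (\<lambda>X Y Z. ev2 drinfeld_f (\<lambda>f1 f2.
      G (S Z * f1 * (s1 * d1)) (S_inv (S a1 * t2) * X * \<beta> * S Y * f2 * (s2 * d2)))))))"
    unfolding phi_form_def unfolding cop_mult[OF b0] ..
  also have "\<dots> = cop a (\<lambda>a1 a2. cop t1 (\<lambda>d1 d2. asc (\<lambda>X Y Z. cop (S a2) (\<lambda>s1 s2. ev2 drinfeld_f (\<lambda>f1 f2.
      G (S Z * (f1 * s1) * d1) (S_inv (S a1 * t2) * X * \<beta> * S Y * (f2 * s2) * d2))))))"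
    by ((unfold mult_simps)?, (rule ev_reorder)+)
  also have "\<dots> = cop a (\<lambda>a1 a2. cop t1 (\<lambda>d1 d2. asc (\<lambda>X Y Z. cop a2 (\<lambda>a21 a22. ev2 drinfeld_f (\<lambda>f1 f2.
      G (S Z * (S a22 * f1) * d1) (S_inv (S a1 * t2) * X * \<beta> * S Y * (S a21 * f2) * d2))))))"
    by (simp only: f_antipode[OF b1])
  also have "\<dots> = cop t1 (\<lambda>d1 d2. ev2 drinfeld_f (\<lambda>f1 f2. cop a (\<lambda>a1 a2. cop a2 (\<lambda>a21 a22. asc (\<lambda>X Y Z.
      G (S (a22 * Z) * f1 * d1) (S_inv t2 * (a1 * X) * \<beta> * S (a21 * Y) * f2 * d2))))))"
    unfolding mult_simps S_inv_S by (rule ev_reorder)+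
  also have "\<dots> = cop t1 (\<lambda>d1 d2. ev2 drinfeld_f (\<lambda>f1 f2. asc (\<lambda>X Y Z. cop a (\<lambda>a1 a2. cop a1 (\<lambda>a11 a12.
      G (S (Z * a2) * f1 * d1) (S_inv t2 * (X * a11) * \<beta> * S (Y * a12) * f2 * d2))))))"
    by (simp only: coassoc[OF t])
  also have "\<dots> = cop t1 (\<lambda>d1 d2. ev2 drinfeld_f (\<lambda>f1 f2. asc (\<lambda>X Y Z. cop a (\<lambda>a1 a2. cop a1 (\<lambda>a11 a12.
      G (S (Z * a2) * (f1 * d1)) (S_inv t2 * X * (a11 * \<beta> * S a12) * (S Y * f2 * d2)))))))"
    by ((unfold mult_simps)?, (rule ev_reorder)+)
  also have "\<dots> = cop t1 (\<lambda>d1 d2. ev2 drinfeld_f (\<lambda>f1 f2. asc (\<lambda>X Y Z.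
      G (S (Z * a) * (f1 * d1)) (S_inv t2 * X * \<beta> * (S Y * f2 * d2)))))"
    by (simp only: cop_beta[OF f1] cop_counit_left[OF f2])
  also have "\<dots> = phi_form (\<lambda>u v. G (S a * u) v) t1 t2"
    unfolding phi_form_def by ((unfold mult_simps)?, (rule ev_reorder)+)
  finally show ?thesis .
qed

lemma phi_form_mult:
  assumes G: "bilin G"
  shows "phi_form G (t1 * c) (t2 * d) = cop c (\<lambda>c1 c2. phi_form (\<lambda>u v. G (u * c1) (S_inv d * v * c2)) t1 t2)"
proof -
  note GD = bilinD[OF G]
  have b0: "bilin (\<lambda>d1 d2. asc (\<lambda>X Y Z. ev2 drinfeld_f (\<lambda>f1 f2. G (S Z * f1 * d1) (w * X * \<beta> * S Y * f2 * d2))))" for w by (simp add: lin_defs multilinear GD)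
  show ?thesis
    unfolding phi_form_def unfolding cop_mult[OF b0] by ((unfold mult_simps)?, (rule ev_reorder)+)
qed

text \<open>As S^-1(S(Y) \<alpha> Z) = S^-1(\<alpha> Z) Y, the value at \<gamma> is (\<alpha>
  \<otimes> 1) q_R. \<open>f_antipode_alpha\<close> replaces f by \<gamma>, the contraction that
  arises is \<open>gamma_form_tilde\<close>, and \<open>pentagon_right\<close> with a fresh \<phi>
  finishes as in \<open>q_p_cancel\<close>.\<close>

lemma phi_form_gamma:
  assumes G: "bilin G"
  shows "ev2 gamma (phi_form G) = asc (\<lambda>X Y Z. G (\<alpha> * X) (S_inv (S Y * \<alpha> * Z)))"
proof -
  note GD = bilinD[OF G]
  have b0: "bilin (\<lambda>u v. G (S Z * u) (w * X * \<beta> * S Y * v))" for Z w X Y by (simp add: lin_defs multilinear GD)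
  have K: "phi_form G (S a * \<alpha> * b) t2 = asc (\<lambda>X Y Z. gamma_form (\<lambda>u v. G (S Z * u) (S_inv t2 * X * \<beta> * S Y * v)) a b)" for a b t2
  proof -
    have "phi_form G (S a * \<alpha> * b) t2 = asc (\<lambda>X Y Z. cop (S a * \<alpha> * b) (\<lambda>d1 d2. ev2 drinfeld_f (\<lambda>f1 f2.
      G (S Z * (f1 * d1)) (S_inv t2 * X * \<beta> * S Y * (f2 * d2)))))"
      unfolding phi_form_def by ((unfold mult_simps)?, (rule ev_reorder)+)
    then show ?thesis by (simp only: f_antipode_alpha[OF b0])
  qed
  have ml: "gamma_form (\<lambda>u v. G (S Z * u) (w * X * \<beta> * S Y * v)) (y' * c) b =
    cop c (\<lambda>c1 c2. gamma_form (\<lambda>u v. G (S (c2 * Z) * u) (w * X * \<beta> * S (c1 * Y) * v)) y' b)" for Z w X Y y' c b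
  proof -
    have "gamma_form (\<lambda>u v. G (S Z * u) (w * X * \<beta> * S Y * v)) (y' * c) b =
      gamma_form (\<lambda>u v. cop c (\<lambda>c1 c2. G (S (c2 * Z) * u) (w * X * \<beta> * S (c1 * Y) * v))) y' b"
      by (simp only: gamma_form_mult_left[OF b0, symmetric], simp only: mult_simps)
    also have "\<dots> = cop c (\<lambda>c1 c2. gamma_form (\<lambda>u v. G (S (c2 * Z) * u) (w * X * \<beta> * S (c1 * Y) * v)) y' b)"
      unfolding gamma_form_def by (rule ev_reorder)+
    finally show ?thesis .
  qed
  have t: "trilin (\<lambda>a b c. gamma_form (\<lambda>u v. G (S c * u) (w * a * \<beta> * S b * v)) Y' Z')" for w Y' Z'
    by (simp add: lin_defs multilinear GD)
  have f1: "(\<lambda>t. gamma_form (\<lambda>u v. G (S Z * u) (w * t * S Y * v)) Y' Z') \<in> dual" for Z w Y Y' Z'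
    by (simp add: lin_defs multilinear GD)
  have f2: "(\<lambda>t. gamma_form (\<lambda>u v. G (S (Z * t) * u) (w * v)) Y' Z') \<in> dual" for Z w Y' Z'
    by (simp add: lin_defs multilinear GD)
  have b2: "bilin (\<lambda>u v. G (S (Z * x) * u) (w * X * \<beta> * S Y * v))" for Z x w X Y by (simp add: lin_defs multilinear GD)
  have mr: "gamma_form (\<lambda>u v. G (S (Z * x) * u) (w * X * \<beta> * S Y * v)) y' (z' * c) =
    cop c (\<lambda>c1 c2. gamma_form (\<lambda>u v. G (S (Z * x) * (u * c1)) (w * X * \<beta> * S Y * (v * c2))) y' z')" for Z x w X Y y' z' c
  proof -
    have "gamma_form (\<lambda>u v. G (S (Z * x) * u) (w * X * \<beta> * S Y * v)) y' (z' * c) =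
      gamma_form (\<lambda>u v. cop c (\<lambda>c1 c2. G (S (Z * x) * (u * c1)) (w * X * \<beta> * S Y * (v * c2)))) y' z'"
      by (simp only: gamma_form_mult_right[OF b2])
    also have "\<dots> = cop c (\<lambda>c1 c2. gamma_form (\<lambda>u v. G (S (Z * x) * (u * c1)) (w * X * \<beta> * S Y * (v * c2))) y' z')"
      unfolding gamma_form_def by (rule ev_reorder)+
    finally show ?thesis .
  qed
  have b3: "bilin (\<lambda>u v. G (S x * u * y1) (S_inv (\<alpha> * z) * v * y2))" for x y1 z y2 by (simp add: lin_defs multilinear GD)
  let ?F = "\<lambda>a b c d. G (S a * \<alpha> * b) (S_inv (\<alpha> * d) * c)"
  have q: "quadrilin ?F" by (simp add: lin_defs multilinear GD)
  have f3: "(\<lambda>t. asci (\<lambda>x' y' z'. cop y' (\<lambda>y1 y2. asci (\<lambda>x y z.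
      G (S (x * x') * t * (y * y1)) (S_inv (\<alpha> * (Z * z')) * (Y * z * y2)))))) \<in> dual" for Y Z by (simp add: lin_defs multilinear GD)
  have b4: "bilin (\<lambda>Y Z. asci (\<lambda>x' y' z'. cop y' (\<lambda>y1 y2. asci (\<lambda>x y z.
      G (S (x * x') * \<alpha> * (y * y1)) (S_inv (\<alpha> * (Z * z')) * (Y * z * y2))))))" by (simp add: lin_defs multilinear GD)
  have f4: "(\<lambda>t. asc (\<lambda>X Y Z. G (S x * \<alpha> * (y * X)) (S_inv Z * S_inv t * Y))) \<in> dual" for x y by (simp add: lin_defs multilinear GD)
  have b5: "bilin (\<lambda>x y. asc (\<lambda>X Y Z. G (S x * \<alpha> * (y * X)) (S_inv Z * S_inv \<alpha> * Y)))" by (simp add: lin_defs multilinear GD)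
  have "ev2 gamma (phi_form G) = asc (\<lambda>X' Y' Z'. asci (\<lambda>x y z. cop x (\<lambda>x1 x2.
      asc (\<lambda>X Y Z. gamma_form (\<lambda>u v. G (S Z * u) (S_inv (S (X' * x1) * \<alpha> * z) * X * \<beta> * S Y * v)) (Y' * x2) (Z' * y)))))"
    by (simp only: gamma_alt[OF phi_form_bilin[OF G]] K)
  also have "\<dots> = asc (\<lambda>X' Y' Z'. asci (\<lambda>x y z. cop x (\<lambda>x1 x2.
      asc (\<lambda>X Y Z. cop x2 (\<lambda>x21 x22. gamma_form (\<lambda>u v. G (S (x22 * Z) * u) (S_inv (S (X' * x1) * \<alpha> * z) * X * \<beta> * S (x21 * Y) * v)) Y' (Z' * y))))))"
    by (simp only: ml)
  also have "\<dots> = asc (\<lambda>X' Y' Z'. asci (\<lambda>x y z. cop x (\<lambda>x1 x2. cop x2 (\<lambda>x21 x22. asc (\<lambda>X Y Z.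
      gamma_form (\<lambda>u v. G (S (x22 * Z) * u) (S_inv (\<alpha> * z) * X' * (x1 * X) * \<beta> * S (x21 * Y) * v)) Y' (Z' * y))))))"
    unfolding mult_simps S_inv_S by (rule ev_reorder)+
  also have "\<dots> = asc (\<lambda>X' Y' Z'. asci (\<lambda>x y z. asc (\<lambda>X Y Z. cop x (\<lambda>x1 x2. cop x1 (\<lambda>x11 x12.
      gamma_form (\<lambda>u v. G (S (Z * x2) * u) (S_inv (\<alpha> * z) * X' * (X * x11) * \<beta> * S (Y * x12) * v)) Y' (Z' * y))))))"
    by (simp only: coassoc[OF t])
  also have "\<dots> = asc (\<lambda>X' Y' Z'. asci (\<lambda>x y z. asc (\<lambda>X Y Z. cop x (\<lambda>x1 x2. cop x1 (\<lambda>x11 x12.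
      gamma_form (\<lambda>u v. G (S (Z * x2) * u) (S_inv (\<alpha> * z) * X' * X * (x11 * \<beta> * S x12) * S Y * v)) Y' (Z' * y))))))"
    by (simp only: mult_simps)
  also have "\<dots> = asc (\<lambda>X' Y' Z'. asci (\<lambda>x y z. asc (\<lambda>X Y Z. cop x (\<lambda>x1 x2. \<epsilon> x1 *
      gamma_form (\<lambda>u v. G (S (Z * x2) * u) (S_inv (\<alpha> * z) * X' * X * \<beta> * S Y * v)) Y' (Z' * y)))))"
    by (simp only: cop_beta[OF f1])
  also have "\<dots> = asc (\<lambda>X' Y' Z'. asci (\<lambda>x y z. asc (\<lambda>X Y Z.
      gamma_form (\<lambda>u v. G (S (Z * x) * u) (S_inv (\<alpha> * z) * X' * X * \<beta> * S Y * v)) Y' (Z' * y))))"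
    by (simp only: cop_counit_left[OF f2])
  also have "\<dots> = asc (\<lambda>X' Y' Z'. asci (\<lambda>x y z. asc (\<lambda>X Y Z. cop y (\<lambda>y1 y2.
      gamma_form (\<lambda>u v. G (S (Z * x) * (u * y1)) (S_inv (\<alpha> * z) * X' * X * \<beta> * S Y * (v * y2))) Y' Z'))))"
    by (simp only: mr)
  also have "\<dots> = asci (\<lambda>x y z. cop y (\<lambda>y1 y2. asc (\<lambda>X' Y' Z'. asc (\<lambda>X Y Z.
      gamma_form (\<lambda>u v. G (S x * (S Z * u) * y1) (S_inv (\<alpha> * z) * (X' * X * \<beta> * S Y * v) * y2)) Y' Z'))))"
    by ((unfold mult_simps)?, (rule ev_reorder)+)
  also have "\<dots> = asci (\<lambda>x' y' z'. cop y' (\<lambda>y1 y2. asci (\<lambda>x y z.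
      G (S x' * (S x * \<alpha> * y) * y1) (S_inv (\<alpha> * z') * z * y2))))"
    by (simp only: gamma_form_tilde[OF b3])
  also have "\<dots> = asci (\<lambda>x' y' z'. cop y' (\<lambda>y1 y2. asci (\<lambda>x y z.
      G (S (x * x') * \<alpha> * (y * y1)) (S_inv (\<alpha> * (1 * z')) * (1 * z * y2)))))"
    by (simp only: mult_simps mult_1_left)
  also have "\<dots> = asc (\<lambda>X Y Z. \<epsilon> X * asci (\<lambda>x' y' z'. cop y' (\<lambda>y1 y2. asci (\<lambda>x y z.
      G (S (x * x') * \<alpha> * (y * y1)) (S_inv (\<alpha> * (Z * z')) * (Y * z * y2))))))"
    by (rule asc_counit1[OF b4, symmetric])
  also have "\<dots> = asc (\<lambda>X Y Z. cop X (\<lambda>X1 X2. asci (\<lambda>x' y' z'. cop y' (\<lambda>y1 y2. asci (\<lambda>x y z.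
      G (S (x * x') * (S X1 * \<alpha> * X2) * (y * y1)) (S_inv (\<alpha> * (Z * z')) * (Y * z * y2)))))))"
    by (simp only: cop_alpha[OF f3])
  also have "\<dots> = asc (\<lambda>X Y Z. cop X (\<lambda>X1 X2. asci (\<lambda>x' y' z'. cop y' (\<lambda>y1 y2. asci (\<lambda>x y z.
      ?F (X1 * x * x') (X2 * y * y1) (Y * z * y2) (Z * z'))))))"
    by ((unfold mult_simps)?, (rule ev_reorder)+)
  also have "\<dots> = asci (\<lambda>x y z. cop z (\<lambda>z1 z2. asc (\<lambda>X Y Z. ?F x (y * X) (z1 * Y) (z2 * Z))))"
    by (rule pentagon_right[OF q])
  also have "\<dots> = asci (\<lambda>x y z. cop z (\<lambda>z1 z2. asc (\<lambda>X Y Z. G (S x * \<alpha> * (y * X)) (S_inv Z * S_inv (S z1 * \<alpha> * z2) * Y))))"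
    unfolding mult_simps S_inv_S by (rule ev_reorder)+
  also have "\<dots> = asc (\<lambda>X Y Z. G (S 1 * \<alpha> * (1 * X)) (S_inv Z * S_inv \<alpha> * Y))"
    by (simp only: cop_alpha[OF f4] asci_counit3[OF b5])
  also have "\<dots> = asc (\<lambda>X Y Z. G (\<alpha> * X) (S_inv (S Y * \<alpha> * Z)))"
    by (simp only: mult_simps mult_1_left S_inv_S)
  finally show ?thesis .
qed

text \<open>Expanding f over \<gamma> reduces to \<open>phi_form_gamma\<close>, so that q_R appears.
  \<open>qs_cov\<close> collects the factor y \<beta> S(z) on the first leg,
  \<open>p_q_cancel\<close> cancels q_R against p_R, and S(x) \<alpha> y \<beta> S(z) = 1
  remains.\<close>

lemma phi_form_f_p:
  assumes G: "bilin G"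
  shows "ev2 drinfeld_f (\<lambda>t1 t2. ev2 p_R (\<lambda>p1 p2. phi_form G (t1 * p1) (t2 * p2))) = G 1 1"
proof -
  note GD = bilinD[OF G]
  note PD = bilinD[OF phi_form_bilin[OF G]]
  have b0: "bilin (\<lambda>t1 t2. ev2 p_R (\<lambda>p1 p2. phi_form G (t1 * p1) (t2 * p2)))"
    by (simp add: lin_defs multilinear PD)
  have b1: "bilin (\<lambda>u v. G (S x * u) v)" "bilin (\<lambda>u v. G (S x * (u * e1)) (S_inv d * v * e2))" for x e1 e2 d by (simp add: lin_defs multilinear GD)+
  have b2: "bilin (\<lambda>e1 e2. asc (\<lambda>X Y Z. G (S x * (\<alpha> * X * e1)) (S_inv d * S_inv (S Y * \<alpha> * Z) * e2)))" for x d by (simp add: lin_defs multilinear GD)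
  have b3: "bilin (\<lambda>u v. G (S x * (\<alpha> * u * p11)) (S_inv (S p12 * v * p2)))" for x p11 p12 p2 by (simp add: lin_defs multilinear GD)
  have b4: "bilin (\<lambda>u v. G (S x * (\<alpha> * (c * u))) (S_inv v))" for x c by (simp add: lin_defs multilinear GD)
  have f: "(\<lambda>t. G t 1) \<in> dual" by (simp add: lin_defs multilinear GD)
  have "ev2 drinfeld_f (\<lambda>t1 t2. ev2 p_R (\<lambda>p1 p2. phi_form G (t1 * p1) (t2 * p2))) =
    asci (\<lambda>x y z. cop x (\<lambda>x1 x2. ev2 gamma (\<lambda>g1 g2. cop (y * \<beta> * S z) (\<lambda>c1 c2. ev2 p_R (\<lambda>p1 p2.
      phi_form G (S x2 * g1 * c1 * p1) (S x1 * g2 * c2 * p2))))))"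
    by (simp only: f_props(2)[OF b0] gamma_form_def)
  also have "\<dots> = asci (\<lambda>x y z. ev2 gamma (\<lambda>g1 g2. cop (y * \<beta> * S z) (\<lambda>c1 c2. ev2 p_R (\<lambda>p1 p2. cop x (\<lambda>x1 x2.
      phi_form G (S x2 * (g1 * (c1 * p1))) (S x1 * (g2 * (c2 * p2))))))))"
    by ((unfold mult_simps)?, (rule ev_reorder)+)
  also have "\<dots> = asci (\<lambda>x y z. ev2 gamma (\<lambda>g1 g2. cop (y * \<beta> * S z) (\<lambda>c1 c2. ev2 p_R (\<lambda>p1 p2. cop (c1 * p1) (\<lambda>e1 e2.
      phi_form (\<lambda>u v. G (S x * (u * e1)) (S_inv (c2 * p2) * v * e2)) g1 g2)))))"
    by (simp only: phi_form_antipode[OF G] phi_form_mult[OF b1(1)])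
  also have "\<dots> = asci (\<lambda>x y z. cop (y * \<beta> * S z) (\<lambda>c1 c2. ev2 p_R (\<lambda>p1 p2. cop (c1 * p1) (\<lambda>e1 e2.
      ev2 gamma (phi_form (\<lambda>u v. G (S x * (u * e1)) (S_inv (c2 * p2) * v * e2)))))))"
    by (rule ev_reorder)+
  also have "\<dots> = asci (\<lambda>x y z. cop (y * \<beta> * S z) (\<lambda>c1 c2. ev2 p_R (\<lambda>p1 p2. cop (c1 * p1) (\<lambda>e1 e2.
      asc (\<lambda>X Y Z. G (S x * (\<alpha> * X * e1)) (S_inv (c2 * p2) * S_inv (S Y * \<alpha> * Z) * e2))))))"
    by (simp only: phi_form_gamma[OF b1(2)])
  also have "\<dots> = asci (\<lambda>x y z. cop (y * \<beta> * S z) (\<lambda>c1 c2. ev2 p_R (\<lambda>p1 p2. cop c1 (\<lambda>c11 c12. cop p1 (\<lambda>p11 p12.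
      asc (\<lambda>X Y Z. G (S x * (\<alpha> * X * (c11 * p11))) (S_inv (c2 * p2) * S_inv (S Y * \<alpha> * Z) * (c12 * p12))))))))"
    by (simp only: cop_mult[OF b2])
  also have "\<dots> = asci (\<lambda>x y z. ev2 p_R (\<lambda>p1 p2. cop p1 (\<lambda>p11 p12. cop (y * \<beta> * S z) (\<lambda>c1 c2. cop c1 (\<lambda>c11 c12.
      asc (\<lambda>X Y Z. G (S x * (\<alpha> * (X * c11) * p11)) (S_inv (S p12 * (S (Y * c12) * \<alpha> * (Z * c2)) * p2))))))))"
    unfolding mult_simps S_inv_S by (rule ev_reorder)+
  also have "\<dots> = asci (\<lambda>x y z. ev2 p_R (\<lambda>p1 p2. cop p1 (\<lambda>p11 p12.
      asc (\<lambda>X Y Z. G (S x * (\<alpha> * ((y * \<beta> * S z) * X) * p11)) (S_inv (S p12 * (S Y * \<alpha> * Z) * p2))))))"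
    by (simp only: qs_cov[OF b3])
  also have "\<dots> = asci (\<lambda>x y z. ev2 p_R (\<lambda>p1 p2. cop p1 (\<lambda>p11 p12.
      asc (\<lambda>X Y Z. G (S x * (\<alpha> * ((y * \<beta> * S z) * (X * p11)))) (S_inv (S (Y * p12) * \<alpha> * Z * p2))))))"
    by (simp only: mult_simps)
  also have "\<dots> = asci (\<lambda>x y z. G (S x * \<alpha> * y * \<beta> * S z) 1)"
    by (simp only: p_q_cancel[OF b4] S_inv_one mult_1_right, simp only: mult.assoc)
  also have "\<dots> = G 1 1" by (rule asci_antipode[OF f])
  finally show ?thesis .
qed

section \<open>Cointegrals are Frobenius functionals\<close>

text \<open>Apply \<epsilon> to S(a1) \<alpha> a2 = \<epsilon>(a) \<alpha>; the normalisation
  \<epsilon>(\<alpha>) = 1 removes \<alpha>.\<close>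

lemma counit_antipode: "\<epsilon> (S a) = \<epsilon> a"
proof -
  have f: "(\<lambda>t. \<epsilon> (S t)) \<in> dual" by (simp add: lin_defs multilinear)
  have "\<epsilon> a = cop a (\<lambda>a1 a2. \<epsilon> (S a1 * \<alpha> * a2))"
    by (simp add: cop_alpha[OF \<epsilon>_props(1)] counit_alpha)
  also have "\<dots> = cop a (\<lambda>a1 a2. \<epsilon> a2 * \<epsilon> (S a1))"
    by (simp add: \<epsilon>_props counit_alpha mult.commute)
  also have "\<dots> = \<epsilon> (S a)" by (rule cop_counit_right[OF f])
  finally show ?thesis by simp
qed

text \<open>S(r) is a left integral because \<epsilon> is invariant under S. The modulus, defined on
  left integrals, therefore governs r through S^-1, which is the hypothesis of
  \<open>casimir_left\<close>.\<close>

lemma modulus_right_integral: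
  assumes r: "right_integral r" and \<mu>: "modulus \<mu>"
  shows "S_inv a * r = smult H (\<mu> a) r"
proof -
  have \<epsilon>: "\<epsilon> (S_inv b) = \<epsilon> b" for b using counit_antipode[of "S_inv b"] by simp
  have "b * S r = smult H (\<epsilon> b) (S r)" for b
  proof -
    have "b * S r = S (r * S_inv b)" by (simp add: antipode_mult)
    also have "\<dots> = smult H (\<epsilon> b) (S r)" using r by (simp add: right_integral_def S_linear \<epsilon>)
    finally show ?thesis .
  qed
  then have "S r * a = smult H (\<mu> a) (S r)" using \<mu> by (simp add: modulus_def left_integral_def)
  then have "S (S_inv a * r) = S (smult H (\<mu> a) r)" by (simp add: antipode_mult S_linear)
  then show ?thesis by (simp only: S_inj)
qed

lemma lift2_field: "t \<in> tensors2 \<Longrightarrow> bilin F \<Longrightarrow> lift2 F t = ev2 t F"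
  using lift2_ev[OF vector_space_field, of t F "\<lambda>x. x"]
  by (simp add: linear_scale vector_space_field lin_defs)

lemma comult_bar_linear:
  assumes "bilin F"
  shows "ev2 (comult_bar (a + b)) F = ev2 (comult_bar a) F + ev2 (comult_bar b) F"
    "ev2 (comult_bar (smult H c a)) F = c * ev2 (comult_bar a) F"
  by (simp_all add: comult_bar_props(2)[OF assms] multilinear)

lemma hit_right_ev: "\<mu> \<in> dual \<Longrightarrow> g \<in> dual \<Longrightarrow> g (a \<leftharpoonup> \<mu>) = cop a (\<lambda>a1 a2. \<mu> a1 * g a2)"
  using lift2_scalar[OF comult_closed, of g "\<lambda>a1 a2. smult H (\<mu> a1) a2" a]
  by (simp add: hit_right_def linear_scale vector_space_axioms dualD(1)[of \<mu>] dualD(2)[of \<mu>] dualD(2)[of g]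
    scale_left_distrib scale_right_distrib mult.commute)

context
  fixes \<mu> lam :: "'h \<Rightarrow> 'k" and r :: 'h
  assumes \<mu>: "modulus \<mu>" and lam: "left_cointegral B lam" and r: "right_integral r" and lam_r: "lam r = 1"
begin

lemma lam_dual: "lam \<in> dual" and mu_dual: "\<mu> \<in> dual"
  using lam \<mu> by (auto simp: left_cointegral_def modulus_def algebra_character_def)

lemma mu_one: "\<mu> 1 = 1"
  using \<mu> by (auto simp: modulus_def algebra_character_def)

lemmas lam_linear = dualD[OF lam_dual] and mu_linear = dualD[OF mu_dual]

text \<open>E(\<lambda>) = \<lambda> with S^2(q2 b) S(\<beta>) written as S(\<beta> S(q2 b)):
  everything to the right of the argument is then the antipode of one element, ready for
  \<open>casimir_right\<close>.\<close>

lemma cointegral_eq: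
  "lam a = (\<Sum>b\<in>B. ev2 q_R (\<lambda>q1 q2. ev2 (comult_bar (S_inv q1 * (a * S (\<beta> * S (q2 * b))))) (\<lambda>x y. coord b x * lam y)))"
proof -
  have b1: "bilin (\<lambda>x y. coord b x * lam y)" for b
    by (simp add: lin_defs multilinear lam_linear algebra_simps)
  have b2: "bilin (\<lambda>q1 q2. ev2 (comult_bar (S_inv q1 * (a * S (\<beta> * S (q2 * b))))) (\<lambda>x y. coord b x * lam y))" for b
    by (simp add: lin_defs multilinear comult_bar_linear[OF b1])
  have "lam a = cointegral_map B lam a" using lam by (simp add: left_cointegral_def)
  also have "\<dots> = (\<Sum>b\<in>B. lift2 (\<lambda>q1 q2. ev2 (comult_bar (S_inv q1 * (a * S (\<beta> * S (q2 * b))))) (\<lambda>x y. coord b x * lam y)) q_R)"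
    unfolding cointegral_map_def lift2_field[OF comult_bar_props(1) b1] by (simp only: mult_simps)
  also have "\<dots> = (\<Sum>b\<in>B. ev2 q_R (\<lambda>q1 q2. ev2 (comult_bar (S_inv q1 * (a * S (\<beta> * S (q2 * b))))) (\<lambda>x y. coord b x * lam y)))"
    by (simp only: lift2_field[OF q_props(1) b2])
  finally show ?thesis .
qed

text \<open>With \<epsilon> on its first leg p_R contracts to \<beta>, and r \<beta> =
  \<epsilon>(\<beta>) r = r.\<close>

lemma int_p_R:
  assumes f: "f \<in> dual"
  shows "ev2 p_R (\<lambda>p1 p2. \<epsilon> p1 * f (r * p2)) = f r"
proof -
  have b: "bilin (\<lambda>p1 p2. \<epsilon> p1 * f (r * p2))" "bilin (\<lambda>y z. f (r * (y * \<beta> * S z)))"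
    by (simp_all add: lin_defs multilinear dualD[OF f] algebra_simps)
  show ?thesis
    using r by (simp only: p_props(2)[OF b(1)] asci_counit1[OF b(2)])
      (simp add: antipode_one right_integral_def counit_beta)
qed

text \<open>
  Here \<open>E(\<lambda>) = \<lambda>\<close> is used: it is applied to the second leg of \<open>\<Delta>(r)\<close>, and everything collapses to
  the value of \<open>phi_form\<close> at \<open>f p\<^sub>R\<close>.
\<close>

lemma cointegral_comult_bar:
  assumes g: "g \<in> dual"
  shows "ev2 (comult_bar r) (\<lambda>x y. g x * lam y) = g 1"
proof -
  note GD = dualD[OF g] lam_linear
  have bK: "bilin (\<lambda>x y. coord b x * lam y)" for b
    by (simp add: lin_defs multilinear GD algebra_simps)
  have b1: "bilin (\<lambda>x y. g x * ev2 (comult_bar (S_inv q1 * y)) (\<lambda>x' y'. coord b x' * lam y'))" for q1 b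
    by (simp add: lin_defs multilinear GD comult_bar_linear[OF bK] mult.assoc mult.left_commute)
  have f1: "(\<lambda>b. g (x * (\<beta> * S (q2 * b)))) \<in> dual" for x q2 by (simp add: lin_defs multilinear GD)
  have b2: "bilin (\<lambda>x' y'. g (x * (\<beta> * S (q2 * x'))) * lam y')" for x q2
    by (simp add: lin_defs multilinear GD algebra_simps)
  have b3: "bilin (\<lambda>x y. ev2 (comult_bar (S_inv q1 * y)) (\<lambda>x' y'. g (x * (\<beta> * S (q2 * x'))) * lam y'))" for q1 q2
  proof -
    have "ev2 (comult_bar (S_inv q1 * y)) (\<lambda>x' y'. g ((x + z) * (\<beta> * S (q2 * x'))) * lam y') =
      ev2 (comult_bar (S_inv q1 * y)) (\<lambda>x' y'. g (x * (\<beta> * S (q2 * x'))) * lam y') +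
      ev2 (comult_bar (S_inv q1 * y)) (\<lambda>x' y'. g (z * (\<beta> * S (q2 * x'))) * lam y')" for x y z
      by (simp add: multilinear GD)
    moreover have "ev2 (comult_bar (S_inv q1 * y)) (\<lambda>x' y'. g (smult H c x * (\<beta> * S (q2 * x'))) * lam y') =
      c * ev2 (comult_bar (S_inv q1 * y)) (\<lambda>x' y'. g (x * (\<beta> * S (q2 * x'))) * lam y')" for x y c
      by (simp add: multilinear GD mult.assoc)
    ultimately show ?thesis
      by (simp add: lin_defs mult_scale_right distrib_left comult_bar_linear[OF b2])
  qed
  have b4: "bilin (\<lambda>c1 c2. ev2 tensor_U (\<lambda>u1 u2. g (x * (\<beta> * S (q2 * (w1 * c1 * u1)))) * lam (w2 * c2 * u2)))" for x q2 w1 w2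
    by (simp add: lin_defs multilinear GD algebra_simps)
  have K1: "cop (s * (v2 * r2 * p2)) (\<lambda>c1 c2. ev2 tensor_U (\<lambda>u1 u2. g (x * (\<beta> * S (q2 * (w1 * c1 * u1)))) * lam (w2 * c2 * u2))) =
    cop (s * v2) (\<lambda>s1 s2. cop (r2 * p2) (\<lambda>e1 e2. ev2 tensor_U (\<lambda>u1 u2.
      g (x * (\<beta> * S (q2 * (w1 * (s1 * e1) * u1)))) * lam (w2 * (s2 * e2) * u2))))" for s v2 r2 p2 x q2 w1 w2
    using cop_mult[OF b4, of "s * v2" "r2 * p2"] by (simp only: mult.assoc)
  have t1: "trilin (\<lambda>a b c. g (v1 * a * \<beta> * S b * S (q2 * w1 * s1)) * lam (w2 * s2 * c))" for v1 q2 w1 s1 w2 s2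
    by (simp add: lin_defs multilinear GD algebra_simps)
  have f2: "(\<lambda>t. g (v1 * X * t * S Y * w) * lam l) \<in> dual" for v1 X Y w l
    by (simp add: lin_defs multilinear GD algebra_simps)
  have f3: "(\<lambda>t. g w * lam (w2 * (Z * (t * p2)))) \<in> dual" for w w2 Z p2
    by (simp add: lin_defs multilinear GD algebra_simps)
  have f4: "(\<lambda>t. g w * lam (w2 * (Z * t))) \<in> dual" for w w2 Z
    by (simp add: lin_defs multilinear GD algebra_simps)
  have b5: "bilin (\<lambda>s1 s2. asc (\<lambda>X Y Z. g (v1 * X * \<beta> * S Y * S (q2 * s1)) * lam (s2 * (Z * r))))" for v1 q2
    by (simp add: lin_defs multilinear GD algebra_simps)
  have b6: "bilin (\<lambda>v1 v2. ev2 tensor_V (\<lambda>w1 w2. cop (S_inv q1 * v2) (\<lambda>s1 s2. asc (\<lambda>X Y Z.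
      g (v1 * X * \<beta> * S Y * S (q2 * (w1 * s1))) * lam (w2 * s2 * (Z * r))))))" for q1 q2
    by (simp add: lin_defs multilinear GD algebra_simps)
  have b7: "bilin (\<lambda>c1 c2. ev2 drinfeld_f (\<lambda>f1 f2. ev2 p_R (\<lambda>p1 p2. asc (\<lambda>X Y Z.
      g (v1 * X * \<beta> * S Y * S (q2 * S_inv (f2 * c2 * p2))) * lam (S_inv (f1 * c1 * p1) * (Z * r))))))" for v1 q2
    by (simp add: lin_defs multilinear GD algebra_simps)
  have b8: "bilin (\<lambda>q1 q2. cop q1 (\<lambda>q11 q12. ev2 p_R (\<lambda>p1' p2'.
      g (w * (f2' * d2 * (q12 * p2' * S q2))) * lam (S_inv (f1' * d1 * (q11 * p1')) * (Z * r)))))" for w f2' d2 f1' d1 Z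
    by (simp add: lin_defs multilinear GD algebra_simps)
  have b9: "bilin (\<lambda>u v. g (w * (f2' * d2 * v)) * lam (S_inv (f1' * d1 * u) * (Z * r)))" for w f1' f2' d1 d2 Z
    by (simp add: lin_defs multilinear GD algebra_simps)
  have b10: "bilin (\<lambda>u v. g v * \<mu> u)"
    by (simp add: lin_defs multilinear GD mu_linear algebra_simps)
  have "ev2 (comult_bar r) (\<lambda>x y. g x * lam y) =
    ev2 (comult_bar r) (\<lambda>x y. \<Sum>b\<in>B. ev2 q_R (\<lambda>q1 q2. g x * ev2 (comult_bar (S_inv q1 * (y * S (\<beta> * S (q2 * b))))) (\<lambda>x' y'. coord b x' * lam y')))"
    by (subst cointegral_eq) (simp only: sum_distrib_left pull_in(1))
  also have "\<dots> = (\<Sum>b\<in>B. ev2 q_R (\<lambda>q1 q2. ev2 (comult_bar r) (\<lambda>x y. g x * ev2 (comult_bar (S_inv q1 * (y * S (\<beta> * S (q2 * b))))) (\<lambda>x' y'. coord b x' * lam y'))))"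
    unfolding ev2_form_sum by (rule sum.cong[OF refl], rule ev22_swap)
  \<comment> \<open>The factor S(\<beta> S(q2 b)) leaves the argument of \<lambda> and moves to the
    first leg.\<close>
  also have "\<dots> = (\<Sum>b\<in>B. ev2 q_R (\<lambda>q1 q2. ev2 (comult_bar r) (\<lambda>x y. g (x * (\<beta> * S (q2 * b))) * ev2 (comult_bar (S_inv q1 * y)) (\<lambda>x' y'. coord b x' * lam y'))))"
    by (simp only: casimir_right[OF r b1])
  also have "\<dots> = (\<Sum>b\<in>B. ev2 q_R (\<lambda>q1 q2. ev2 (comult_bar r) (\<lambda>x y. ev2 (comult_bar (S_inv q1 * y)) (\<lambda>x' y'. coord b x' * g (x * (\<beta> * S (q2 * b))) * lam y'))))"
    by (simp only: pull_in(1) mult.assoc[where 'a = 'k] mult.left_commute[where 'a = 'k])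
  \<comment> \<open>Now the basis sum is an ordinary coordinate expansion: it substitutes the first
    leg of the inner coproduct for the basis element.\<close>
  also have "\<dots> = ev2 q_R (\<lambda>q1 q2. ev2 (comult_bar r) (\<lambda>x y. ev2 (comult_bar (S_inv q1 * y)) (\<lambda>x' y'. (\<Sum>b\<in>B. coord b x' * g (x * (\<beta> * S (q2 * b)))) * lam y')))"
    by (simp only: sum_distrib_right ev2_form_sum)
  also have "\<dots> = ev2 q_R (\<lambda>q1 q2. ev2 (comult_bar r) (\<lambda>x y. ev2 (comult_bar (S_inv q1 * y)) (\<lambda>x' y'. g (x * (\<beta> * S (q2 * x'))) * lam y')))"
    by (simp only: dual_expand[OF f1])
  also have "\<dots> = ev2 q_R (\<lambda>q1 q2. ev2 tensor_V (\<lambda>v1 v2. cop r (\<lambda>r1 r2. ev2 p_R (\<lambda>p1 p2. ev2 tensor_V (\<lambda>w1 w2.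
      cop (S_inv q1 * (v2 * r2 * p2)) (\<lambda>c1 c2. ev2 tensor_U (\<lambda>u1 u2.
      g (v1 * r1 * p1 * (\<beta> * S (q2 * (w1 * c1 * u1)))) * lam (w2 * c2 * u2))))))))"
    by (simp only: int_comult_bar[OF r b3], simp only: comult_bar_props(2)[OF b2])
  also have "\<dots> = ev2 q_R (\<lambda>q1 q2. ev2 tensor_V (\<lambda>v1 v2. cop r (\<lambda>r1 r2. ev2 p_R (\<lambda>p1 p2. ev2 tensor_V (\<lambda>w1 w2.
      cop (S_inv q1 * v2) (\<lambda>s1 s2. cop (r2 * p2) (\<lambda>e1 e2. ev2 tensor_U (\<lambda>u1 u2.
      g (v1 * r1 * p1 * (\<beta> * S (q2 * (w1 * (s1 * e1) * u1)))) * lam (w2 * (s2 * e2) * u2)))))))))"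
    by (simp only: K1)
  also have "\<dots> = ev2 q_R (\<lambda>q1 q2. ev2 tensor_V (\<lambda>v1 v2. ev2 tensor_V (\<lambda>w1 w2. cop (S_inv q1 * v2) (\<lambda>s1 s2.
      cop r (\<lambda>r1 r2. ev2 p_R (\<lambda>p1 p2. cop (r2 * p2) (\<lambda>e1 e2. ev2 tensor_U (\<lambda>u1 u2.
      g (v1 * (r1 * p1) * \<beta> * S (e1 * u1) * S (q2 * w1 * s1)) * lam (w2 * s2 * (e2 * u2))))))))))"
    by ((unfold mult_simps)?, (rule ev_reorder)+)
  \<comment> \<open>Converts the coproduct of the second leg of \<Delta>(r) p_R into one of the
    first; \<beta> then contracts that leg to a counit.\<close>
  also have "\<dots> = ev2 q_R (\<lambda>q1 q2. ev2 tensor_V (\<lambda>v1 v2. ev2 tensor_V (\<lambda>w1 w2. cop (S_inv q1 * v2) (\<lambda>s1 s2.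
      asc (\<lambda>X Y Z. cop r (\<lambda>r1 r2. ev2 p_R (\<lambda>p1 p2. cop (r1 * p1) (\<lambda>d1 d2.
      g (v1 * (X * d1) * \<beta> * S (Y * d2) * S (q2 * w1 * s1)) * lam (w2 * s2 * (Z * (r2 * p2)))))))))))"
    by (simp only: int_coprod_U[OF r t1])
  also have "\<dots> = ev2 q_R (\<lambda>q1 q2. ev2 tensor_V (\<lambda>v1 v2. ev2 tensor_V (\<lambda>w1 w2. cop (S_inv q1 * v2) (\<lambda>s1 s2.
      asc (\<lambda>X Y Z. cop r (\<lambda>r1 r2. ev2 p_R (\<lambda>p1 p2. cop (r1 * p1) (\<lambda>d1 d2.
      g (v1 * X * (d1 * \<beta> * S d2) * S Y * S (q2 * w1 * s1)) * lam (w2 * s2 * (Z * (r2 * p2)))))))))))"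
    by (simp only: mult_simps)
  also have "\<dots> = ev2 q_R (\<lambda>q1 q2. ev2 tensor_V (\<lambda>v1 v2. ev2 tensor_V (\<lambda>w1 w2. cop (S_inv q1 * v2) (\<lambda>s1 s2.
      asc (\<lambda>X Y Z. ev2 p_R (\<lambda>p1 p2. \<epsilon> p1 * cop r (\<lambda>r1 r2. \<epsilon> r1 *
      (g (v1 * X * \<beta> * S Y * S (q2 * w1 * s1)) * lam (w2 * s2 * (Z * (r2 * p2)))))))))))"
    by (simp only: cop_beta[OF f2] pull_in(1), subst ev22_swap[of "\<Delta> r"], simp only: \<epsilon>_props mult_ac)
  also have "\<dots> = ev2 q_R (\<lambda>q1 q2. ev2 tensor_V (\<lambda>v1 v2. ev2 tensor_V (\<lambda>w1 w2. cop (S_inv q1 * v2) (\<lambda>s1 s2.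
      asc (\<lambda>X Y Z. g (v1 * X * \<beta> * S Y * S (q2 * w1 * s1)) * lam (w2 * s2 * (Z * r)))))))"
    by (simp only: cop_counit_left[OF f3] int_p_R[OF f4])
  \<comment> \<open>The outer V is opened. Its second leg combines with S^-1(q1) to S^-1(f1 p1 q1),
    an argument to which \<open>V_antipode\<close> applies at the inner V.\<close>
  also have "\<dots> = ev2 q_R (\<lambda>q1 q2. ev2 drinfeld_f (\<lambda>f1 f2. ev2 p_R (\<lambda>p1 p2. ev2 tensor_V (\<lambda>w1 w2.
      cop (S_inv (f1 * p1 * q1)) (\<lambda>s1 s2. asc (\<lambda>X Y Z.
      g (S_inv (f2 * p2) * X * \<beta> * S Y * S (q2 * (w1 * s1))) * lam (w2 * s2 * (Z * r))))))))"
    by (simp only: mult.assoc[of _ _ "_ :: 'h"] , simp only: V_props(2)[OF b6[unfolded mult.assoc]], simp only: mult_simps)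
  also have "\<dots> = ev2 q_R (\<lambda>q1 q2. ev2 drinfeld_f (\<lambda>f1 f2. ev2 p_R (\<lambda>p1 p2. cop (f1 * p1 * q1) (\<lambda>c1 c2.
      ev2 drinfeld_f (\<lambda>f1' f2'. ev2 p_R (\<lambda>p1' p2'. asc (\<lambda>X Y Z.
      g (S_inv (f2 * p2) * X * \<beta> * S Y * S (q2 * S_inv (f2' * c2 * p2'))) * lam (S_inv (f1' * c1 * p1') * (Z * r)))))))))"
    by (simp only: V_antipode[OF b5])
  also have "\<dots> = ev2 q_R (\<lambda>q1 q2. ev2 drinfeld_f (\<lambda>f1 f2. ev2 p_R (\<lambda>p1 p2. cop (f1 * p1) (\<lambda>d1 d2. cop q1 (\<lambda>q11 q12.
      ev2 drinfeld_f (\<lambda>f1' f2'. ev2 p_R (\<lambda>p1' p2'. asc (\<lambda>X Y Z.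
      g (S_inv (f2 * p2) * X * \<beta> * S Y * S (q2 * S_inv (f2' * (d2 * q12) * p2'))) * lam (S_inv (f1' * (d1 * q11) * p1') * (Z * r))))))))))"
    by (simp only: cop_mult[OF b7])
  also have "\<dots> = ev2 drinfeld_f (\<lambda>f1 f2. ev2 p_R (\<lambda>p1 p2. asc (\<lambda>X Y Z. cop (f1 * p1) (\<lambda>d1 d2. ev2 drinfeld_f (\<lambda>f1' f2'.
      ev2 q_R (\<lambda>q1 q2. cop q1 (\<lambda>q11 q12. ev2 p_R (\<lambda>p1' p2'.
      g (S_inv (f2 * p2) * X * \<beta> * S Y * (f2' * d2 * (q12 * p2' * S q2))) * lam (S_inv (f1' * d1 * (q11 * p1')) * (Z * r))))))))))"
    unfolding mult_simps S_S_inv by (rule ev_reorder)+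
  also have "\<dots> = ev2 drinfeld_f (\<lambda>f1 f2. ev2 p_R (\<lambda>p1 p2. asc (\<lambda>X Y Z. cop (f1 * p1) (\<lambda>d1 d2. ev2 drinfeld_f (\<lambda>f1' f2'.
      asc (\<lambda>X' Y' Z'. cop X' (\<lambda>q11 q12. ev2 p_R (\<lambda>p1' p2'.
      g (S_inv (f2 * p2) * X * \<beta> * S Y * (f2' * d2 * (q12 * p2' * (S Y' * \<alpha> * Z')))) * lam (S_inv (f1' * d1 * (q11 * p1')) * (Z * r))))))))))"
    by (simp only: q_props(2)[OF b8], simp only: mult_simps S_S_inv)
  \<comment> \<open>The q_R of the definition of E and the p_R of the inner V annihilate each
    other.\<close>
  also have "\<dots> = ev2 drinfeld_f (\<lambda>f1 f2. ev2 p_R (\<lambda>p1 p2. asc (\<lambda>X Y Z. cop (f1 * p1) (\<lambda>d1 d2. ev2 drinfeld_f (\<lambda>f1' f2'.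
      g (S_inv (f2 * p2) * X * \<beta> * S Y * (f2' * d2 * 1)) * lam (S_inv (f1' * d1 * 1) * (Z * r)))))))"
    by (simp only: q_p_cancel[OF b9])
  also have "\<dots> = ev2 drinfeld_f (\<lambda>f1 f2. ev2 p_R (\<lambda>p1 p2. asc (\<lambda>X Y Z. cop (f1 * p1) (\<lambda>d1 d2. ev2 drinfeld_f (\<lambda>f1' f2'.
      g (S_inv (f2 * p2) * X * \<beta> * S Y * f2' * d2) * lam (S_inv (S Z * f1' * d1) * r))))))"
    by (simp only: mult_simps mult_1_right S_inv_S)
  \<comment> \<open>\<lambda> now sees only S^-1(b) r, so it yields \<mu>(b) by the modulus and
    \<lambda>(r) = 1. What remains is \<open>phi_form\<close> for the form g(v) \<mu>(u).\<close>
  also have "\<dots> = ev2 drinfeld_f (\<lambda>f1 f2. ev2 p_R (\<lambda>p1 p2. asc (\<lambda>X Y Z. cop (f1 * p1) (\<lambda>d1 d2. ev2 drinfeld_f (\<lambda>f1' f2'.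
      g (S_inv (f2 * p2) * X * \<beta> * S Y * f2' * d2) * \<mu> (S Z * f1' * d1))))))"
    by (simp only: modulus_right_integral[OF r \<mu>] lam_linear lam_r mult_1_right)
  also have "\<dots> = ev2 drinfeld_f (\<lambda>f1 f2. ev2 p_R (\<lambda>p1 p2. phi_form (\<lambda>u v. g v * \<mu> u) (f1 * p1) (f2 * p2)))"
    unfolding phi_form_def by (rule ev_reorder)+
  also have "\<dots> = g 1" by (simp only: phi_form_f_p[OF b10] mu_one mult_1_right)
  finally show ?thesis .
qed

section \<open>Nondegeneracy and the Nakayama automorphism\<close>

text \<open>Writing a = S(S^-1(a)), the Casimir identity moves S^-1(a) to the first leg, where r1
  \<lambda>(r2) = 1 applies.\<close>

lemma frobenius: "g \<in> dual \<Longrightarrow> ev2 (comult_bar r) (\<lambda>x y. g x * lam (y * a)) = g (S_inv a)"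
proof -
  assume g: "g \<in> dual"
  have b: "bilin (\<lambda>x y. g x * lam y)"
    by (simp add: lin_defs multilinear dualD[OF g] lam_linear algebra_simps)
  have f: "(\<lambda>x. g (x * S_inv a)) \<in> dual" by (simp add: lin_defs multilinear dualD[OF g])
  show ?thesis
    using casimir_right[OF r b, of "S_inv a"] cointegral_comult_bar[OF f] by simp
qed

lemma frobenius_nondegenerate: "(\<And>y. lam (y * a) = 0) \<Longrightarrow> a = 0"
proof -
  assume "\<And>y. lam (y * a) = 0"
  then have "g (S_inv a) = g 0" if "g \<in> dual" for g
    using frobenius[OF that, of a] by (simp add: ev2_form_0 dual_0 that)
  then have "S_inv a = 0" by (rule dual_eqI)
  then have "S (S_inv a) = S 0" by (rule arg_cong)
  moreover have "S 0 = 0" using S_linear(1)[of 0 0] by simp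
  ultimately show ?thesis by simp
qed

lemma frobenius_surj:
  assumes \<psi>: "\<psi> \<in> dual"
  shows "\<exists>c. \<forall>y. \<psi> y = lam (y * c)"
proof -
  \<comment> \<open>\<open>T\<close> stores the functional \<lambda>(y c) by its values at the
    basis. This gives an endomorphism of H, for which injectivity implies surjectivity.\<close>
  define T where "T c = (\<Sum>b\<in>B. smult H (lam (b * c)) b)" for c
  have co: "coord b (T c) = lam (b * c)" if "b \<in> B" for b c
  proof -
    have "coord b (T c) = (\<Sum>b'\<in>B. lam (b' * c) * coord b b')"
      unfolding T_def by (simp add: dual_sum[OF coord_dual] dualD(2)[OF coord_dual])
    also have "\<dots> = (\<Sum>b'\<in>B. if b' = b then lam (b * c) else 0)"
      by (intro sum.cong refl) (auto simp: representation_basis[OF independent_Basis])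
    finally show ?thesis using that by (simp add: finite_Basis)
  qed
  have lin: "Vector_Spaces.linear (smult H) (smult H) T"
    by (simp add: linear_scale vector_space_axioms T_def distrib_left lam_linear mult_scale_right
      scale_left_distrib sum.distrib scale_sum_right)
  have ext: "f y = lam (y * c)" if "f \<in> dual" "\<And>b. b \<in> B \<Longrightarrow> f b = lam (b * c)" for f c y
  proof -
    have "(\<lambda>y. lam (y * c)) \<in> dual" by (simp add: lin_defs multilinear lam_linear)
    then show ?thesis
      using dual_expand[OF that(1), of y] dual_expand[of "\<lambda>y. lam (y * c)" y] that(2) by simp
  qed
  have "inj T"
  proof (rule injI)
    fix c d assume T: "T c = T d"
    have "c - d = 0"
    proof (rule frobenius_nondegenerate)
      fix y
      have "0 = lam (y * (c - d))"
      proof (rule ext)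
        show "(\<lambda>y. 0) \<in> dual" by (simp add: dual_iff)
        fix b assume "b \<in> B"
        then have "lam (b * c) = lam (b * d)" using co T by metis
        then show "0 = lam (b * (c - d))"
          using lam_linear(1)[of "b * (c - d)" "b * d"] by (simp add: algebra_simps)
      qed
      then show "lam (y * (c - d)) = 0" by simp
    qed
    then show "c = d" by simp
  qed
  moreover have "finite_dimensional_vector_space_pair (smult H) B (smult H) B" by unfold_locales
  ultimately have "surj T"
    using finite_dimensional_vector_space_pair.linear_injective_imp_surjective[OF _ lin] by blast
  then obtain c where c: "(\<Sum>b\<in>B. smult H (\<psi> b) b) = T c" by (metis surjD)
  have "\<psi> b = lam (b * c)" if b: "b \<in> B" for b
  proof -
    have "coord b (\<Sum>b'\<in>B. smult H (\<psi> b') b') = (\<Sum>b'\<in>B. \<psi> b' * coord b b')"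
      by (simp add: dual_sum[OF coord_dual] dualD(2)[OF coord_dual])
    also have "\<dots> = (\<Sum>b'\<in>B. if b' = b then \<psi> b else 0)"
      by (intro sum.cong refl) (auto simp: representation_basis[OF independent_Basis])
    finally show ?thesis using b co[OF b, of c] c by (simp add: finite_Basis)
  qed
  then show ?thesis using ext[OF \<psi>] by blast
qed

text \<open>Every functional is \<lambda>(y c) for some c, and functionals separate points.\<close>

lemma frobenius_nondegenerate_left: "(\<And>y. lam (a * y) = lam (b * y)) \<Longrightarrow> a = b"
proof (rule dual_eqI)
  fix f assume *: "\<And>y. lam (a * y) = lam (b * y)" and "f \<in> dual"
  then obtain c where "\<And>y. f y = lam (y * c)" using frobenius_surj by blast
  then show "f a = f b" using * by simp
qed

text \<open>Paired with the Casimir element, both sides give a \<leftharpoonup> \<mu>, one by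
  \<open>casimir_left\<close>, the other by \<open>frobenius\<close>. The difference is \<lambda>(y
  c) for some c, and pairing it gives S^-1(c), which must vanish.\<close>

lemma frobenius_nakayama: "lam (S_inv a * y) = lam (y * S (a \<leftharpoonup> \<mu>))"
proof -
  define \<chi> where "\<chi> y = lam (S_inv a * y) - lam (y * S (a \<leftharpoonup> \<mu>))" for y
  have "\<chi> \<in> dual"
    by (simp add: \<chi>_def dual_iff multilinear lam_linear right_diff_distrib)
  then obtain c where c: "\<And>y. \<chi> y = lam (y * c)" using frobenius_surj by blast
  have "g (S_inv c) = g 0" if g: "g \<in> dual" for g
  proof -
    have b: "bilin (\<lambda>x y. g x * lam y)"
      by (simp add: lin_defs multilinear dualD[OF g] lam_linear algebra_simps)
    have f: "(\<lambda>x. g (a2 * x)) \<in> dual" for a2 by (simp add: lin_defs multilinear dualD[OF g])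
    have "ev2 (comult_bar r) (\<lambda>x y. g x * lam (S_inv a * y)) = cop a (\<lambda>a1 a2. \<mu> a1 * g a2)"
      by (simp add: casimir_left[OF r b modulus_right_integral[OF r \<mu>]] cointegral_comult_bar[OF f])
    also have "\<dots> = ev2 (comult_bar r) (\<lambda>x y. g x * lam (y * S (a \<leftharpoonup> \<mu>)))"
      by (simp add: frobenius[OF g] hit_right_ev[OF mu_dual g])
    moreover have "ev2 (comult_bar r) (\<lambda>x y. g x * lam (S_inv a * y)) =
      ev2 (comult_bar r) (\<lambda>x y. g x * \<chi> y + g x * lam (y * S (a \<leftharpoonup> \<mu>)))"
      by (simp add: \<chi>_def algebra_simps)
    ultimately have "ev2 (comult_bar r) (\<lambda>x y. g x * \<chi> y) = 0"
      by (simp add: ev2_form(1))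
    then show ?thesis by (simp add: c frobenius[OF g] dual_0[OF g])
  qed
  then have "S_inv c = 0" by (rule dual_eqI)
  then have "S (S_inv c) = S 0" by (rule arg_cong)
  moreover have "S 0 = 0" using S_linear(1)[of 0 0] by simp
  ultimately have "c = 0" by simp
  then have "\<chi> y = 0" by (simp add: c dual_0[OF lam_dual])
  then show ?thesis by (simp add: \<chi>_def)
qed

text \<open>\<lambda>(a y) = \<lambda>(y S(S_\<mu>(a))), so S_\<mu>(a) determines \<lambda>(a y) for
  all y, hence a. It is used to identify the value of \<open>inv\<close>.\<close>

lemma S_mod_inj: "S_mod \<mu> a = S_mod \<mu> b \<Longrightarrow> a = b"
  using frobenius_nakayama[of "S a"] frobenius_nakayama[of "S b"]
  by (intro frobenius_nondegenerate_left) (simp add: S_mod_def)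

section \<open>The comodulus and Radford's formula\<close>

lemma comodulus_ev: "g \<in> dual \<Longrightarrow> g (comodulus lam r) = ev2 (comult_bar r) (\<lambda>x y. lam x * g y)"
  using lift2_scalar[OF comult_bar_props(1), of g "\<lambda>x y. smult H (lam x) y" r]
  by (simp add: comodulus_def linear_scale vector_space_axioms lam_linear dualD(2)[of g]
    scale_left_distrib scale_right_distrib mult.commute)

lemma v_element_ev: "g \<in> dual \<Longrightarrow> g (v_element lam r) = ev2 (comult_bar r) (\<lambda>x y. g x * lam (S y))"
  using lift2_scalar[OF comult_bar_props(1), of g "\<lambda>x y. smult H (lam (S y)) x" r]
  by (simp add: v_element_def linear_scale vector_space_axioms lam_linear S_linear dualD(2)[of g]
    scale_left_distrib scale_right_distrib mult.commute)

text \<open>\<lambda>(u x) = \<lambda>(r1) \<lambda>(r2 x), and r1 \<lambda>(r2 x) = S^-1(x) by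
  \<open>frobenius\<close>.\<close>

lemma lam_S_inv: "lam (S_inv x) = lam (comodulus lam r * x)"
proof -
  have "(\<lambda>t. lam (t * x)) \<in> dual" by (simp add: lin_defs multilinear lam_linear)
  from comodulus_ev[OF this] show ?thesis by (simp add: frobenius[OF lam_dual])
qed

text \<open>\<lambda>(S(y)) = \<lambda>(y c) for some c, and then v = r1 \<lambda>(S(r2)) = r1
  \<lambda>(r2 c) = S^-1(c).\<close>

lemma lam_S: "lam (S y) = lam (y * S (v_element lam r))"
proof -
  have "(\<lambda>y. lam (S y)) \<in> dual" by (simp add: lin_defs multilinear lam_linear)
  then obtain c where c: "\<And>y. lam (S y) = lam (y * c)" using frobenius_surj by blast
  have "v_element lam r = S_inv c"
    by (rule dual_eqI) (simp add: v_element_ev c frobenius)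
  then show ?thesis by (simp add: c)
qed

text \<open>The two one-sided inverse relations come from S S^-1 = id and S^-1 S = id, read through
  \<open>lam_S\<close> and \<open>lam_S_inv\<close>; each composite must leave \<lambda>
  unchanged.\<close>

lemma radford:
  defines "u \<equiv> comodulus lam r" and "v \<equiv> v_element lam r"
  shows "u * S (S v) = 1" and "S (S v) * u = 1"
    and "S (S v) * a * u = S (S (S_mod \<mu> (S_mod \<mu> a)))"
    and "inv (S_mod \<mu> \<circ> S_mod \<mu>) v = S (S v)"
proof -
  show 1: "u * S (S v) = 1"
  proof (rule frobenius_nondegenerate_left)
    fix x
    have "lam (1 * x) = lam (S_inv x * S v)" using lam_S[of "S_inv x"] by (simp add: v_def)
    also have "\<dots> = lam (S_inv (S (S v) * x))" by (simp add: S_inv_mult)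
    finally show "lam (u * S (S v) * x) = lam (1 * x)" by (simp add: lam_S_inv u_def mult.assoc)
  qed
  have "S_inv u * S v - 1 = 0"
  proof (rule frobenius_nondegenerate)
    fix y
    have "lam y = lam (u * S y)" using lam_S_inv[of "S y"] by (simp add: u_def)
    also have "\<dots> = lam (S (y * S_inv u))" by (simp add: antipode_mult)
    also have "\<dots> = lam (y * (S_inv u * S v))" by (simp add: lam_S v_def mult.assoc)
    finally show "lam (y * (S_inv u * S v - 1)) = 0"
      using lam_linear(1)[of "y * (S_inv u * S v - 1)" y] by (simp add: algebra_simps)
  qed
  then have "S (S_inv u * S v) = S 1" by simp
  then show 2: "S (S v) * u = 1" by (simp add: antipode_mult antipode_one)
  have 3: "a * u = u * S (S (S_mod \<mu> (S_mod \<mu> a)))" for a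
  proof (rule frobenius_nondegenerate_left)
    fix y
    define a' where "a' = S_mod \<mu> a"
    have "lam (a * u * y) = lam (u * y * S a')"
      using frobenius_nakayama[of "S a" "u * y"] by (simp add: a'_def S_mod_def mult.assoc)
    also have "\<dots> = lam (S_inv (S a') * S_inv y)"
      by (simp add: mult.assoc u_def lam_S_inv[symmetric] S_inv_mult del: S_inv_S)
    also have "\<dots> = lam (S_inv y * S (S_mod \<mu> a'))"
      using frobenius_nakayama[of "S a'" "S_inv y"] by (simp add: S_mod_def)
    also have "\<dots> = lam (S_inv (S (S (S_mod \<mu> a')) * y))" by (simp add: S_inv_mult)
    also have "\<dots> = lam (u * S (S (S_mod \<mu> a')) * y)" by (simp add: lam_S_inv u_def mult.assoc)
    finally show "lam (a * u * y) = lam (u * S (S (S_mod \<mu> (S_mod \<mu> a))) * y)" by (simp add: a'_def)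
  qed
  have 4: "S (S v) * a * u = S (S (S_mod \<mu> (S_mod \<mu> a)))" for a
  proof -
    have "S (S v) * a * u = S (S v) * (a * u)" by (simp only: mult.assoc)
    also have "\<dots> = S (S v) * u * S (S (S_mod \<mu> (S_mod \<mu> a)))" by (simp only: 3[of a] mult.assoc)
    finally show ?thesis by (simp add: 2)
  qed
  show "S (S v) * a * u = S (S (S_mod \<mu> (S_mod \<mu> a)))" by (rule 4)
  \<comment> \<open>Conjugation by u fixes u^-1 = S^2(v). By the formula just proved
    S^2(S_\<mu>^2(S^2(v))) = S^2(v), and cancelling S^2 gives S_\<mu>^2(S^2(v)) = v.\<close>
  have "S (S v) = S (S (S_mod \<mu> (S_mod \<mu> (S (S v)))))"
    using 4[of "S (S v)"] by (simp add: mult.assoc 2)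
  then have "(S_mod \<mu> \<circ> S_mod \<mu>) (S (S v)) = v" by (simp add: S_inj)
  moreover have "inj (S_mod \<mu> \<circ> S_mod \<mu>)" by (intro injI) (auto dest!: S_mod_inj)
  ultimately show "inv (S_mod \<mu> \<circ> S_mod \<mu>) v = S (S v)" by (metis inv_f_f)
qed

end

end

theorem proposition6p2:
  fixes H :: "('k::field, 'h::ring_1) quasi_hopf_data"
    and B :: "'h set"
    and \<mu> lam :: "'h \<Rightarrow> 'k"
    and r u v :: 'h
    and S S\<^sub>\<mu> :: "'h \<Rightarrow> 'h"
  assumes "quasi_hopf_algebra H"
    and "finite_dimensional_vector_space (smult H) B"
    and "quasi_hopf_algebra.modulus H \<mu>"
    and "quasi_hopf_algebra.left_cointegral H B lam"
    and "quasi_hopf_algebra.right_integral H r"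
    and "lam r = 1"
  defines "S \<equiv> antipode H"
    and "S\<^sub>\<mu> \<equiv> quasi_hopf_algebra.S_mod H \<mu>"
    and "u \<equiv> quasi_hopf_algebra.comodulus H lam r"
    and "v \<equiv> quasi_hopf_algebra.v_element H lam r"
  shows "\<exists>u_inv. u * u_inv = 1 \<and> u_inv * u = 1
      \<and> u_inv = S (S v) \<and> u_inv = inv (S\<^sub>\<mu> \<circ> S\<^sub>\<mu>) v
      \<and> (\<forall>a. u_inv * a * u = S (S (S\<^sub>\<mu> (S\<^sub>\<mu> a))))"
proof -
  interpret Q: quasi_hopf_algebra H by fact
  interpret V: finite_dimensional_vector_space "smult H" B by fact
  interpret finite_quasi_hopf H B by unfold_locales
  show ?thesis
    unfolding assms(7-10)
    using radford[OF assms(3-6)] by (intro exI[of _ "antipode H (antipode H (Q.v_element lam r))"]) auto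
qed

end
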